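(* Let $k\ge 0$ be a fixed integer and let $p,q\in(1,\infty)$. For each $m\in\mathbb{N}$, let $\psi_m^D$ be the orthogonal Daubechies wavelet of order $m$, and let $C_{k;p,q}(\psi_m^D)$ be the quantity defined in the context. Then $$\lim_{m\to\infty} C_{k;p,q}(\psi_m^D)=\frac{(2\pi)^{1/p-1/q}}{\pi^k}\left(\frac{1-2^{1-pk}}{pk-1}\right)^{1/p}.$$
   Context: $L_p=L_p(\mathbb{R})$ is the usual space of measurable functions $f:\mathbb{R}\to\mathbb{C}$ with norm $\|f\|_p=\left(\int_{\mathbb{R}}|f(x)|^p\,dx\right)^{1/p}$ for $1\le p<\infty$. Set $(f,g)=\int_{\mathbb{R}} f(x)\overline{g(x)}\,dx$. The Fourier transform is $\hat f(\omega)=(f)^{\wedge}(\omega)=\frac{1}{\sqrt{2\pi}}\int_{\mathbb{R}} f(x)e^{-i\omega x}\,dx$ (extended to $L_2(\mathbb{R})$ as usual). For an integer $k\ge 0$ and $p\in(1,\infty)$, set $$W_{2,p}^k=\left\{f\in L_2(\mathbb{R}):\ \left\|(i\omega)^k\hat f(\omega)\right\|_p\le 1\right\},$$ where the norm is taken in the variable $\omega$. For $p,q\in(1,\infty)$, $p'=\frac{p}{p-1}$, and a function $\psi\in L_2(\mathbb{R})$, set $$C_{k;p,q}(\psi)=\sup_{f\in W_{2,p'}^k}\frac{|(\psi,f)|}{\|\hat\psi\|_q}.$$ Daubechies wavelets: for $m\in\mathbb{N}$ ($m\ge 1$), a Daubechies filter is a trigonometric polynomial $$H_m(\omega)=2^{-1/2}\sum_{l=0}^{2m-1}h_m(l)e^{il\omega},\qquad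 h_m(l)\in\mathbb{R},$$ with $H_m(0)=1$, satisfying $$|H_m(\omega)|^2=\left(\cos^2\frac{\omega}{2}\right)^m P_{m-1}\left(\sin^2\frac{\omega}{2}\right),\qquad P_{m-1}(x)=\sum_{j=0}^{m-1}\binom{m-1+j}{j}x^j.$$ For each $m$ such a filter $H_m$ is fixed. The orthogonal scaling function $\varphi_m^D$ is the function with Fourier transform $$(\varphi_m^D)^{\wedge}(\omega)=\frac{1}{\sqrt{2\pi}}\prod_{l=1}^{\infty}H_m(\omega 2^{-l}),$$ and the orthogonal Daubechies wavelet $\psi_m^D$ is the function with Fourier transform $$(\psi_m^D)^{\wedge}(\omega)=e^{-\frac{i\omega}{2}}\,\overline{H_m\left(\frac{\omega}{2}+\pi\right)}\,(\varphi_m^D)^{\wedge}\left(\frac{\omega}{2}\right).$$ *)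

theory Defs
  imports "HOL-Analysis.Analysis"
begin

text \<open>The norm takes values in \<^typ>\<open>ennreal\<close>, so that it is \<open>\<infinity>\<close>, and not a junk value, for a
  measurable function that is not p-integrable.  Functions are not identified almost everywhere.\<close>

definition Lp_norm :: "real \<Rightarrow> (real \<Rightarrow> complex) \<Rightarrow> ennreal" where
  "Lp_norm p f =
     (let I = (\<integral>\<^sup>+x. ennreal (cmod (f x) powr p) \<partial>lebesgue)
      in if I = \<infinity> then \<infinity> else ennreal (enn2real I powr (1 / p)))"

definition Lp :: "real \<Rightarrow> (real \<Rightarrow> complex) set" where
  "Lp p = {f \<in> borel_measurable lebesgue. Lp_norm p f < \<infinity>}"

definition L2_inner :: "(real \<Rightarrow> complex) \<Rightarrow> (real \<Rightarrow> complex) \<Rightarrow> complex" where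
  "L2_inner f g = (LINT x|lebesgue. f x * cnj (g x))"

definition fourier_L1 :: "(real \<Rightarrow> complex) \<Rightarrow> real \<Rightarrow> complex" where
  "fourier_L1 f \<omega> = 1 / complex_of_real (sqrt (2 * pi)) *
     (LINT x|lebesgue. f x * exp (- (\<i> * complex_of_real \<omega> * complex_of_real x)))"

text \<open>Extension by continuity from the dense subspace \<^term>\<open>Lp 1 \<inter> Lp 2\<close> of \<^term>\<open>Lp 2\<close>: the
  relation is the closure of the graph of the integral transform.  By Plancherel's theorem it
  relates each element of \<^term>\<open>Lp 2\<close> to a function that is unique almost everywhere.\<close>

definition is_fourier_L2 :: "(real \<Rightarrow> complex) \<Rightarrow> (real \<Rightarrow> complex) \<Rightarrow> bool" where
  "is_fourier_L2 f g \<longleftrightarrow> g \<in> Lp 2 \<and>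
     (\<exists>u :: nat \<Rightarrow> real \<Rightarrow> complex. (\<forall>n. u n \<in> Lp 1 \<inter> Lp 2) \<and>
        (\<lambda>n. Lp_norm 2 (\<lambda>x. u n x - f x)) \<longlonglongrightarrow> 0 \<and>
        (\<lambda>n. Lp_norm 2 (\<lambda>\<omega>. fourier_L1 (u n) \<omega> - g \<omega>)) \<longlonglongrightarrow> 0)"

text \<open>An arbitrary representative of the Fourier transform of an element of \<^term>\<open>Lp 2\<close>;
  its values at individual points carry no information.\<close>

definition fourier :: "(real \<Rightarrow> complex) \<Rightarrow> real \<Rightarrow> complex" where
  "fourier f = (SOME g. is_fourier_L2 f g)"

definition W2 :: "nat \<Rightarrow> real \<Rightarrow> (real \<Rightarrow> complex) set" where
  "W2 k p = {f \<in> Lp 2. Lp_norm p (\<lambda>\<omega>. (\<i> * complex_of_real \<omega>) ^ k * fourier f \<omega>) \<le> 1}"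

text \<open>The supremum is taken in \<^typ>\<open>ennreal\<close>, since it can be infinite (for instance when
  \<open>\<psi>\<close> has too few vanishing moments).\<close>

definition C_const :: "nat \<Rightarrow> real \<Rightarrow> real \<Rightarrow> (real \<Rightarrow> complex) \<Rightarrow> ennreal" where
  "C_const k p q \<psi> =
     (SUP f\<in>W2 k (p / (p - 1)). ennreal (cmod (L2_inner \<psi> f)) / Lp_norm q (fourier \<psi>))"

text \<open>A filter of order \<open>m\<close> is given by its coefficients \<open>h 0, \<dots>, h (2 * m - 1)\<close>;
  the other values of \<open>h\<close> are irrelevant.\<close>

definition filter_symbol :: "nat \<Rightarrow> (nat \<Rightarrow> real) \<Rightarrow> real \<Rightarrow> complex" where
  "filter_symbol m h \<omega> = 1 / complex_of_real (sqrt 2) *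
     (\<Sum>l<2 * m. complex_of_real (h l) * exp (\<i> * of_nat l * complex_of_real \<omega>))"

definition daubechies_poly :: "nat \<Rightarrow> real \<Rightarrow> real" where
  "daubechies_poly n x = (\<Sum>j=0..n. real ((n + j) choose j) * x ^ j)"

definition daubechies_filter :: "nat \<Rightarrow> (nat \<Rightarrow> real) \<Rightarrow> bool" where
  "daubechies_filter m h \<longleftrightarrow>
     filter_symbol m h 0 = 1 \<and>
     (\<forall>\<omega>. (cmod (filter_symbol m h \<omega>))\<^sup>2 =
        ((cos (\<omega> / 2))\<^sup>2) ^ m * daubechies_poly (m - 1) ((sin (\<omega> / 2))\<^sup>2))"

definition scaling_function :: "nat \<Rightarrow> (nat \<Rightarrow> real) \<Rightarrow> (real \<Rightarrow> complex) \<Rightarrow> bool" where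
  "scaling_function m h \<phi> \<longleftrightarrow> \<phi> \<in> Lp 2 \<and>
     (AE \<omega> in lebesgue. fourier \<phi> \<omega> =
        1 / complex_of_real (sqrt (2 * pi)) * (\<Prod>l. filter_symbol m h (\<omega> / 2 ^ Suc l)))"

definition daubechies_wavelet ::
    "nat \<Rightarrow> (nat \<Rightarrow> real) \<Rightarrow> (real \<Rightarrow> complex) \<Rightarrow> (real \<Rightarrow> complex) \<Rightarrow> bool" where
  "daubechies_wavelet m h \<phi> \<psi> \<longleftrightarrow> \<psi> \<in> Lp 2 \<and>
     (AE \<omega> in lebesgue. fourier \<psi> \<omega> =
        exp (- (\<i> * complex_of_real \<omega> / 2)) * cnj (filter_symbol m h (\<omega> / 2 + pi)) *
        fourier \<phi> (\<omega> / 2))"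

end

theory Submission
  imports Defs "HOL-Probability.Probability"
begin

text \<open>By Plancherel's theorem \<open>C_const k p q \<psi>\<close> is the operator norm of a duality pairing, so that
  Hoelder's inequality and its equality case give the quotient of the p-norm of \<open>\<omega>\<^sup>-\<^sup>k \<psi>^\<close> and the
  q-norm of \<open>\<psi>^\<close>.  The squared modulus of the filter is a binomial tail probability, which
  tends to the indicator of \<open>\<bar>\<omega>\<bar> < \<pi> / 2\<close>; hence the modulus of \<open>\<psi>^\<close> tends to \<open>(2 \<pi>)\<^sup>-\<^sup>1\<^sup>/\<^sup>2\<close> on
  \<open>\<pi> < \<bar>\<omega>\<bar> < 2 \<pi>\<close> and to 0 elsewhere.  Dominated convergence applies because \<open>\<omega>\<^sup>-\<^sup>k \<psi>^\<close> is bounded near 0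
  and \<open>\<psi>^\<close> decays like \<open>1 / \<bar>\<omega>\<bar>\<close>, both uniformly in the order of the filter.\<close>

subsection \<open>Squared norms on the line\<close>

text \<open>\<open>fourier\<close> is an arbitrary representative picked by \<open>SOME\<close>, so
  nothing can be said about it before existence, uniqueness, inversion and Parseval hold on
  \<open>Lp 2\<close>. These are derived from Gaussian averaging, with squared norms throughout so
  that roots and Minkowski's inequality are avoided. Two points shape the rest. The extremal
  function of Hoelder's inequality on the whole line would need its own proof of square
  integrability; the lower bound is therefore taken over the octave
  \<open>\<pi> < |\<omega>| < 2 \<pi>\<close> only. Nothing is lost, since the integrals over the
  octave and over the line have the same limit. Secondly, \<open>p\<close> and \<open>q\<close> may
  be arbitrarily close to 1, and a majorant of size \<open>1 / |\<omega>|\<close> is just good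
  enough for every exponent above 1. It must not depend on the filters, which are determined only up
  to phase: all estimates use the squared modulus alone, and the infinite product is controlled
  along the orbit of the angle doubling map, not factor by factor.\<close>

definition L2_normsq :: "(real \<Rightarrow> complex) \<Rightarrow> ennreal" where
  "L2_normsq f = (\<integral>\<^sup>+x. ennreal ((cmod (f x))\<^sup>2) \<partial>lebesgue)"

lemma Lp_norm_2_eq: "Lp_norm 2 f = (if L2_normsq f = \<infinity> then \<infinity> else ennreal (sqrt (enn2real (L2_normsq f))))"
proof -
  have "cmod z powr 2 = (cmod z)\<^sup>2" for z by simp
  then show ?thesis
    unfolding Lp_norm_def L2_normsq_def Let_def by (simp add: powr_half_sqrt)
qed

lemma Lp_norm_2_power: "(Lp_norm 2 f)\<^sup>2 = L2_normsq f"
proof (cases "L2_normsq f = \<infinity>")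
  case False
  then show ?thesis by (simp add: Lp_norm_2_eq ennreal_power less_top)
qed (simp add: Lp_norm_2_eq)

text \<open>Transfers the convergences in \<open>is_fourier_L2\<close> to squared norms, which add
  up without roots.\<close>

lemma Lp_norm_2_tendsto_0:
  "(\<lambda>n. Lp_norm 2 (f n)) \<longlonglongrightarrow> 0 \<longleftrightarrow> (\<lambda>n. L2_normsq (f n)) \<longlonglongrightarrow> 0"
proof
  assume "(\<lambda>n. Lp_norm 2 (f n)) \<longlonglongrightarrow> 0"
  then have "(\<lambda>n. Lp_norm 2 (f n) * Lp_norm 2 (f n)) \<longlonglongrightarrow> 0 * 0"
    by (intro tendsto_mult_ennreal) auto
  then show "(\<lambda>n. L2_normsq (f n)) \<longlonglongrightarrow> 0"
    by (simp add: Lp_norm_2_power[symmetric] power2_eq_square)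
next
  assume L: "(\<lambda>n. L2_normsq (f n)) \<longlonglongrightarrow> 0"
  \<comment> \<open>Eventually the squared norms are finite, so \<open>Lp_norm\<close> is given by
    its real branch, where the square root is continuous.\<close>
  then have "\<forall>\<^sub>F n in sequentially. L2_normsq (f n) < \<infinity>"
    using order_tendstoD(2)[OF L, of \<infinity>] by simp
  moreover have "(\<lambda>n. ennreal (sqrt (enn2real (L2_normsq (f n))))) \<longlonglongrightarrow> ennreal (sqrt (enn2real 0))"
    using tendsto_enn2real[of "\<lambda>n. L2_normsq (f n)" 0] L
    by (intro tendsto_ennrealI tendsto_real_sqrt) auto
  ultimately show "(\<lambda>n. Lp_norm 2 (f n)) \<longlonglongrightarrow> 0"
    by (subst tendsto_cong[where g = "\<lambda>n. ennreal (sqrt (enn2real (L2_normsq (f n))))"])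
       (auto simp: Lp_norm_2_eq elim: eventually_mono)
qed

lemma Lp_2_iff: "f \<in> Lp 2 \<longleftrightarrow> f \<in> borel_measurable lebesgue \<and> L2_normsq f < \<infinity>"
  by (auto simp: Lp_def Lp_norm_2_eq less_top)

lemma Lp_1_iff: "f \<in> Lp 1 \<longleftrightarrow> integrable lebesgue f"
proof -
  have "Lp_norm 1 f = (\<integral>\<^sup>+x. ennreal (cmod (f x)) \<partial>lebesgue)"
    by (simp add: Lp_norm_def Let_def less_top)
  then show ?thesis by (auto simp: Lp_def integrable_iff_bounded)
qed

lemma is_fourier_L2_iff:
  "is_fourier_L2 f g \<longleftrightarrow> g \<in> Lp 2 \<and>
     (\<exists>u :: nat \<Rightarrow> real \<Rightarrow> complex. (\<forall>n. u n \<in> Lp 1 \<inter> Lp 2) \<and>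
        (\<lambda>n. L2_normsq (\<lambda>x. u n x - f x)) \<longlonglongrightarrow> 0 \<and>
        (\<lambda>n. L2_normsq (\<lambda>\<omega>. fourier_L1 (u n) \<omega> - g \<omega>)) \<longlonglongrightarrow> 0)"
  unfolding is_fourier_L2_def Lp_norm_2_tendsto_0 ..

lemma L2_normsq_cong_AE: "AE x in lebesgue. f x = g x \<Longrightarrow> L2_normsq f = L2_normsq g"
  unfolding L2_normsq_def by (rule nn_integral_cong_AE) auto

lemma L2_normsq_eq_0_iff:
  assumes "f \<in> borel_measurable lebesgue"
  shows "L2_normsq f = 0 \<longleftrightarrow> (AE x in lebesgue. f x = 0)"
  using assms unfolding L2_normsq_def by (subst nn_integral_0_iff_AE) auto

lemma L2_normsq_scale:
  assumes "f \<in> borel_measurable lebesgue"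
  shows "L2_normsq (\<lambda>x. c * f x) = ennreal ((cmod c)\<^sup>2) * L2_normsq f"
  using assms unfolding L2_normsq_def
  by (subst nn_integral_cmult[symmetric])
     (auto simp: norm_mult power_mult_distrib ennreal_mult)

lemma L2_normsq_minus_commute: "L2_normsq (\<lambda>x. f x - g x) = L2_normsq (\<lambda>x. g x - f x)"
  unfolding L2_normsq_def by (simp add: norm_minus_commute)

text \<open>The cross term \<open>2 * cmod a * cmod b\<close> is at most
  \<open>t * (cmod a)^2 + (cmod b)^2 / t\<close>. The free weight lets the constant in front of the
  main term come arbitrarily close to 1.\<close>

lemma L2_normsq_add_le:
  assumes f: "f \<in> borel_measurable lebesgue" and g: "g \<in> borel_measurable lebesgue" and t: "t > 0"
  shows "L2_normsq (\<lambda>x. f x + g x) \<le> ennreal (1 + t) * L2_normsq f + ennreal (1 + 1 / t) * L2_normsq g"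
proof -
  have *: "(cmod (a + b))\<^sup>2 \<le> (1 + t) * (cmod a)\<^sup>2 + (1 + 1 / t) * (cmod b)\<^sup>2" for a b
  proof -
    have "(cmod (a + b))\<^sup>2 \<le> (cmod a + cmod b)\<^sup>2"
      by (simp add: norm_triangle_ineq power_mono)
    also have "\<dots> = (1 + t) * (cmod a)\<^sup>2 + (1 + 1 / t) * (cmod b)\<^sup>2 - (t * cmod a - cmod b)\<^sup>2 / t"
      using t by (simp add: field_simps power2_eq_square)
    also have "\<dots> \<le> (1 + t) * (cmod a)\<^sup>2 + (1 + 1 / t) * (cmod b)\<^sup>2" using t by simp
    finally show ?thesis .
  qed
  have "L2_normsq (\<lambda>x. f x + g x) \<le> (\<integral>\<^sup>+x. ennreal (1 + t) * ennreal ((cmod (f x))\<^sup>2) +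
      ennreal (1 + 1 / t) * ennreal ((cmod (g x))\<^sup>2) \<partial>lebesgue)"
    unfolding L2_normsq_def using * t
    by (intro nn_integral_mono)
       (auto simp: ennreal_mult[symmetric] ennreal_plus[symmetric] simp del: ennreal_plus intro!: ennreal_leI)
  also have "\<dots> = ennreal (1 + t) * L2_normsq f + ennreal (1 + 1 / t) * L2_normsq g"
    using f g unfolding L2_normsq_def by (subst nn_integral_add) (auto simp: nn_integral_cmult)
  finally show ?thesis .
qed

lemma L2_normsq_add_le2:
  assumes "f \<in> borel_measurable lebesgue" "g \<in> borel_measurable lebesgue"
  shows "L2_normsq (\<lambda>x. f x + g x) \<le> 2 * L2_normsq f + 2 * L2_normsq g"
  using L2_normsq_add_le[OF assms, of 1] by simp

lemma Lp_2_add: "f \<in> Lp 2 \<Longrightarrow> g \<in> Lp 2 \<Longrightarrow> (\<lambda>x. f x + g x) \<in> Lp 2"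
  using L2_normsq_add_le2[of f g]
  by (auto simp: Lp_2_iff ennreal_mult_less_top intro: le_less_trans)

lemma Lp_2_scale: "f \<in> Lp 2 \<Longrightarrow> (\<lambda>x. c * f x) \<in> Lp 2"
  by (auto simp: Lp_2_iff L2_normsq_scale ennreal_mult_less_top)

lemma Lp_2_diff: "f \<in> Lp 2 \<Longrightarrow> g \<in> Lp 2 \<Longrightarrow> (\<lambda>x. f x - g x) \<in> Lp 2"
  using Lp_2_add[OF _ Lp_2_scale[of g "-1"]] by simp

lemma L2_normsq_tendsto_0_add:
  assumes "\<And>n. f n \<in> borel_measurable lebesgue" "\<And>n. g n \<in> borel_measurable lebesgue"
    and "(\<lambda>n. L2_normsq (f n)) \<longlonglongrightarrow> 0" "(\<lambda>n. L2_normsq (g n)) \<longlonglongrightarrow> 0"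
  shows "(\<lambda>n. L2_normsq (\<lambda>x. f n x + g n x)) \<longlonglongrightarrow> 0"
proof (rule tendsto_sandwich[OF _ _ tendsto_const])
  show "\<forall>\<^sub>F n in sequentially. L2_normsq (\<lambda>x. f n x + g n x) \<le> 2 * L2_normsq (f n) + 2 * L2_normsq (g n)"
    using assms(1,2) by (intro always_eventually allI L2_normsq_add_le2) auto
  have "(\<lambda>n. 2 * L2_normsq (f n) + 2 * L2_normsq (g n)) \<longlonglongrightarrow> 2 * 0 + 2 * 0"
    by (intro tendsto_add tendsto_mult_ennreal tendsto_const assms) auto
  then show "(\<lambda>n. 2 * L2_normsq (f n) + 2 * L2_normsq (g n)) \<longlonglongrightarrow> 0" by simp
qed auto

lemma L2_normsq_tendsto_0_scale:
  assumes "\<And>n. f n \<in> borel_measurable lebesgue" "(\<lambda>n. L2_normsq (f n)) \<longlonglongrightarrow> 0"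
  shows "(\<lambda>n. L2_normsq (\<lambda>x. c * f n x)) \<longlonglongrightarrow> 0"
proof -
  have "(\<lambda>n. ennreal ((cmod c)\<^sup>2) * L2_normsq (f n)) \<longlonglongrightarrow> ennreal ((cmod c)\<^sup>2) * 0"
    by (intro tendsto_mult_ennreal tendsto_const assms) auto
  then show ?thesis using assms(1) by (simp add: L2_normsq_scale)
qed

text \<open>Letting the weight in \<open>L2_normsq_add_le\<close> tend to zero replaces Minkowski's inequality.\<close>

lemma L2_normsq_le_of_approx:
  assumes f: "\<And>n. f n \<in> borel_measurable lebesgue" "F \<in> borel_measurable lebesgue"
    and g: "\<And>n. g n \<in> borel_measurable lebesgue" "G \<in> borel_measurable lebesgue"
    and fF: "(\<lambda>n. L2_normsq (\<lambda>x. f n x - F x)) \<longlonglongrightarrow> 0" and gG: "(\<lambda>n. L2_normsq (\<lambda>x. g n x - G x)) \<longlonglongrightarrow> 0"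
    and le: "\<And>n. L2_normsq (g n) \<le> L2_normsq (f n)" and fin: "L2_normsq F < \<infinity>"
  shows "L2_normsq G \<le> L2_normsq F"
proof -
  \<comment> \<open>The weight \<open>t\<close> is kept fixed while \<open>n\<close> grows: the
    error terms carry the large factor \<open>1 + 1 / t\<close> but tend to 0. Only afterwards does
    \<open>t\<close> shrink.\<close>
  have step: "L2_normsq G \<le> ennreal ((1 + t) * (1 + t)) * L2_normsq F" if t: "t > 0" for t
  proof -
    have "L2_normsq G \<le> ennreal (1 + t) * (ennreal (1 + t) * L2_normsq F + ennreal (1 + 1 / t) * L2_normsq (\<lambda>x. f n x - F x)) +
        ennreal (1 + 1 / t) * L2_normsq (\<lambda>x. g n x - G x)" for n
    proof -
      have "L2_normsq G \<le> ennreal (1 + t) * L2_normsq (g n) + ennreal (1 + 1 / t) * L2_normsq (\<lambda>x. G x - g n x)"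
        using L2_normsq_add_le[of "g n" "\<lambda>x. G x - g n x" t] f g t by simp
      also have "L2_normsq (g n) \<le> ennreal (1 + t) * L2_normsq F + ennreal (1 + 1 / t) * L2_normsq (\<lambda>x. f n x - F x)"
        using L2_normsq_add_le[of F "\<lambda>x. f n x - F x" t] f g t le[of n] by simp
      finally show ?thesis by (simp add: L2_normsq_minus_commute[of G] mult_left_mono)
    qed
    moreover have "(\<lambda>n. ennreal (1 + t) * (ennreal (1 + t) * L2_normsq F + ennreal (1 + 1 / t) * L2_normsq (\<lambda>x. f n x - F x)) +
        ennreal (1 + 1 / t) * L2_normsq (\<lambda>x. g n x - G x)) \<longlonglongrightarrow>
        ennreal (1 + t) * (ennreal (1 + t) * L2_normsq F + ennreal (1 + 1 / t) * 0) + ennreal (1 + 1 / t) * 0"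
      using fin t by (intro tendsto_add tendsto_mult_ennreal tendsto_const fF gG) (auto simp: less_top)
    ultimately have "L2_normsq G \<le> ennreal (1 + t) * (ennreal (1 + t) * L2_normsq F + ennreal (1 + 1 / t) * 0) + ennreal (1 + 1 / t) * 0"
      by (intro LIMSEQ_le_const) auto
    then show ?thesis using t by (simp add: mult.assoc ennreal_mult)
  qed
  have "(\<lambda>n. ennreal ((1 + 1 / real (Suc n)) * (1 + 1 / real (Suc n))) * L2_normsq F) \<longlonglongrightarrow> ennreal ((1 + 0) * (1 + 0)) * L2_normsq F"
    using fin
    by (intro tendsto_mult_ennreal tendsto_const tendsto_ennrealI tendsto_mult tendsto_add LIMSEQ_Suc lim_1_over_n) auto
  then have "L2_normsq G \<le> ennreal ((1 + 0) * (1 + 0)) * L2_normsq F"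
    by (rule LIMSEQ_le_const) (use step in auto)
  then show ?thesis by simp
qed

lemma L2_normsq_Fatou:
  assumes "\<And>n. h n \<in> borel_measurable lebesgue" "AE x in lebesgue. (\<lambda>n. h n x) \<longlonglongrightarrow> g x"
  shows "L2_normsq (\<lambda>x. g x) \<le> liminf (\<lambda>n. L2_normsq (h n))"
proof -
  have "L2_normsq g = (\<integral>\<^sup>+x. liminf (\<lambda>n. ennreal ((cmod (h n x))\<^sup>2)) \<partial>lebesgue)"
    unfolding L2_normsq_def
  proof (rule nn_integral_cong_AE)
    show "AE x in lebesgue. ennreal ((cmod (g x))\<^sup>2) = liminf (\<lambda>n. ennreal ((cmod (h n x))\<^sup>2))"
      using assms(2)
    proof eventually_elim
      fix x assume "(\<lambda>n. h n x) \<longlonglongrightarrow> g x"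
      then have "(\<lambda>n. ennreal ((cmod (h n x))\<^sup>2)) \<longlonglongrightarrow> ennreal ((cmod (g x))\<^sup>2)"
        by (intro tendsto_intros tendsto_ennrealI)
      then show "ennreal ((cmod (g x))\<^sup>2) = liminf (\<lambda>n. ennreal ((cmod (h n x))\<^sup>2))"
        by (intro lim_imp_Liminf[symmetric]) auto
    qed
  qed
  also have "\<dots> \<le> liminf (\<lambda>n. L2_normsq (h n))"
    using assms(1) unfolding L2_normsq_def by (intro nn_integral_liminf) auto
  finally show ?thesis .
qed

text \<open>Fatou's lemma applied to \<open>h n - G\<close> identifies the pointwise limit with the
  mean square limit, without extracting a subsequence.\<close>

lemma L2_normsq_limit_unique:
  assumes m: "\<And>n. h n \<in> borel_measurable lebesgue" "G \<in> borel_measurable lebesgue"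
    and lim: "AE x in lebesgue. (\<lambda>n. h n x) \<longlonglongrightarrow> g x"
    and conv: "(\<lambda>n. L2_normsq (\<lambda>x. h n x - G x)) \<longlonglongrightarrow> 0"
    and g: "g \<in> borel_measurable lebesgue"
  shows "AE x in lebesgue. g x = G x"
proof -
  have "L2_normsq (\<lambda>x. g x - G x) \<le> liminf (\<lambda>n. L2_normsq (\<lambda>x. h n x - G x))"
    using m lim by (intro L2_normsq_Fatou) (auto elim!: eventually_mono intro!: tendsto_intros)
  also have "\<dots> = 0" by (intro lim_imp_Liminf conv) auto
  finally have "L2_normsq (\<lambda>x. g x - G x) = 0" by simp
  then show ?thesis using m g by (subst (asm) L2_normsq_eq_0_iff) auto
qed

lemma L2_normsq_dominated_convergence:
  assumes m: "\<And>n. h n \<in> borel_measurable lebesgue" "g \<in> borel_measurable lebesgue"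
    and lim: "AE x in lebesgue. (\<lambda>n. h n x) \<longlonglongrightarrow> g x"
    and dom: "\<And>n. AE x in lebesgue. cmod (h n x) \<le> d x" and d: "d \<in> borel_measurable lebesgue"
    and fin: "(\<integral>\<^sup>+x. ennreal ((d x)\<^sup>2) \<partial>lebesgue) < \<infinity>"
  shows "(\<lambda>n. L2_normsq (\<lambda>x. h n x - g x)) \<longlonglongrightarrow> 0"
proof -
  have bound: "AE x in lebesgue. \<forall>n. cmod (h n x) \<le> d x" using dom by (simp add: AE_all_countable)
  have "(\<lambda>n. \<integral>\<^sup>+x. ennreal ((cmod (h n x - g x))\<^sup>2) \<partial>lebesgue) \<longlonglongrightarrow> (\<integral>\<^sup>+x. 0 \<partial>(lebesgue::real measure))"
  proof (rule nn_integral_dominated_convergence[where w = "\<lambda>x. 4 * ennreal ((d x)\<^sup>2)"])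
    show "AE x in lebesgue. ennreal ((cmod (h n x - g x))\<^sup>2) \<le> 4 * ennreal ((d x)\<^sup>2)" for n
      using bound lim
    proof eventually_elim
      fix x assume b: "\<forall>n. cmod (h n x) \<le> d x" and l: "(\<lambda>n. h n x) \<longlonglongrightarrow> g x"
      have "cmod (g x) \<le> d x" using b by (intro LIMSEQ_le_const2[OF tendsto_norm[OF l]]) auto
      then have "cmod (h n x - g x) \<le> 2 * d x"
        using spec[OF b, of n] norm_triangle_ineq4[of "h n x" "g x"] by linarith
      then have "(cmod (h n x - g x))\<^sup>2 \<le> (2 * d x)\<^sup>2" by (intro power_mono) auto
      then have "ennreal ((cmod (h n x - g x))\<^sup>2) \<le> ennreal (4 * (d x)\<^sup>2)"
        by (intro ennreal_leI) (simp add: power_mult_distrib)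
      then show "ennreal ((cmod (h n x - g x))\<^sup>2) \<le> 4 * ennreal ((d x)\<^sup>2)" by (simp add: ennreal_mult)
    qed
    show "AE x in lebesgue. (\<lambda>n. ennreal ((cmod (h n x - g x))\<^sup>2)) \<longlonglongrightarrow> 0"
      using lim
    proof eventually_elim
      fix x assume l: "(\<lambda>n. h n x) \<longlonglongrightarrow> g x"
      have "(\<lambda>n. ennreal ((cmod (h n x - g x))\<^sup>2)) \<longlonglongrightarrow> ennreal ((cmod (g x - g x))\<^sup>2)"
        by (intro tendsto_intros tendsto_ennrealI l)
      then show "(\<lambda>n. ennreal ((cmod (h n x - g x))\<^sup>2)) \<longlonglongrightarrow> 0" by simp
    qed
    show "(\<integral>\<^sup>+x. 4 * ennreal ((d x)\<^sup>2) \<partial>lebesgue) < \<infinity>"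
      using fin d by (subst nn_integral_cmult) (auto simp: ennreal_mult_less_top)
  qed (use m d in auto)
  then show ?thesis unfolding L2_normsq_def by simp
qed

text \<open>Fubini's theorem is used on the product of two copies of \<open>lborel\<close>, so
  Lebesgue measurable functions are first exchanged for Borel representatives.\<close>

lemma ex_borel_complex:
  fixes u :: "real \<Rightarrow> complex"
  assumes "u \<in> borel_measurable lebesgue"
  obtains v where "v \<in> borel_measurable borel" "AE x in lebesgue. u x = v x"
proof -
  have "(\<lambda>x. Re (u x)) \<in> borel_measurable lebesgue" "(\<lambda>x. Im (u x)) \<in> borel_measurable lebesgue"
    using assms by measurable
  from this[THEN completion_ex_borel_measurable_real]
  obtain a b where a: "a \<in> borel_measurable lborel" "AE x in lborel. Re (u x) = a x"
    and b: "b \<in> borel_measurable lborel" "AE x in lborel. Im (u x) = b x"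
    by blast
  show thesis
  proof (rule that[of "\<lambda>x. Complex (a x) (b x)"])
    have "(\<lambda>x. complex_of_real (a x) + \<i> * complex_of_real (b x)) \<in> borel_measurable borel"
      using a(1) b(1) by measurable
    then show "(\<lambda>x. Complex (a x) (b x)) \<in> borel_measurable borel" by (simp add: Complex_eq)
    have "AE x in lborel. u x = Complex (a x) (b x)" using a(2) b(2) by eventually_elim (simp add: complex_eq_iff)
    then show "AE x in lebesgue. u x = Complex (a x) (b x)" by (rule AE_completion)
  qed
qed

subsection \<open>Gaussian regularization\<close>

text \<open>In the non-integrable case the left side is the default value 0.\<close>

lemma norm_integral_le_nn_integral:
  fixes f :: "'a \<Rightarrow> complex"
  shows "ennreal (cmod (integral\<^sup>L M f)) \<le> (\<integral>\<^sup>+x. ennreal (cmod (f x)) \<partial>M)"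
  by (cases "integrable M f") (auto simp: integral_norm_bound_ennreal not_integrable_integral_eq)

text \<open>Domination by a product of functions of one variable each: the integrability hypothesis
  for the two exchanges of integrals below.\<close>

lemma integrable_pair_bound:
  fixes k :: "real \<times> real \<Rightarrow> complex" and f g :: "real \<Rightarrow> real"
  assumes f: "integrable lborel f" and g: "integrable lborel g"
    and k[measurable]: "k \<in> borel_measurable (lborel \<Otimes>\<^sub>M lborel)"
    and le: "\<And>x y. cmod (k (x, y)) \<le> f x * g y"
  shows "integrable (lborel \<Otimes>\<^sub>M lborel) k"
proof (rule integrableI_bounded[OF k])
  have [measurable]: "f \<in> borel_measurable borel" "g \<in> borel_measurable borel"
    using f g by auto
  have "(\<integral>\<^sup>+z. ennreal (cmod (k z)) \<partial>(lborel \<Otimes>\<^sub>M lborel)) \<le>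
      (\<integral>\<^sup>+z. ennreal \<bar>f (fst z)\<bar> * ennreal \<bar>g (snd z)\<bar> \<partial>(lborel \<Otimes>\<^sub>M lborel))"
  proof (rule nn_integral_mono)
    fix z :: "real \<times> real"
    have "cmod (k z) \<le> \<bar>f (fst z)\<bar> * \<bar>g (snd z)\<bar>"
      using le[of "fst z" "snd z"] by (auto simp: abs_mult[symmetric])
    then show "ennreal (cmod (k z)) \<le> ennreal \<bar>f (fst z)\<bar> * ennreal \<bar>g (snd z)\<bar>"
      by (simp add: ennreal_mult[symmetric] ennreal_leI)
  qed
  also have "\<dots> = (\<integral>\<^sup>+x. \<integral>\<^sup>+y. ennreal \<bar>f x\<bar> * ennreal \<bar>g y\<bar> \<partial>lborel \<partial>lborel)"
    by (subst lborel.nn_integral_fst[symmetric]) auto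
  also have "\<dots> = (\<integral>\<^sup>+x. ennreal \<bar>f x\<bar> \<partial>lborel) * (\<integral>\<^sup>+y. ennreal \<bar>g y\<bar> \<partial>lborel)"
    by (simp add: nn_integral_cmult nn_integral_multc)
  also have "\<dots> < \<infinity>"
    using f g by (simp add: integrable_iff_bounded ennreal_mult_less_top)
  finally show "(\<integral>\<^sup>+z. ennreal (cmod (k z)) \<partial>(lborel \<Otimes>\<^sub>M lborel)) < \<infinity>" .
qed

section \<open>The transform of integrable functions\<close>

lemma fourier_L1_borel:
  assumes [measurable]: "u \<in> borel_measurable borel"
  shows "fourier_L1 u \<omega> = 1 / complex_of_real (sqrt (2 * pi)) *
     (LINT x|lborel. u x * exp (- (\<i> * complex_of_real \<omega> * complex_of_real x)))"
  unfolding fourier_L1_def by (subst integral_completion) auto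

lemma fourier_L1_cong_AE:
  assumes "AE x in lebesgue. u x = v x" "u \<in> borel_measurable lebesgue" "v \<in> borel_measurable lebesgue"
  shows "fourier_L1 u = fourier_L1 v"
proof
  fix \<omega>
  have [measurable]: "(\<lambda>x. exp (- (\<i> * complex_of_real \<omega> * complex_of_real x))) \<in> borel_measurable lebesgue"
    by (rule measurable_completion) auto
  show "fourier_L1 u \<omega> = fourier_L1 v \<omega>"
    unfolding fourier_L1_def using assms
    by (intro arg_cong2[where f = "(*)"] refl integral_cong_AE) auto
qed

lemma borel_measurable_fourier_L1:
  assumes u: "u \<in> borel_measurable borel"
  shows "fourier_L1 u \<in> borel_measurable borel"
proof -
  have [measurable]: "u \<in> borel_measurable lborel" using u by simp
  have "(\<lambda>\<omega>. LINT x|lborel. u x * exp (- (\<i> * complex_of_real \<omega> * complex_of_real x))) \<in> borel_measurable borel"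
    by (rule lborel.borel_measurable_lebesgue_integral) measurable
  then show ?thesis
    unfolding fourier_L1_borel[OF u, abs_def] by measurable
qed

text \<open>The factor \<open>1 / sqrt (2 * pi)\<close> is below 1 and is dropped; only some bound
  uniform in \<open>\<omega>\<close> matters.\<close>

lemma norm_fourier_L1_le:
  assumes u: "u \<in> borel_measurable borel" "integrable lborel u"
  shows "cmod (fourier_L1 u \<omega>) \<le> (LINT x|lborel. cmod (u x))"
proof -
  have "cmod (LINT x|lborel. u x * exp (- (\<i> * complex_of_real \<omega> * complex_of_real x)))
      \<le> (LINT x|lborel. cmod (u x * exp (- (\<i> * complex_of_real \<omega> * complex_of_real x))))"
    by (rule integral_norm_bound)
  also have "\<dots> = (LINT x|lborel. cmod (u x))"
    by (simp add: norm_mult)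
  finally have *: "cmod (LINT x|lborel. u x * exp (- (\<i> * complex_of_real \<omega> * complex_of_real x)))
      \<le> (LINT x|lborel. cmod (u x))" .
  have "1 \<le> sqrt (2 * pi)" using pi_gt3 by simp
  moreover have "0 \<le> (LINT x|lborel. cmod (u x))" by simp
  ultimately have "(LINT x|lborel. cmod (u x)) / sqrt (2 * pi) \<le> (LINT x|lborel. cmod (u x)) / 1"
    by (intro divide_left_mono) auto
  then show ?thesis
    using * \<open>1 \<le> sqrt (2 * pi)\<close> unfolding fourier_L1_borel[OF u(1)]
    by (simp add: norm_mult norm_divide divide_right_mono order_trans[rotated])
qed

text \<open>A multiplier that makes double integrals in time and frequency absolutely convergent and
  tends to 1 pointwise as \<open>s\<close> grows.\<close>

definition gauss_weight :: "real \<Rightarrow> real \<Rightarrow> real" where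
  "gauss_weight s \<omega> = exp (- ((\<omega> / s)\<^sup>2 / 2))"

text \<open>For \<open>s > 0\<close> the density of the centred normal law with standard deviation
  \<open>1 / s\<close>: an approximate identity as \<open>s\<close> grows, and the counterpart of
  \<open>gauss_weight s\<close> on the time side.\<close>

definition gauss_kernel :: "real \<Rightarrow> real \<Rightarrow> real" where
  "gauss_kernel s z = s * std_normal_density (s * z)"

lemma gauss_measurable [measurable]:
  "gauss_weight s \<in> borel_measurable borel" "gauss_kernel s \<in> borel_measurable borel"
  unfolding gauss_weight_def[abs_def] gauss_kernel_def[abs_def] by measurable

lemma gauss_weight_bounds: "0 < gauss_weight s \<omega>" "gauss_weight s \<omega> \<le> 1"
  by (auto simp: gauss_weight_def)

lemma gauss_kernel_nonneg: "s > 0 \<Longrightarrow> 0 \<le> gauss_kernel s z"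
  by (simp add: gauss_kernel_def)

lemma gauss_kernel_sym: "gauss_kernel s (x - y) = gauss_kernel s (y - x)"
  by (simp add: gauss_kernel_def normal_density_def power_mult_distrib power2_commute)

lemma integrable_std_normal: "integrable lborel std_normal_density"
  using integrable_std_normal_moment[of 0] by simp

lemma integral_std_normal: "(LINT x|lborel. std_normal_density x) = 1"
  using integral_std_normal_moment_even[of 0] by simp

lemma gauss_weight_eq: "gauss_weight s (s * x) = sqrt (2 * pi) * std_normal_density x" if "s > 0"
  using that by (simp add: gauss_weight_def std_normal_density_def)

lemma integrable_gauss_weight:
  assumes "s > 0"
  shows "integrable lborel (gauss_weight s)"
proof -
  have "integrable lborel (\<lambda>x. gauss_weight s (0 + s * x))"
    using assms integrable_std_normal by (simp add: gauss_weight_eq)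
  then show ?thesis
    using assms by (subst (asm) lborel_integrable_real_affine_iff) auto
qed

text \<open>Rescaling by \<open>s\<close> turns the integral into the characteristic function of the
  standard normal law at \<open>s * z\<close>, which is again Gaussian.\<close>

lemma integral_exp_gauss_weight:
  assumes s: "s > 0"
  shows "(LINT \<omega>|lborel. exp (\<i> * complex_of_real \<omega> * complex_of_real z) * complex_of_real (gauss_weight s \<omega>)) =
      2 * pi * gauss_kernel s z"
proof -
  have "(LINT \<omega>|lborel. exp (\<i> * complex_of_real \<omega> * complex_of_real z) * complex_of_real (gauss_weight s \<omega>)) =
      s * (LINT x|lborel. exp (\<i> * complex_of_real (s * x) * complex_of_real z) * complex_of_real (gauss_weight s (s * x)))"
    using s by (subst lborel_integral_real_affine[where c = s and t = 0]) (auto simp: scaleR_conv_of_real)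
  also have "(LINT x|lborel. exp (\<i> * complex_of_real (s * x) * complex_of_real z) * complex_of_real (gauss_weight s (s * x))) =
      (LINT x|lborel. sqrt (2 * pi) * (std_normal_density x *\<^sub>R iexp ((s * z) * x)))"
  proof (intro Bochner_Integration.integral_cong refl)
    fix x
    have "\<i> * complex_of_real (s * x) * complex_of_real z = \<i> * complex_of_real (s * z * x)" by simp
    then show "exp (\<i> * complex_of_real (s * x) * complex_of_real z) * complex_of_real (gauss_weight s (s * x)) =
        sqrt (2 * pi) * (std_normal_density x *\<^sub>R iexp ((s * z) * x))"
      unfolding gauss_weight_eq[OF s] scaleR_conv_of_real of_real_mult
      by (simp add: mult_ac)
  qed
  also have "\<dots> = sqrt (2 * pi) * (LINT x|lborel. std_normal_density x *\<^sub>R iexp ((s * z) * x))"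
    by (rule integral_mult_right_zero)
  also have "\<dots> = sqrt (2 * pi) * char std_normal_distribution (s * z)"
    unfolding char_def
    by (subst integral_density) auto
  also have "\<dots> = sqrt (2 * pi) * exp (- (s * z)\<^sup>2 / 2)"
    by (simp add: char_std_normal_distribution)
  also have "complex_of_real s * \<dots> = 2 * pi * gauss_kernel s z"
  proof -
    have "s * (sqrt (2 * pi) * exp (- (s * z)\<^sup>2 / 2)) = 2 * pi * gauss_kernel s z"
      by (simp add: gauss_kernel_def std_normal_density_def field_simps)
    then show ?thesis by (metis of_real_mult)
  qed
  finally show ?thesis by simp
qed

lemma nn_integral_gauss_kernel:
  assumes s: "s > 0"
  shows "(\<integral>\<^sup>+y. ennreal (gauss_kernel s (x - y)) \<partial>lborel) = 1"
proof -
  have "1 = (\<integral>\<^sup>+y. ennreal (std_normal_density y) \<partial>lborel)"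
    using integral_std_normal integrable_std_normal
    by (subst nn_integral_eq_integral) auto
  also have "(\<integral>\<^sup>+y. ennreal (std_normal_density y) \<partial>lborel) =
      (\<integral>\<^sup>+y. ennreal s * ennreal (std_normal_density (s * x - s * y)) \<partial>lborel)"
    using s by (subst nn_integral_real_affine[where c = "-s" and t = "s * x"]) (auto simp: nn_integral_cmult)
  also have "\<dots> = (\<integral>\<^sup>+y. ennreal (gauss_kernel s (x - y)) \<partial>lborel)"
    using s by (simp add: gauss_kernel_def ennreal_mult[symmetric] right_diff_distrib)
  finally show ?thesis ..
qed

text \<open>Regularized inversion formula. Fubini moves the integral over \<open>\<omega>\<close>
  inside, where only the transform of the weight remains; the outcome is the convolution of
  \<open>u\<close> with a probability density.\<close>

lemma gauss_inversion:
  assumes u: "u \<in> borel_measurable borel" "integrable lborel u" and s: "s > 0"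
  shows "(LINT \<omega>|lborel. fourier_L1 u \<omega> * gauss_weight s \<omega> * exp (\<i> * complex_of_real \<omega> * complex_of_real x)) =
      complex_of_real (sqrt (2 * pi)) * (LINT y|lborel. u y * gauss_kernel s (x - y))"
proof -
  have [measurable]: "u \<in> borel_measurable lborel" using u by simp
  let ?k = "\<lambda>\<omega> y. u y * exp (\<i> * complex_of_real \<omega> * complex_of_real (x - y)) * gauss_weight s \<omega>"
  have int: "integrable (lborel \<Otimes>\<^sub>M lborel) (\<lambda>(\<omega>, y). ?k \<omega> y)"
  proof (rule integrable_pair_bound[where f = "gauss_weight s" and g = "\<lambda>y. cmod (u y)"])
    show "cmod (case (\<omega>, y) of (\<omega>, y) \<Rightarrow> ?k \<omega> y) \<le> gauss_weight s \<omega> * cmod (u y)" for \<omega> y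
      using gauss_weight_bounds(1)[of s \<omega>] by (simp add: norm_mult)
  qed (use s u integrable_gauss_weight in auto)
  have "(LINT \<omega>|lborel. fourier_L1 u \<omega> * gauss_weight s \<omega> * exp (\<i> * complex_of_real \<omega> * complex_of_real x)) =
      (LINT \<omega>|lborel. 1 / complex_of_real (sqrt (2 * pi)) * (LINT y|lborel. ?k \<omega> y))"
  proof (intro Bochner_Integration.integral_cong refl)
    fix \<omega>
    have "(LINT y|lborel. ?k \<omega> y) = (LINT y|lborel. (exp (\<i> * complex_of_real \<omega> * complex_of_real x) * gauss_weight s \<omega>) *
        (u y * exp (- (\<i> * complex_of_real \<omega> * complex_of_real y))))"
      by (intro Bochner_Integration.integral_cong refl)
         (simp add: exp_minus exp_diff right_diff_distrib field_simps)
    also have "\<dots> = (exp (\<i> * complex_of_real \<omega> * complex_of_real x) * gauss_weight s \<omega>) *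
        (LINT y|lborel. u y * exp (- (\<i> * complex_of_real \<omega> * complex_of_real y)))"
      by (rule integral_mult_right_zero)
    finally show "fourier_L1 u \<omega> * gauss_weight s \<omega> * exp (\<i> * complex_of_real \<omega> * complex_of_real x) =
        1 / complex_of_real (sqrt (2 * pi)) * (LINT y|lborel. ?k \<omega> y)"
      unfolding fourier_L1_borel[OF u(1)] by (simp add: mult_ac)
  qed
  also have "\<dots> = 1 / complex_of_real (sqrt (2 * pi)) * (LINT y|lborel. LINT \<omega>|lborel. ?k \<omega> y)"
    using lborel_pair.Fubini_integral[OF int] by simp
  also have "(LINT y|lborel. LINT \<omega>|lborel. ?k \<omega> y) = (LINT y|lborel. 2 * pi * (u y * gauss_kernel s (x - y)))"
  proof (intro Bochner_Integration.integral_cong refl)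
    fix y
    have "(LINT \<omega>|lborel. ?k \<omega> y) = u y * (LINT \<omega>|lborel. exp (\<i> * complex_of_real \<omega> * complex_of_real (x - y)) * gauss_weight s \<omega>)"
      by (subst integral_mult_right_zero[symmetric]) (simp add: mult_ac)
    then show "(LINT \<omega>|lborel. ?k \<omega> y) = 2 * pi * (u y * gauss_kernel s (x - y))"
      unfolding integral_exp_gauss_weight[OF s] by simp
  qed
  also have "1 / complex_of_real (sqrt (2 * pi)) * \<dots> =
      complex_of_real (sqrt (2 * pi)) * (LINT y|lborel. u y * gauss_kernel s (x - y))"
  proof -
    have "complex_of_real (2 * pi) = complex_of_real (sqrt (2 * pi)) * complex_of_real (sqrt (2 * pi))"
      by (subst of_real_mult[symmetric]) simp
    then have "1 / complex_of_real (sqrt (2 * pi)) * complex_of_real (2 * pi) = complex_of_real (sqrt (2 * pi))"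
      by simp
    then show ?thesis
      by (subst integral_mult_right_zero) (simp only: mult.assoc[symmetric])
  qed
  finally show ?thesis .
qed

text \<open>Schur's test: \<open>cmod (u x) * cmod (u y)\<close> is split into half the sum of the
  squares, and the symmetric kernel has mass 1 in each variable, so each half contributes half of
  the squared norm.\<close>

lemma nn_integral_gauss_le:
  assumes [measurable]: "u \<in> borel_measurable borel" and s: "s > 0"
  shows "(\<integral>\<^sup>+x. ennreal (cmod (u x)) * (\<integral>\<^sup>+y. ennreal (cmod (u y) * gauss_kernel s (x - y)) \<partial>lborel) \<partial>lborel) \<le> L2_normsq u"
proof -
  let ?K = "gauss_kernel s"
  have "(\<integral>\<^sup>+x. ennreal (cmod (u x)) * (\<integral>\<^sup>+y. ennreal (cmod (u y) * ?K (x - y)) \<partial>lborel) \<partial>lborel) =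
      (\<integral>\<^sup>+x. \<integral>\<^sup>+y. ennreal (cmod (u x)) * ennreal (cmod (u y) * ?K (x - y)) \<partial>lborel \<partial>lborel)"
    by (subst nn_integral_cmult) auto
  also have "\<dots> \<le> (\<integral>\<^sup>+x. \<integral>\<^sup>+y. ennreal ((cmod (u x))\<^sup>2 / 2) * ennreal (?K (x - y)) + ennreal ((cmod (u y))\<^sup>2 / 2) * ennreal (?K (y - x)) \<partial>lborel \<partial>lborel)"
  proof (intro nn_integral_mono)
    fix x y :: real
    have "cmod (u x) * cmod (u y) \<le> (cmod (u x))\<^sup>2 / 2 + (cmod (u y))\<^sup>2 / 2"
      using sum_squares_bound[of "cmod (u x)" "cmod (u y)"] by simp
    then have "cmod (u x) * cmod (u y) * ?K (x - y) \<le> ((cmod (u x))\<^sup>2 / 2 + (cmod (u y))\<^sup>2 / 2) * ?K (x - y)"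
      using gauss_kernel_nonneg[OF s] by (rule mult_right_mono)
    then have "ennreal (cmod (u x) * cmod (u y) * ?K (x - y)) \<le> ennreal (((cmod (u x))\<^sup>2 / 2 + (cmod (u y))\<^sup>2 / 2) * ?K (x - y))"
      by (rule ennreal_leI)
    also have "\<dots> = ennreal ((cmod (u x))\<^sup>2 / 2) * ennreal (?K (x - y)) + ennreal ((cmod (u y))\<^sup>2 / 2) * ennreal (?K (x - y))"
      using gauss_kernel_nonneg[OF s, of "x - y"] by (simp add: distrib_right ennreal_mult[symmetric] ennreal_plus[symmetric] del: ennreal_plus)
    finally show "ennreal (cmod (u x)) * ennreal (cmod (u y) * ?K (x - y)) \<le>
        ennreal ((cmod (u x))\<^sup>2 / 2) * ennreal (?K (x - y)) + ennreal ((cmod (u y))\<^sup>2 / 2) * ennreal (?K (y - x))"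
      using gauss_kernel_nonneg[OF s, of "x - y"] gauss_kernel_sym[of s x y] by (simp add: ennreal_mult[symmetric] mult_ac)
  qed
  also have "\<dots> = (\<integral>\<^sup>+x. \<integral>\<^sup>+y. ennreal ((cmod (u x))\<^sup>2 / 2) * ennreal (?K (x - y)) \<partial>lborel \<partial>lborel) +
      (\<integral>\<^sup>+x. \<integral>\<^sup>+y. ennreal ((cmod (u y))\<^sup>2 / 2) * ennreal (?K (y - x)) \<partial>lborel \<partial>lborel)"
    by (simp add: nn_integral_add)
  also have "(\<integral>\<^sup>+x. \<integral>\<^sup>+y. ennreal ((cmod (u y))\<^sup>2 / 2) * ennreal (?K (y - x)) \<partial>lborel \<partial>lborel) =
      (\<integral>\<^sup>+y. \<integral>\<^sup>+x. ennreal ((cmod (u y))\<^sup>2 / 2) * ennreal (?K (y - x)) \<partial>lborel \<partial>lborel)"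
    by (rule lborel_pair.Fubini') measurable
  also have "(\<integral>\<^sup>+y. \<integral>\<^sup>+x. ennreal ((cmod (u y))\<^sup>2 / 2) * ennreal (?K (y - x)) \<partial>lborel \<partial>lborel) = (\<integral>\<^sup>+y. ennreal ((cmod (u y))\<^sup>2 / 2) \<partial>lborel)"
    by (subst nn_integral_cmult) (auto simp: nn_integral_gauss_kernel[OF s])
  also have "\<dots> + \<dots> = (\<integral>\<^sup>+y. ennreal ((cmod (u y))\<^sup>2 / 2) + ennreal ((cmod (u y))\<^sup>2 / 2) \<partial>lborel)"
    by (rule nn_integral_add[symmetric]) auto
  also have "\<dots> = L2_normsq u"
    unfolding L2_normsq_def nn_integral_completion by (simp add: ennreal_plus[symmetric] del: ennreal_plus)
  finally show ?thesis .
qed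

text \<open>One factor of the squared modulus is written out as the integral defining
  \<open>cnj (fourier_L1 u \<omega>)\<close>. After Fubini, \<open>gauss_inversion\<close> turns the
  left side into the pairing of \<open>u\<close> with its Gaussian average, which
  \<open>nn_integral_gauss_le\<close> bounds.\<close>

lemma L2_normsq_fourier_L1_gauss_le:
  assumes u: "u \<in> borel_measurable borel" "integrable lborel u" and s: "s > 0"
  shows "(\<integral>\<^sup>+\<omega>. ennreal ((cmod (fourier_L1 u \<omega>))\<^sup>2 * gauss_weight s \<omega>) \<partial>lborel) \<le> L2_normsq u"
proof -
  have [measurable]: "u \<in> borel_measurable borel" using u by simp
  note [measurable] = borel_measurable_fourier_L1[OF u(1)]
  have [measurable]: "cnj \<in> borel_measurable borel"
    by (intro borel_measurable_continuous_onI continuous_intros)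
  \<comment> \<open>A crude uniform bound on the transform, used only to establish
    integrability.\<close>
  define C where "C = (LINT x|lborel. cmod (u x))"
  have C: "cmod (fourier_L1 u \<omega>) \<le> C" for \<omega> unfolding C_def by (rule norm_fourier_L1_le[OF u])
  have C0: "C \<ge> 0" unfolding C_def by simp
  let ?k = "\<lambda>\<omega> x. fourier_L1 u \<omega> * gauss_weight s \<omega> * exp (\<i> * complex_of_real \<omega> * complex_of_real x) * cnj (u x)"
  have int: "integrable (lborel \<Otimes>\<^sub>M lborel) (\<lambda>(\<omega>, x). ?k \<omega> x)"
  proof (rule integrable_pair_bound[where f = "\<lambda>\<omega>. C * gauss_weight s \<omega>" and g = "\<lambda>y. cmod (u y)"])
    show "cmod (case (\<omega>, x) of (\<omega>, x) \<Rightarrow> ?k \<omega> x) \<le> C * gauss_weight s \<omega> * cmod (u x)" for \<omega> x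
      using gauss_weight_bounds(1)[of s \<omega>] C[of \<omega>] by (simp add: norm_mult mult_right_mono)
  qed (use s u integrable_gauss_weight in auto)
  have int2: "integrable lborel (\<lambda>\<omega>. (cmod (fourier_L1 u \<omega>))\<^sup>2 * gauss_weight s \<omega>)"
  proof (rule Bochner_Integration.integrable_bound[where f = "\<lambda>\<omega>. C\<^sup>2 * gauss_weight s \<omega>"])
    show "AE \<omega> in lborel. norm ((cmod (fourier_L1 u \<omega>))\<^sup>2 * gauss_weight s \<omega>) \<le> norm (C\<^sup>2 * gauss_weight s \<omega>)"
      using gauss_weight_bounds(1)[of s] C C0 by (intro AE_I2) (auto simp: abs_mult intro!: mult_right_mono power_mono)
  qed (use s integrable_gauss_weight in auto)
  have "complex_of_real (LINT \<omega>|lborel. (cmod (fourier_L1 u \<omega>))\<^sup>2 * gauss_weight s \<omega>) =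
      (LINT \<omega>|lborel. complex_of_real ((cmod (fourier_L1 u \<omega>))\<^sup>2 * gauss_weight s \<omega>))"
    by (rule integral_complex_of_real[symmetric])
  also have "\<dots> = (LINT \<omega>|lborel. 1 / complex_of_real (sqrt (2 * pi)) * (LINT x|lborel. ?k \<omega> x))"
  proof (intro Bochner_Integration.integral_cong refl)
    fix \<omega>
    have "(LINT x|lborel. ?k \<omega> x) = (fourier_L1 u \<omega> * gauss_weight s \<omega>) *
        (LINT x|lborel. cnj (u x * exp (- (\<i> * complex_of_real \<omega> * complex_of_real x))))"
      by (subst integral_mult_right_zero[symmetric]) (simp add: exp_cnj mult_ac)
    also have "(LINT x|lborel. cnj (u x * exp (- (\<i> * complex_of_real \<omega> * complex_of_real x)))) =
        cnj (LINT x|lborel. u x * exp (- (\<i> * complex_of_real \<omega> * complex_of_real x)))"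
      by (rule Bochner_Integration.integral_cnj)
    also have "\<dots> = complex_of_real (sqrt (2 * pi)) * cnj (fourier_L1 u \<omega>)"
      unfolding fourier_L1_borel[OF u(1)] by simp
    finally have "1 / complex_of_real (sqrt (2 * pi)) * (LINT x|lborel. ?k \<omega> x) = fourier_L1 u \<omega> * cnj (fourier_L1 u \<omega>) * gauss_weight s \<omega>"
      by simp
    then show "complex_of_real ((cmod (fourier_L1 u \<omega>))\<^sup>2 * gauss_weight s \<omega>) = 1 / complex_of_real (sqrt (2 * pi)) * (LINT x|lborel. ?k \<omega> x)"
      by (simp only: complex_norm_square of_real_mult)
  qed
  also have "\<dots> = 1 / complex_of_real (sqrt (2 * pi)) * (LINT x|lborel. LINT \<omega>|lborel. ?k \<omega> x)"
    using lborel_pair.Fubini_integral[OF int] by simp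
  also have "(LINT x|lborel. LINT \<omega>|lborel. ?k \<omega> x) =
      (LINT x|lborel. complex_of_real (sqrt (2 * pi)) * (cnj (u x) * (LINT y|lborel. u y * gauss_kernel s (x - y))))"
    by (intro Bochner_Integration.integral_cong refl, subst integral_mult_left_zero, subst gauss_inversion[OF u s]) (simp add: mult_ac)
  also have "1 / complex_of_real (sqrt (2 * pi)) * \<dots> = (LINT x|lborel. cnj (u x) * (LINT y|lborel. u y * gauss_kernel s (x - y)))"
    by (subst integral_mult_right_zero) simp
  finally have eq: "complex_of_real (LINT \<omega>|lborel. (cmod (fourier_L1 u \<omega>))\<^sup>2 * gauss_weight s \<omega>) =
      (LINT x|lborel. cnj (u x) * (LINT y|lborel. u y * gauss_kernel s (x - y)))" .
  have "(\<integral>\<^sup>+\<omega>. ennreal ((cmod (fourier_L1 u \<omega>))\<^sup>2 * gauss_weight s \<omega>) \<partial>lborel) =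
      ennreal (LINT \<omega>|lborel. (cmod (fourier_L1 u \<omega>))\<^sup>2 * gauss_weight s \<omega>)"
    using gauss_weight_bounds(1)[of s] by (intro nn_integral_eq_integral int2 AE_I2) (simp add: less_imp_le)
  also have "(LINT \<omega>|lborel. (cmod (fourier_L1 u \<omega>))\<^sup>2 * gauss_weight s \<omega>) \<le>
      cmod (LINT x|lborel. cnj (u x) * (LINT y|lborel. u y * gauss_kernel s (x - y)))"
    unfolding eq[symmetric] by simp
  also have "ennreal \<dots> \<le> (\<integral>\<^sup>+x. ennreal (cmod (cnj (u x) * (LINT y|lborel. u y * gauss_kernel s (x - y)))) \<partial>lborel)"
    by (rule norm_integral_le_nn_integral)
  also have "\<dots> \<le> (\<integral>\<^sup>+x. ennreal (cmod (u x)) * (\<integral>\<^sup>+y. ennreal (cmod (u y) * gauss_kernel s (x - y)) \<partial>lborel) \<partial>lborel)"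
  proof (intro nn_integral_mono)
    fix x
    have "ennreal (cmod (LINT y|lborel. u y * gauss_kernel s (x - y))) \<le> (\<integral>\<^sup>+y. ennreal (cmod (u y * gauss_kernel s (x - y))) \<partial>lborel)"
      by (rule norm_integral_le_nn_integral)
    also have "\<dots> = (\<integral>\<^sup>+y. ennreal (cmod (u y) * gauss_kernel s (x - y)) \<partial>lborel)"
      using gauss_kernel_nonneg[OF s] by (simp add: norm_mult)
    finally show "ennreal (cmod (cnj (u x) * (LINT y|lborel. u y * gauss_kernel s (x - y)))) \<le>
        ennreal (cmod (u x)) * (\<integral>\<^sup>+y. ennreal (cmod (u y) * gauss_kernel s (x - y)) \<partial>lborel)"
      by (simp add: norm_mult ennreal_mult mult_left_mono)
  qed
  also have "\<dots> \<le> L2_normsq u" by (rule nn_integral_gauss_le) (use s in auto)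
  finally show ?thesis by (simp add: ennreal_leI)
qed

subsection \<open>The Fourier transform on \<open>L\<^sub>2\<close>\<close>

text \<open>The Gaussian weight is removed by Fatou's lemma, which yields only half of Plancherel's
  identity. This contraction already suffices to extend the transform; equality follows once
  inversion is known.\<close>

lemma L2_normsq_fourier_L1_le:
  assumes "u \<in> Lp 1" "u \<in> Lp 2"
  shows "L2_normsq (fourier_L1 u) \<le> L2_normsq u" and "fourier_L1 u \<in> borel_measurable borel"
proof -
  have m: "u \<in> borel_measurable lebesgue" and i: "integrable lebesgue u"
    using assms by (auto simp: Lp_1_iff)
  obtain v where v: "v \<in> borel_measurable borel" and uv: "AE x in lebesgue. u x = v x"
    using ex_borel_complex[OF m] .
  have vm: "v \<in> borel_measurable lebesgue" using v by (intro measurable_completion) auto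
  have iv: "integrable lborel v"
  proof -
    have "integrable lebesgue v" using i uv by (auto elim: eventually_mono intro: integrable_cong_AE_imp[OF _ vm])
    then show ?thesis using v by (simp add: integrable_completion)
  qed
  have eq: "fourier_L1 u = fourier_L1 v" by (rule fourier_L1_cong_AE[OF uv m vm])
  note fm = borel_measurable_fourier_L1[OF v]
  then show "fourier_L1 u \<in> borel_measurable borel" by (simp add: eq)
  note [measurable] = fm
  have w1: "(\<lambda>n. gauss_weight (real (Suc n)) \<omega>) \<longlonglongrightarrow> 1" for \<omega>
  proof -
    have "(\<lambda>n. exp (- ((\<omega> * (1 / real (Suc n)))\<^sup>2 / 2))) \<longlonglongrightarrow> exp (- ((\<omega> * 0)\<^sup>2 / 2))"
      by (intro tendsto_intros LIMSEQ_Suc lim_1_over_n) auto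
    then show ?thesis by (simp add: gauss_weight_def)
  qed
  have "L2_normsq (fourier_L1 v) = (\<integral>\<^sup>+\<omega>. liminf (\<lambda>n. ennreal ((cmod (fourier_L1 v \<omega>))\<^sup>2 * gauss_weight (real (Suc n)) \<omega>)) \<partial>lborel)"
    unfolding L2_normsq_def nn_integral_completion
  proof (intro nn_integral_cong lim_imp_Liminf[symmetric])
    fix \<omega>
    have "(\<lambda>n. ennreal ((cmod (fourier_L1 v \<omega>))\<^sup>2 * gauss_weight (real (Suc n)) \<omega>)) \<longlonglongrightarrow> ennreal ((cmod (fourier_L1 v \<omega>))\<^sup>2 * 1)"
      by (intro tendsto_ennrealI tendsto_mult tendsto_const w1)
    then show "(\<lambda>n. ennreal ((cmod (fourier_L1 v \<omega>))\<^sup>2 * gauss_weight (real (Suc n)) \<omega>)) \<longlonglongrightarrow> ennreal ((cmod (fourier_L1 v \<omega>))\<^sup>2)"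
      by simp
  qed auto
  also have "\<dots> \<le> liminf (\<lambda>n. \<integral>\<^sup>+\<omega>. ennreal ((cmod (fourier_L1 v \<omega>))\<^sup>2 * gauss_weight (real (Suc n)) \<omega>) \<partial>lborel)"
    by (intro nn_integral_liminf) auto
  also have "\<dots> \<le> liminf (\<lambda>n. L2_normsq v)"
    by (intro Liminf_mono always_eventually allI L2_normsq_fourier_L1_gauss_le v iv) auto
  also have "\<dots> = L2_normsq u" using L2_normsq_cong_AE[OF uv] by (simp add: Liminf_const)
  finally show "L2_normsq (fourier_L1 u) \<le> L2_normsq u" by (simp add: eq)
qed

lemma borel_imp_lebesgue: "f \<in> borel_measurable borel \<Longrightarrow> f \<in> borel_measurable lebesgue"
  by (intro measurable_completion) auto

lemma fourier_L1_Lp_2: "u \<in> Lp 1 \<Longrightarrow> u \<in> Lp 2 \<Longrightarrow> fourier_L1 u \<in> Lp 2"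
  using L2_normsq_fourier_L1_le[of u] by (auto simp: Lp_2_iff borel_imp_lebesgue intro: le_less_trans)

lemma Lp_1_add_scale: "u \<in> Lp 1 \<Longrightarrow> v \<in> Lp 1 \<Longrightarrow> (\<lambda>x. u x + c * v x) \<in> Lp 1"
  by (auto simp: Lp_1_iff)

lemma Lp_2_add_scale: "u \<in> Lp 2 \<Longrightarrow> v \<in> Lp 2 \<Longrightarrow> (\<lambda>x. u x + c * v x) \<in> Lp 2"
  by (intro Lp_2_add Lp_2_scale)

lemma Lp_measurable: "f \<in> Lp p \<Longrightarrow> f \<in> borel_measurable lebesgue"
  by (simp add: Lp_def)

lemma fourier_L1_add_scale:
  assumes "u \<in> Lp 1" "v \<in> Lp 1"
  shows "fourier_L1 (\<lambda>x. u x + c * v x) \<omega> = fourier_L1 u \<omega> + c * fourier_L1 v \<omega>"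
proof -
  let ?e = "\<lambda>x. exp (- (\<i> * complex_of_real \<omega> * complex_of_real x))"
  have e: "?e \<in> borel_measurable lebesgue" by (rule borel_imp_lebesgue) measurable
  have int: "integrable lebesgue (\<lambda>x. w x * ?e x)" if "w \<in> Lp 1" for w
    using that e unfolding Lp_1_iff
    by (rule_tac Bochner_Integration.integrable_bound[of _ w]) (auto simp: norm_mult)
  have "(LINT x|lebesgue. (u x + c * v x) * ?e x) = (LINT x|lebesgue. u x * ?e x + c * (v x * ?e x))"
    by (simp add: algebra_simps)
  also have "\<dots> = (LINT x|lebesgue. u x * ?e x) + c * (LINT x|lebesgue. v x * ?e x)"
    by (subst Bochner_Integration.integral_add) (use int assms in auto)
  finally show ?thesis unfolding fourier_L1_def by (simp add: algebra_simps)
qed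

lemma is_fourier_L2_L1: "u \<in> Lp 1 \<Longrightarrow> u \<in> Lp 2 \<Longrightarrow> is_fourier_L2 u (fourier_L1 u)"
  unfolding is_fourier_L2_iff
  by (intro conjI fourier_L1_Lp_2 exI[of _ "\<lambda>_. u"]) (auto simp: L2_normsq_def)

lemma is_fourier_L2_add_scale:
  assumes fg: "is_fourier_L2 f g" "is_fourier_L2 f' g'" and f: "f \<in> Lp 2" "f' \<in> Lp 2"
  shows "is_fourier_L2 (\<lambda>x. f x + c * f' x) (\<lambda>x. g x + c * g' x)"
proof -
  obtain u where u: "\<And>n. u n \<in> Lp 1 \<inter> Lp 2" "(\<lambda>n. L2_normsq (\<lambda>x. u n x - f x)) \<longlonglongrightarrow> 0"
    "(\<lambda>n. L2_normsq (\<lambda>\<omega>. fourier_L1 (u n) \<omega> - g \<omega>)) \<longlonglongrightarrow> 0" and g: "g \<in> Lp 2"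
    using fg(1) unfolding is_fourier_L2_iff by blast
  obtain v where v: "\<And>n. v n \<in> Lp 1 \<inter> Lp 2" "(\<lambda>n. L2_normsq (\<lambda>x. v n x - f' x)) \<longlonglongrightarrow> 0"
    "(\<lambda>n. L2_normsq (\<lambda>\<omega>. fourier_L1 (v n) \<omega> - g' \<omega>)) \<longlonglongrightarrow> 0" and g': "g' \<in> Lp 2"
    using fg(2) unfolding is_fourier_L2_iff by blast
  have mu: "u n \<in> borel_measurable lebesgue" "v n \<in> borel_measurable lebesgue"
    "fourier_L1 (u n) \<in> borel_measurable lebesgue" "fourier_L1 (v n) \<in> borel_measurable lebesgue" for n
    using u(1)[of n] v(1)[of n] by (auto intro: borel_imp_lebesgue L2_normsq_fourier_L1_le Lp_measurable)
  note m = mu Lp_measurable[OF g] Lp_measurable[OF g'] Lp_measurable[OF f(1)] Lp_measurable[OF f(2)]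
  have "(\<lambda>n. L2_normsq (\<lambda>x. (u n x - f x) + c * (v n x - f' x))) \<longlonglongrightarrow> 0"
    using m u v by (intro L2_normsq_tendsto_0_add L2_normsq_tendsto_0_scale) auto
  moreover have "(\<lambda>n. L2_normsq (\<lambda>x. (fourier_L1 (u n) x - g x) + c * (fourier_L1 (v n) x - g' x))) \<longlonglongrightarrow> 0"
    using m u v by (intro L2_normsq_tendsto_0_add L2_normsq_tendsto_0_scale) auto
  moreover have "fourier_L1 (\<lambda>x. u n x + c * v n x) \<omega> = fourier_L1 (u n) \<omega> + c * fourier_L1 (v n) \<omega>" for n \<omega>
    using u v by (intro fourier_L1_add_scale) auto
  ultimately show ?thesis
    unfolding is_fourier_L2_iff using u v g g'
    by (intro conjI exI[of _ "\<lambda>n x. u n x + c * v n x"])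
       (auto simp: algebra_simps intro: Lp_1_add_scale Lp_2_add_scale)
qed

text \<open>The contraction on \<open>Lp 1 \<inter> Lp 2\<close> survives simultaneous approximation
  of \<open>f\<close> and \<open>g\<close>.\<close>

lemma is_fourier_L2_le:
  assumes "is_fourier_L2 f g" and f: "f \<in> Lp 2"
  shows "L2_normsq g \<le> L2_normsq f"
proof -
  obtain u where u: "\<And>n. u n \<in> Lp 1 \<inter> Lp 2" "(\<lambda>n. L2_normsq (\<lambda>x. u n x - f x)) \<longlonglongrightarrow> 0"
    "(\<lambda>n. L2_normsq (\<lambda>\<omega>. fourier_L1 (u n) \<omega> - g \<omega>)) \<longlonglongrightarrow> 0" and g: "g \<in> Lp 2"
    using assms(1) unfolding is_fourier_L2_iff by blast
  show ?thesis
    using u(1) f g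
    by (intro L2_normsq_le_of_approx[OF _ _ _ _ u(2,3)])
       (auto intro: Lp_measurable L2_normsq_fourier_L1_le fourier_L1_Lp_2 simp: Lp_2_iff[of f])
qed

lemma is_fourier_L2_diff:
  assumes "is_fourier_L2 f g" "is_fourier_L2 f' g'" "f \<in> Lp 2" "f' \<in> Lp 2"
  shows "is_fourier_L2 (\<lambda>x. f x - f' x) (\<lambda>x. g x - g' x)"
  using is_fourier_L2_add_scale[OF assms, of "-1"] by simp

lemma is_fourier_L2_Lp: "is_fourier_L2 f g \<Longrightarrow> g \<in> Lp 2"
  by (simp add: is_fourier_L2_def)

text \<open>Linearity and contraction applied to \<open>f - f\<close> give \<open>g - g'\<close>
  norm 0. This makes the choice in \<open>fourier\<close> harmless up to null sets.\<close>

lemma is_fourier_L2_unique: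
  assumes "is_fourier_L2 f g" "is_fourier_L2 f g'" "f \<in> Lp 2"
  shows "AE x in lebesgue. g x = g' x"
proof -
  have "L2_normsq (\<lambda>x. g x - g' x) \<le> L2_normsq (\<lambda>x. f x - f x)"
    using assms by (intro is_fourier_L2_le is_fourier_L2_diff Lp_2_diff)
  then have "L2_normsq (\<lambda>x. g x - g' x) = 0" by (simp add: L2_normsq_def)
  then show ?thesis
    using Lp_measurable[OF is_fourier_L2_Lp[OF assms(1)]] Lp_measurable[OF is_fourier_L2_Lp[OF assms(2)]]
    by (subst (asm) L2_normsq_eq_0_iff) auto
qed

lemma is_fourier_L2_cong:
  assumes fg: "is_fourier_L2 f g" and ff: "AE x in lebesgue. f x = f' x"
    and gg: "AE x in lebesgue. g x = g' x" and m: "g' \<in> borel_measurable lebesgue"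
  shows "is_fourier_L2 f' g'"
proof -
  have "L2_normsq (\<lambda>x. u x - f x) = L2_normsq (\<lambda>x. u x - f' x)" for u
    using ff by (intro L2_normsq_cong_AE) (auto elim: eventually_mono)
  moreover have "L2_normsq (\<lambda>x. u x - g x) = L2_normsq (\<lambda>x. u x - g' x)" for u
    using gg by (intro L2_normsq_cong_AE) (auto elim: eventually_mono)
  moreover have "g' \<in> Lp 2"
    using is_fourier_L2_Lp[OF fg] L2_normsq_cong_AE[OF gg] m by (auto simp: Lp_2_iff)
  ultimately show ?thesis using fg unfolding is_fourier_L2_iff by simp
qed

text \<open>Diagonal argument: for each \<open>n\<close> a single \<open>u\<close> approximates
  \<open>F n\<close> and its transform approximates \<open>G n\<close>, both within
  \<open>1 / (n + 1)\<close>.\<close>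

lemma is_fourier_L2_closed:
  assumes FG: "\<And>n. is_fourier_L2 (F n) (G n)" and F: "\<And>n. F n \<in> Lp 2"
    and f: "f \<in> Lp 2" and g: "g \<in> Lp 2"
    and Ff: "(\<lambda>n. L2_normsq (\<lambda>x. F n x - f x)) \<longlonglongrightarrow> 0" and Gg: "(\<lambda>n. L2_normsq (\<lambda>x. G n x - g x)) \<longlonglongrightarrow> 0"
  shows "is_fourier_L2 f g"
proof -
  have "\<exists>u. u \<in> Lp 1 \<inter> Lp 2 \<and> L2_normsq (\<lambda>x. u x - F n x) < ennreal (1 / real (Suc n)) \<and>
      L2_normsq (\<lambda>x. fourier_L1 u x - G n x) < ennreal (1 / real (Suc n))" for n
  proof -
    obtain u where u: "\<And>j. u j \<in> Lp 1 \<inter> Lp 2" "(\<lambda>j. L2_normsq (\<lambda>x. u j x - F n x)) \<longlonglongrightarrow> 0"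
      "(\<lambda>j. L2_normsq (\<lambda>\<omega>. fourier_L1 (u j) \<omega> - G n \<omega>)) \<longlonglongrightarrow> 0"
      using FG[of n] unfolding is_fourier_L2_iff by blast
    have "\<forall>\<^sub>F j in sequentially. L2_normsq (\<lambda>x. u j x - F n x) < ennreal (1 / real (Suc n)) \<and>
      L2_normsq (\<lambda>x. fourier_L1 (u j) x - G n x) < ennreal (1 / real (Suc n))"
      by (intro eventually_conj order_tendstoD(2)[OF u(2)] order_tendstoD(2)[OF u(3)]) auto
    then show ?thesis using u(1) by (auto simp: eventually_sequentially)
  qed
  then obtain u where u: "\<And>n. u n \<in> Lp 1 \<inter> Lp 2" "\<And>n. L2_normsq (\<lambda>x. u n x - F n x) < ennreal (1 / real (Suc n))"
      "\<And>n. L2_normsq (\<lambda>x. fourier_L1 (u n) x - G n x) < ennreal (1 / real (Suc n))" by metis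
  have z: "(\<lambda>n. ennreal (1 / real (Suc n))) \<longlonglongrightarrow> 0"
    using tendsto_ennrealI[OF LIMSEQ_Suc[OF lim_1_over_n]] by simp
  have 1: "(\<lambda>n. L2_normsq (\<lambda>x. u n x - F n x)) \<longlonglongrightarrow> 0"
    by (rule tendsto_sandwich[OF _ _ tendsto_const z]) (use u(2) in \<open>auto intro!: always_eventually less_imp_le simp del: of_nat_Suc\<close>)
  have 2: "(\<lambda>n. L2_normsq (\<lambda>x. fourier_L1 (u n) x - G n x)) \<longlonglongrightarrow> 0"
    by (rule tendsto_sandwich[OF _ _ tendsto_const z]) (use u(3) in \<open>auto intro!: always_eventually less_imp_le simp del: of_nat_Suc\<close>)
  have m: "u n \<in> borel_measurable lebesgue" "fourier_L1 (u n) \<in> borel_measurable lebesgue"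
    "F n \<in> borel_measurable lebesgue" "G n \<in> borel_measurable lebesgue" for n
    using u(1)[of n] F[of n] is_fourier_L2_Lp[OF FG[of n]]
    by (auto intro: borel_imp_lebesgue L2_normsq_fourier_L1_le Lp_measurable)
  have "(\<lambda>n. L2_normsq (\<lambda>x. (u n x - F n x) + (F n x - f x))) \<longlonglongrightarrow> 0"
    using m Lp_measurable[OF f] by (intro L2_normsq_tendsto_0_add 1 Ff) auto
  moreover have "(\<lambda>n. L2_normsq (\<lambda>x. (fourier_L1 (u n) x - G n x) + (G n x - g x))) \<longlonglongrightarrow> 0"
    using m Lp_measurable[OF g] by (intro L2_normsq_tendsto_0_add 2 Gg) auto
  ultimately show ?thesis unfolding is_fourier_L2_iff using u(1) g by auto
qed

section \<open>Completeness and existence of the transform\<close>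

lemma ennreal_double_add:
  "0 \<le> a \<Longrightarrow> 0 \<le> b \<Longrightarrow> 2 * ennreal a + 2 * ennreal b = ennreal (2 * a + 2 * b)"
  by (simp add: ennreal_plus ennreal_mult)

text \<open>Riesz-Fischer for a rapidly Cauchy sequence. The rate \<open>(1 / 16) ^ n\<close> leaves
  room for the weight \<open>4 ^ n\<close>: the weighted squared increments still have a finite
  integral, so almost everywhere the increments are at most a multiple of \<open>(1 / 2) ^ n\<close>
  and telescope to a limit.\<close>

lemma L2_normsq_complete:
  assumes h: "\<And>n. h n \<in> Lp 2" and step: "\<And>n. L2_normsq (\<lambda>x. h (Suc n) x - h n x) \<le> ennreal ((1 / 16) ^ n)"
  shows "\<exists>g \<in> Lp 2. (\<lambda>n. L2_normsq (\<lambda>x. h n x - g x)) \<longlonglongrightarrow> 0"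
proof -
  note [measurable] = Lp_measurable[OF h]
  define d where "d n x = cmod (h (Suc n) x - h n x)" for n x
  have "(\<integral>\<^sup>+x. (\<Sum>n. ennreal (4 ^ n * (d n x)\<^sup>2)) \<partial>lebesgue) = (\<Sum>n. \<integral>\<^sup>+x. ennreal (4 ^ n * (d n x)\<^sup>2) \<partial>lebesgue)"
    unfolding d_def by (rule nn_integral_suminf) measurable
  also have "\<dots> \<le> (\<Sum>n. ennreal ((1 / 4) ^ n))"
  proof (intro suminf_le summableI)
    fix n
    have "(\<integral>\<^sup>+x. ennreal (4 ^ n * (d n x)\<^sup>2) \<partial>lebesgue) = ennreal (4 ^ n) * L2_normsq (\<lambda>x. h (Suc n) x - h n x)"
      unfolding d_def L2_normsq_def by (subst nn_integral_cmult[symmetric]) (auto simp: ennreal_mult)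
    also have "\<dots> \<le> ennreal (4 ^ n) * ennreal ((1 / 16) ^ n)" by (intro mult_left_mono step) auto
    also have "\<dots> = ennreal ((1 / 4) ^ n)" by (simp add: ennreal_mult[symmetric] power_mult_distrib[symmetric])
    finally show "(\<integral>\<^sup>+x. ennreal (4 ^ n * (d n x)\<^sup>2) \<partial>lebesgue) \<le> ennreal ((1 / 4) ^ n)" .
  qed
  also have "\<dots> = ennreal (\<Sum>n. (1 / 4) ^ n)"
    by (intro suminf_ennreal2 summable_geometric) auto
  finally have "(\<integral>\<^sup>+x. (\<Sum>n. ennreal (4 ^ n * (d n x)\<^sup>2)) \<partial>lebesgue) \<noteq> \<infinity>" by (auto simp: top_unique)
  then have fin: "AE x in lebesgue. (\<Sum>n. ennreal (4 ^ n * (d n x)\<^sup>2)) \<noteq> \<infinity>"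
    unfolding d_def by (intro nn_integral_PInf_AE) auto
  have conv: "AE x in lebesgue. convergent (\<lambda>n. h n x)"
    using fin
  proof eventually_elim
    fix x assume *: "(\<Sum>n. ennreal (4 ^ n * (d n x)\<^sup>2)) \<noteq> \<infinity>"
    define S where "S = enn2real (\<Sum>n. ennreal (4 ^ n * (d n x)\<^sup>2))"
    have S: "(\<Sum>n. ennreal (4 ^ n * (d n x)\<^sup>2)) = ennreal S" "S \<ge> 0" using *
      unfolding S_def by (simp_all add: less_top)
    have le: "d n x \<le> sqrt S * (1 / 2) ^ n" for n
    proof -
      have "ennreal (4 ^ n * (d n x)\<^sup>2) \<le> ennreal S"
        unfolding S(1)[symmetric]
        by (rule order_trans[OF _ sum_le_suminf[of "\<lambda>n. ennreal (4 ^ n * (d n x)\<^sup>2)" "{n}"]]) auto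
      then have "4 ^ n * (d n x)\<^sup>2 \<le> S" using S(2) by (simp only: ennreal_le_iff)
      moreover have "(4::real) ^ n = 2 ^ n * 2 ^ n" by (simp add: power_mult_distrib[symmetric])
      then have "4 ^ n * (d n x)\<^sup>2 = (2 ^ n * d n x)\<^sup>2"
        unfolding \<open>4 ^ n = _\<close> by (simp only: power2_eq_square mult_ac)
      ultimately have "(2 ^ n * d n x)\<^sup>2 \<le> S" by (simp only:)
      then have "2 ^ n * d n x \<le> sqrt S" by (rule real_le_rsqrt)
      then show ?thesis by (simp add: power_divide pos_le_divide_eq mult.commute)
    qed
    have "summable (\<lambda>n. h (Suc n) x - h n x)"
    proof (rule summable_comparison_test')
      show "summable (\<lambda>n. sqrt S * (1 / 2) ^ n)" by (intro summable_mult summable_geometric) auto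
      show "norm (h (Suc n) x - h n x) \<le> sqrt S * (1 / 2) ^ n" for n using le[of n] by (simp add: d_def)
    qed
    then have "convergent (\<lambda>n. \<Sum>i<n. h (Suc i) x - h i x)" by (simp add: summable_iff_convergent)
    then have "convergent (\<lambda>n. h n x - h 0 x)" by (simp add: sum_lessThan_telescope[of "\<lambda>i. h i x"])
    then have "convergent (\<lambda>n. (h n x - h 0 x) + h 0 x)" by (intro convergent_add convergent_const)
    then show "convergent (\<lambda>n. h n x)" by simp
  qed
  define g where "g x = lim (\<lambda>n. h n x)" for x
  have gm[measurable]: "g \<in> borel_measurable lebesgue" unfolding g_def[abs_def] by measurable
  have lim: "AE x in lebesgue. (\<lambda>n. h n x) \<longlonglongrightarrow> g x"
    using conv unfolding g_def by (auto elim: eventually_mono simp: convergent_LIMSEQ_iff)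
  \<comment> \<open>The first increment is split off and the rest treated from \<open>Suc n\<close>
    on: the factor 2 lost in each splitting is outweighed by the gain of 16. The constant 4 closes
    the induction because \<open>2 * 4 / 16 + 2 <= 4\<close>.\<close>
  have far: "L2_normsq (\<lambda>x. h (n + j) x - h n x) \<le> ennreal (4 * (1 / 16) ^ n)" for n j
  proof (induction j arbitrary: n)
    case 0
    then show ?case by (simp add: L2_normsq_def)
  next
    case (Suc j)
    have "L2_normsq (\<lambda>x. h (n + Suc j) x - h n x) = L2_normsq (\<lambda>x. (h (Suc n + j) x - h (Suc n) x) + (h (Suc n) x - h n x))" by simp
    also have "\<dots> \<le> 2 * L2_normsq (\<lambda>x. h (Suc n + j) x - h (Suc n) x) + 2 * L2_normsq (\<lambda>x. h (Suc n) x - h n x)"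
      by (rule L2_normsq_add_le2) auto
    also have "\<dots> \<le> 2 * ennreal (4 * (1 / 16) ^ Suc n) + 2 * ennreal ((1 / 16) ^ n)"
      by (intro add_mono mult_left_mono Suc.IH step) auto
    also have "\<dots> = ennreal (2 * (4 * (1 / 16) ^ Suc n) + 2 * (1 / 16) ^ n)"
      by (rule ennreal_double_add) auto
    also have "\<dots> \<le> ennreal (4 * (1 / 16) ^ n)" by (intro ennreal_leI) simp
    finally show ?case .
  qed
  have bound: "L2_normsq (\<lambda>x. h n x - g x) \<le> ennreal (4 * (1 / 16) ^ n)" for n
  proof -
    \<comment> \<open>Letting \<open>j\<close> tend to infinity converts the Cauchy estimate into a
      bound on the distance to the limit.\<close>
    have "L2_normsq (\<lambda>x. g x - h n x) \<le> liminf (\<lambda>j. L2_normsq (\<lambda>x. h (n + j) x - h n x))"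
    proof (rule L2_normsq_Fatou)
      show "AE x in lebesgue. (\<lambda>j. h (n + j) x - h n x) \<longlonglongrightarrow> g x - h n x"
        using lim
      proof eventually_elim
        fix x assume "(\<lambda>n. h n x) \<longlonglongrightarrow> g x"
        then have "(\<lambda>j. h (j + n) x) \<longlonglongrightarrow> g x" by (rule LIMSEQ_ignore_initial_segment)
        then show "(\<lambda>j. h (n + j) x - h n x) \<longlonglongrightarrow> g x - h n x"
          by (intro tendsto_diff tendsto_const) (simp add: add.commute)
      qed
    qed auto
    also have "\<dots> \<le> liminf (\<lambda>j. ennreal (4 * (1 / 16) ^ n))"
      by (intro Liminf_mono always_eventually allI far)
    finally show ?thesis by (simp add: Liminf_const L2_normsq_minus_commute)
  qed
  have z: "(\<lambda>n. ennreal (4 * (1 / 16) ^ n)) \<longlonglongrightarrow> 0"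
  proof -
    have "(\<lambda>n. 4 * (1 / 16) ^ n :: real) \<longlonglongrightarrow> 4 * 0"
      by (intro tendsto_mult tendsto_const LIMSEQ_realpow_zero) auto
    from tendsto_ennrealI[OF this] show ?thesis by simp
  qed
  have "(\<lambda>n. L2_normsq (\<lambda>x. h n x - g x)) \<longlonglongrightarrow> 0"
    by (rule tendsto_sandwich[OF _ _ tendsto_const z]) (use bound in auto)
  moreover have "g \<in> Lp 2"
  proof -
    have "(\<lambda>x. h 0 x - g x) \<in> Lp 2" using bound[of 0] by (auto simp: Lp_2_iff intro: le_less_trans)
    from Lp_2_diff[OF h[of 0] this] show ?thesis by simp
  qed
  ultimately show ?thesis by blast
qed

text \<open>On a bounded interval square integrability implies integrability, here through
  \<open>t <= 1 + t^2\<close>.\<close>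

lemma Lp_2_restrict:
  fixes f :: "real \<Rightarrow> complex"
  assumes f: "f \<in> Lp 2"
  shows "(\<lambda>x. indicat_real {-a..a} x * f x) \<in> Lp 1 \<inter> Lp 2"
proof -
  let ?r = "\<lambda>x. complex_of_real (indicat_real {-a..a} x) * f x"
  have ind: "indicat_real {-a..a} \<in> borel_measurable lebesgue" by (rule borel_measurable_indicator) auto
  have m: "?r \<in> borel_measurable lebesgue" using Lp_measurable[OF f] ind by measurable
  have "L2_normsq ?r \<le> L2_normsq f"
    unfolding L2_normsq_def by (intro nn_integral_mono ennreal_leI power_mono) (auto split: split_indicator)
  then have "?r \<in> Lp 2" using m f by (auto simp: Lp_2_iff)
  moreover have "integrable lebesgue ?r"
  proof (rule integrableI_bounded[OF m])
    have "(\<integral>\<^sup>+x. ennreal (cmod (?r x)) \<partial>lebesgue) \<le> (\<integral>\<^sup>+x. ennreal (indicat_real {-a..a} x) + ennreal ((cmod (f x))\<^sup>2) \<partial>lebesgue)"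
    proof (intro nn_integral_mono)
      fix x
      have "cmod (f x) \<le> 1 + (cmod (f x))\<^sup>2"
        using sum_squares_bound[of 1 "cmod (f x)"] norm_ge_zero[of "f x"]
        unfolding power_one mult_1_right by linarith
      then show "ennreal (cmod (?r x)) \<le> ennreal (indicat_real {-a..a} x) + ennreal ((cmod (f x))\<^sup>2)"
        by (auto split: split_indicator simp: ennreal_plus[symmetric] simp del: ennreal_plus intro!: ennreal_leI)
    qed
    also have "\<dots> = (\<integral>\<^sup>+x. ennreal (indicat_real {-a..a} x) \<partial>lebesgue) + L2_normsq f"
      unfolding L2_normsq_def using ind Lp_measurable[OF f] by (intro nn_integral_add) auto
    also have "(\<integral>\<^sup>+x. ennreal (indicat_real {-a..a} x) \<partial>lebesgue) = emeasure lborel {-a..a}"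
      unfolding nn_integral_completion by (simp add: ennreal_indicator)
    also have "\<dots> + L2_normsq f < \<infinity>" using f by (simp add: Lp_2_iff emeasure_lborel_Icc_eq)
    finally show "(\<integral>\<^sup>+x. ennreal (cmod (?r x)) \<partial>lebesgue) < \<infinity>" .
  qed
  ultimately show ?thesis by (simp add: Lp_1_iff)
qed

lemma L2_normsq_restrict_tendsto:
  fixes f :: "real \<Rightarrow> complex"
  assumes f: "f \<in> Lp 2"
  shows "(\<lambda>n. L2_normsq (\<lambda>x. indicat_real {- real n..real n} x * f x - f x)) \<longlonglongrightarrow> 0"
proof (rule L2_normsq_dominated_convergence[where d = "\<lambda>x. cmod (f x)"])
  show "AE x in lebesgue. (\<lambda>n. complex_of_real (indicat_real {- real n..real n} x) * f x) \<longlonglongrightarrow> f x"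
  proof (intro AE_I2 tendsto_eventually)
    fix x
    obtain N where "\<bar>x\<bar> \<le> real N" using real_arch_simple by blast
    then have "\<forall>n\<ge>N. complex_of_real (indicat_real {- real n..real n} x) * f x = f x"
      by (auto split: split_indicator)
    then show "\<forall>\<^sub>F n in sequentially. complex_of_real (indicat_real {- real n..real n} x) * f x = f x"
      by (auto simp: eventually_sequentially)
  qed
  show "(\<lambda>x. complex_of_real (indicat_real {- real n..real n} x) * f x) \<in> borel_measurable lebesgue" for n
    using Lp_2_restrict[OF f] by (auto intro: Lp_measurable)
qed (use f in \<open>auto simp: Lp_2_iff L2_normsq_def split: split_indicator\<close>)

lemma ex_fourier_L2:
  assumes f: "f \<in> Lp 2"
  shows "\<exists>g. is_fourier_L2 f g"
proof -
  let ?u = "\<lambda>n x. complex_of_real (indicat_real {- real n..real n} x) * f x"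
  \<comment> \<open>The tolerance is chosen so that successive transforms differ by at most
    \<open>(1 / 16) ^ n\<close>, the rate required by \<open>L2_normsq_complete\<close>.\<close>
  have "\<exists>w. w \<in> Lp 1 \<inter> Lp 2 \<and> L2_normsq (\<lambda>x. w x - f x) < ennreal ((1 / 16) ^ n / 4)" for n
  proof -
    have "\<forall>\<^sub>F j in sequentially. L2_normsq (\<lambda>x. ?u j x - f x) < ennreal ((1 / 16) ^ n / 4)"
      by (rule order_tendstoD(2)[OF L2_normsq_restrict_tendsto[OF f]]) auto
    then obtain j where "L2_normsq (\<lambda>x. ?u j x - f x) < ennreal ((1 / 16) ^ n / 4)" by (auto simp: eventually_sequentially)
    then show ?thesis using Lp_2_restrict[OF f, of "real j"] by blast
  qed
  then obtain w where w: "\<And>n. w n \<in> Lp 1 \<inter> Lp 2" "\<And>n. L2_normsq (\<lambda>x. w n x - f x) < ennreal ((1 / 16) ^ n / 4)"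
    by metis
  have wm: "w n \<in> borel_measurable lebesgue" for n using w(1)[of n] by (auto intro: Lp_measurable)
  have fm: "f \<in> borel_measurable lebesgue" by (rule Lp_measurable[OF f])
  have "\<exists>g \<in> Lp 2. (\<lambda>n. L2_normsq (\<lambda>x. fourier_L1 (w n) x - g x)) \<longlonglongrightarrow> 0"
  proof (rule L2_normsq_complete)
    show "fourier_L1 (w n) \<in> Lp 2" for n using w(1)[of n] by (auto intro: fourier_L1_Lp_2)
    fix n
    have "L2_normsq (\<lambda>x. fourier_L1 (w (Suc n)) x - fourier_L1 (w n) x) \<le> L2_normsq (\<lambda>x. w (Suc n) x - w n x)"
      using w(1) by (intro is_fourier_L2_le is_fourier_L2_diff is_fourier_L2_L1 Lp_2_diff) auto
    also have "\<dots> = L2_normsq (\<lambda>x. (w (Suc n) x - f x) + (f x - w n x))" by simp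
    also have "\<dots> \<le> 2 * L2_normsq (\<lambda>x. w (Suc n) x - f x) + 2 * L2_normsq (\<lambda>x. f x - w n x)"
      using wm fm by (intro L2_normsq_add_le2) auto
    also have "\<dots> \<le> 2 * ennreal ((1 / 16) ^ Suc n / 4) + 2 * ennreal ((1 / 16) ^ n / 4)"
      using w(2)[of n] w(2)[of "Suc n"] by (intro add_mono mult_left_mono) (auto simp: L2_normsq_minus_commute[of f] intro: less_imp_le)
    also have "\<dots> = ennreal (2 * ((1 / 16) ^ Suc n / 4) + 2 * ((1 / 16) ^ n / 4))"
      by (rule ennreal_double_add) auto
    also have "\<dots> \<le> ennreal ((1 / 16) ^ n)" by (intro ennreal_leI) simp
    finally show "L2_normsq (\<lambda>x. fourier_L1 (w (Suc n)) x - fourier_L1 (w n) x) \<le> ennreal ((1 / 16) ^ n)" .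
  qed
  then obtain g where g: "g \<in> Lp 2" "(\<lambda>n. L2_normsq (\<lambda>x. fourier_L1 (w n) x - g x)) \<longlonglongrightarrow> 0" by blast
  have z: "(\<lambda>n. ennreal ((1 / 16) ^ n / 4)) \<longlonglongrightarrow> 0"
  proof -
    have "(\<lambda>n. (1 / 16) ^ n / 4 :: real) \<longlonglongrightarrow> 0 / 4"
      by (intro tendsto_divide tendsto_const LIMSEQ_realpow_zero) auto
    from tendsto_ennrealI[OF this] show ?thesis by simp
  qed
  have "(\<lambda>n. L2_normsq (\<lambda>x. w n x - f x)) \<longlonglongrightarrow> 0"
    by (rule tendsto_sandwich[OF _ _ tendsto_const z]) (auto intro!: always_eventually less_imp_le w(2))
  then have "is_fourier_L2 f g" unfolding is_fourier_L2_iff using g w(1) by auto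
  then show ?thesis by blast
qed

lemma is_fourier_L2_fourier: "f \<in> Lp 2 \<Longrightarrow> is_fourier_L2 f (fourier f)"
  unfolding fourier_def by (rule someI_ex[OF ex_fourier_L2])

subsection \<open>Inversion and Parseval\<close>

lemma measurable_reflect: "f \<in> borel_measurable lebesgue \<Longrightarrow> (\<lambda>x. f (- x)) \<in> borel_measurable (lebesgue :: real measure)"
  using measurable_compose[OF lebesgue_affine_measurable[of "\<lambda>_. -1" "0::real"], of f borel] by simp

lemma lebesgue_reflect: "distr lebesgue lebesgue uminus = (lebesgue :: real measure)"
proof -
  have "lebesgue = density (distr lebesgue lebesgue (\<lambda>x::real. -1 * x)) (\<lambda>x. ennreal \<bar>-1\<bar>)"
    by (rule lebesgue_real_scale) auto
  moreover have "(\<lambda>x::real. - x) = uminus" by auto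
  ultimately show ?thesis by (simp add: density_1)
qed

lemma uminus_measurable_lebesgue: "uminus \<in> lebesgue \<rightarrow>\<^sub>M (lebesgue :: real measure)"
  using lebesgue_affine_measurable[of "\<lambda>_. -1" "0::real"] by simp

lemma L2_normsq_reflect: 
  assumes "f \<in> borel_measurable lebesgue"
  shows "L2_normsq (\<lambda>x. f (- x)) = L2_normsq f"
proof -
  have "L2_normsq f = (\<integral>\<^sup>+x. ennreal ((cmod (f x))\<^sup>2) \<partial>distr lebesgue lebesgue uminus)"
    unfolding L2_normsq_def lebesgue_reflect ..
  also have "\<dots> = L2_normsq (\<lambda>x. f (- x))"
    unfolding L2_normsq_def using assms by (subst nn_integral_distr[OF uminus_measurable_lebesgue]) auto
  finally show ?thesis ..
qed

lemma Lp_2_reflect: "f \<in> Lp 2 \<Longrightarrow> (\<lambda>x. f (- x)) \<in> Lp 2"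
  by (auto simp: Lp_2_iff L2_normsq_reflect measurable_reflect)

lemma Lp_1_reflect:
  assumes "f \<in> Lp 1" shows "(\<lambda>x. f (- x)) \<in> Lp 1"
proof -
  have "integrable (distr lebesgue lebesgue uminus) f" using assms by (simp add: lebesgue_reflect Lp_1_iff)
  then show ?thesis
    unfolding Lp_1_iff by (subst (asm) integrable_distr_eq[OF uminus_measurable_lebesgue]) (use assms in \<open>auto intro: Lp_measurable\<close>)
qed

lemma fourier_L1_reflect:
  assumes "u \<in> Lp 1"
  shows "fourier_L1 (\<lambda>x. u (- x)) \<omega> = fourier_L1 u (- \<omega>)"
proof -
  have e: "(\<lambda>x. exp (\<i> * complex_of_real \<omega> * complex_of_real x)) \<in> borel_measurable lebesgue"
    by (rule borel_imp_lebesgue) measurable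
  have "(LINT x|lebesgue. u x * exp (\<i> * complex_of_real \<omega> * complex_of_real x)) =
      (LINT x|distr lebesgue lebesgue uminus. u x * exp (\<i> * complex_of_real \<omega> * complex_of_real x))"
    unfolding lebesgue_reflect ..
  also have "\<dots> = (LINT x|lebesgue. u (- x) * exp (- (\<i> * complex_of_real \<omega> * complex_of_real x)))"
    by (subst integral_distr[OF uminus_measurable_lebesgue]) (use e Lp_measurable[OF assms] in auto)
  finally show ?thesis unfolding fourier_L1_def by simp
qed

lemma is_fourier_L2_reflect:
  assumes "is_fourier_L2 f g" and f: "f \<in> Lp 2"
  shows "is_fourier_L2 (\<lambda>x. f (- x)) (\<lambda>x. g (- x))"
proof -
  obtain u where u: "\<And>n. u n \<in> Lp 1 \<inter> Lp 2" "(\<lambda>n. L2_normsq (\<lambda>x. u n x - f x)) \<longlonglongrightarrow> 0"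
    "(\<lambda>n. L2_normsq (\<lambda>\<omega>. fourier_L1 (u n) \<omega> - g \<omega>)) \<longlonglongrightarrow> 0" and g: "g \<in> Lp 2"
    using assms(1) unfolding is_fourier_L2_iff by blast
  have 1: "L2_normsq (\<lambda>x. u n (- x) - f (- x)) = L2_normsq (\<lambda>x. u n x - f x)" for n
    using u(1)[of n] f by (intro L2_normsq_reflect[of "\<lambda>x. u n x - f x"] borel_measurable_diff) (auto intro: Lp_measurable)
  have 2: "L2_normsq (\<lambda>x. fourier_L1 (\<lambda>x. u n (- x)) x - g (- x)) = L2_normsq (\<lambda>x. fourier_L1 (u n) x - g x)" for n
    using u(1)[of n] L2_normsq_reflect[OF Lp_measurable[OF Lp_2_diff[OF fourier_L1_Lp_2[of "u n"] g]]]
    by (auto simp: fourier_L1_reflect)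
  show ?thesis
    unfolding is_fourier_L2_iff using u g
    by (intro conjI exI[of _ "\<lambda>n x. u n (- x)"]) (auto simp: 1 2 intro: Lp_1_reflect Lp_2_reflect)
qed

lemma bounded_support_Lp:
  assumes m: "u \<in> borel_measurable lebesgue" and B: "\<And>x. cmod (u x) \<le> B" and a: "\<And>x. a < \<bar>x\<bar> \<Longrightarrow> u x = 0"
  shows "u \<in> Lp 1 \<inter> Lp 2"
proof -
  have B0: "0 \<le> B" using B[of 0] norm_ge_zero order_trans by blast
  have l: "(\<integral>\<^sup>+x. ennreal c * indicator {-a..a} x \<partial>lebesgue) < \<infinity>" for c
    unfolding nn_integral_completion by (subst nn_integral_cmult) (auto simp: ennreal_mult_less_top emeasure_lborel_Icc_eq)
  have "L2_normsq u \<le> (\<integral>\<^sup>+x. ennreal (B\<^sup>2) * indicator {-a..a} x \<partial>lebesgue)"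
    unfolding L2_normsq_def using B a B0 by (intro nn_integral_mono) (fastforce split: split_indicator intro!: ennreal_leI power_mono)
  then have "u \<in> Lp 2" using l[of "B\<^sup>2"] m by (auto simp: Lp_2_iff intro: le_less_trans)
  moreover have "(\<integral>\<^sup>+x. ennreal (cmod (u x)) \<partial>lebesgue) \<le> (\<integral>\<^sup>+x. ennreal B * indicator {-a..a} x \<partial>lebesgue)"
    using B a B0 by (intro nn_integral_mono) (fastforce split: split_indicator intro!: ennreal_leI)
  then have "u \<in> Lp 1" using l[of B] m by (auto simp: Lp_1_iff integrable_iff_bounded intro: le_less_trans)
  ultimately show ?thesis by simp
qed

text \<open>Substituting \<open>y = x - z / s\<close> freezes the kernel to the standard normal
  density and moves the parameter into the argument of \<open>u\<close>, so continuity and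
  boundedness allow dominated convergence.\<close>

lemma gauss_convolution_tendsto:
  assumes u: "continuous_on UNIV u" and B: "\<And>x. cmod (u x) \<le> B"
  shows "(\<lambda>n. LINT y|lborel. u y * gauss_kernel (real (Suc n)) (x - y)) \<longlonglongrightarrow> u x"
proof -
  have [measurable]: "u \<in> borel_measurable borel" by (rule borel_measurable_continuous_onI[OF u])
  have eq: "(LINT y|lborel. u y * gauss_kernel s (x - y)) = (LINT z|lborel. u (x - z / s) * std_normal_density z)" if s: "s > 0" for s
  proof -
    have "(LINT y|lborel. u y * gauss_kernel s (x - y)) =
        \<bar>- 1 / s\<bar> *\<^sub>R (LINT z|lborel. u (x + (- 1 / s) * z) * gauss_kernel s (x - (x + (- 1 / s) * z)))"
      using s by (intro lborel_integral_real_affine) auto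
    also have "\<dots> = (LINT z|lborel. \<bar>- 1 / s\<bar> *\<^sub>R (u (x + (- 1 / s) * z) * gauss_kernel s (x - (x + (- 1 / s) * z))))"
      by (rule Bochner_Integration.integral_scaleR_right[symmetric])
    also have "\<dots> = (LINT z|lborel. u (x - z / s) * std_normal_density z)"
      using s by (intro Bochner_Integration.integral_cong refl) (simp add: gauss_kernel_def scaleR_conv_of_real)
    finally show ?thesis .
  qed
  have "(\<lambda>n. LINT z|lborel. u (x - z / real (Suc n)) * std_normal_density z) \<longlonglongrightarrow> (LINT z|lborel. u x * std_normal_density z)"
  proof (rule integral_dominated_convergence[where w = "\<lambda>z. B * std_normal_density z"])
    show "integrable lborel (\<lambda>z. B * std_normal_density z)" using integrable_std_normal by simp
    show "AE z in lborel. (\<lambda>n. u (x - z / real (Suc n)) * std_normal_density z) \<longlonglongrightarrow> u x * std_normal_density z"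
    proof (intro AE_I2 tendsto_mult tendsto_const)
      fix z
      have "(\<lambda>n. x - z * (1 / real (Suc n))) \<longlonglongrightarrow> x - z * 0"
        by (intro tendsto_intros LIMSEQ_Suc lim_1_over_n)
      then have "(\<lambda>n. x - z / real (Suc n)) \<longlonglongrightarrow> x" by simp
      then show "(\<lambda>n. u (x - z / real (Suc n))) \<longlonglongrightarrow> u x"
        using u by (intro continuous_on_tendsto_compose[OF u]) auto
    qed
    show "AE z in lborel. norm (u (x - z / real (Suc n)) * std_normal_density z) \<le> B * std_normal_density z" for n
      using B by (intro AE_I2) (auto simp: norm_mult intro!: mult_right_mono)
  qed auto
  moreover have "(LINT z|lborel. u x * std_normal_density z) = u x"
  proof -
    have "(LINT z|lborel. u x * std_normal_density z) = u x * (LINT z|lborel. complex_of_real (std_normal_density z))"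
      by (rule integral_mult_right_zero)
    then show ?thesis by (simp add: integral_complex_of_real integral_std_normal)
  qed
  ultimately show ?thesis by (simp add: eq)
qed

text \<open>Inversion in the form "transforming twice reflects", which avoids a separate inverse
  transform. The damped transforms \<open>v n\<close> are integrable; their transforms are Gaussian
  averages of \<open>u\<close> at \<open>- x\<close>, which converge pointwise to
  \<open>u (- x)\<close> and, by contraction, in mean square to the transform of \<open>U\<close>.
  The two limits agree.\<close>

lemma fourier_L1_inversion:
  assumes u: "continuous_on UNIV u" and B: "\<And>x. cmod (u x) \<le> B" and a: "\<And>x. a < \<bar>x\<bar> \<Longrightarrow> u x = 0"
  shows "is_fourier_L2 (fourier_L1 u) (\<lambda>x. u (- x))"
proof -
  have ub[measurable]: "u \<in> borel_measurable borel" by (rule borel_measurable_continuous_onI[OF u])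
  have uL: "u \<in> Lp 1" "u \<in> Lp 2" using bounded_support_Lp[OF borel_imp_lebesgue[OF ub] B a] by auto
  have iu: "integrable lborel u" using uL ub by (simp add: Lp_1_iff integrable_completion)
  define U where "U = fourier_L1 u"
  have Ub[measurable]: "U \<in> borel_measurable borel" unfolding U_def by (rule borel_measurable_fourier_L1[OF ub])
  have U2: "U \<in> Lp 2" unfolding U_def by (rule fourier_L1_Lp_2[OF uL])
  define C where "C = (LINT x|lborel. cmod (u x))"
  have C: "cmod (U \<omega>) \<le> C" for \<omega> unfolding C_def U_def by (rule norm_fourier_L1_le[OF ub iu])
  define v where "v n \<omega> = U \<omega> * gauss_weight (real (Suc n)) \<omega>" for n \<omega>
  have vb[measurable]: "v n \<in> borel_measurable borel" for n unfolding v_def[abs_def] by measurable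
  have vU: "cmod (v n \<omega>) \<le> cmod (U \<omega>)" for n \<omega>
    using gauss_weight_bounds[of "real (Suc n)" \<omega>] by (simp add: v_def norm_mult mult_left_le)
  have iv: "integrable lborel (v n)" for n
  proof (rule Bochner_Integration.integrable_bound[where f = "\<lambda>\<omega>. C * gauss_weight (real (Suc n)) \<omega>"])
    show "AE \<omega> in lborel. norm (v n \<omega>) \<le> norm (C * gauss_weight (real (Suc n)) \<omega>)"
      using C gauss_weight_bounds(1)[of "real (Suc n)"] order_trans[OF norm_ge_zero C]
      by (intro AE_I2) (auto simp: v_def norm_mult abs_mult intro!: mult_right_mono)
  qed (use integrable_gauss_weight in auto)
  have v1: "v n \<in> Lp 1" for n using iv vb by (simp add: Lp_1_iff integrable_completion)
  have v2: "v n \<in> Lp 2" for n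
  proof -
    have "L2_normsq (v n) \<le> L2_normsq U" unfolding L2_normsq_def using vU by (intro nn_integral_mono ennreal_leI power_mono) auto
    then show ?thesis using U2 borel_imp_lebesgue[OF vb] by (auto simp: Lp_2_iff intro: le_less_trans)
  qed
  have vlim: "(\<lambda>n. L2_normsq (\<lambda>x. v n x - U x)) \<longlonglongrightarrow> 0"
  proof (rule L2_normsq_dominated_convergence[where d = "\<lambda>x. cmod (U x)"])
    show "AE x in lebesgue. (\<lambda>n. v n x) \<longlonglongrightarrow> U x"
    proof (rule AE_I2)
      fix x
      have "(\<lambda>n. exp (- ((x * (1 / real (Suc n)))\<^sup>2 / 2))) \<longlonglongrightarrow> exp (- ((x * 0)\<^sup>2 / 2))"
        by (intro tendsto_intros LIMSEQ_Suc lim_1_over_n) auto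
      then have "(\<lambda>n. gauss_weight (real (Suc n)) x) \<longlonglongrightarrow> 1" by (simp add: gauss_weight_def)
      then have "(\<lambda>n. U x * complex_of_real (gauss_weight (real (Suc n)) x)) \<longlonglongrightarrow> U x * complex_of_real 1"
        by (intro tendsto_intros)
      then show "(\<lambda>n. v n x) \<longlonglongrightarrow> U x" by (simp add: v_def)
    qed
  qed (use vU U2 borel_imp_lebesgue[OF vb] borel_imp_lebesgue[OF Ub] in \<open>auto simp: Lp_2_iff L2_normsq_def\<close>)
  obtain g where g: "is_fourier_L2 U g" using ex_fourier_L2[OF U2] by blast
  have gL: "g \<in> Lp 2" by (rule is_fourier_L2_Lp[OF g])
  have lim2: "(\<lambda>n. L2_normsq (\<lambda>x. fourier_L1 (v n) x - g x)) \<longlonglongrightarrow> 0"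
  proof (rule tendsto_sandwich[OF _ _ tendsto_const vlim])
    show "\<forall>\<^sub>F n in sequentially. L2_normsq (\<lambda>x. fourier_L1 (v n) x - g x) \<le> L2_normsq (\<lambda>x. v n x - U x)"
      by (intro always_eventually allI is_fourier_L2_le is_fourier_L2_diff is_fourier_L2_L1 Lp_2_diff v1 v2 U2 g)
  qed auto
  have "fourier_L1 (v n) x = (LINT y|lborel. u y * gauss_kernel (real (Suc n)) (- x - y))" for n x
  proof -
    have "(LINT \<omega>|lborel. v n \<omega> * exp (- (\<i> * complex_of_real x * complex_of_real \<omega>))) =
        (LINT \<omega>|lborel. fourier_L1 u \<omega> * gauss_weight (real (Suc n)) \<omega> * exp (\<i> * complex_of_real \<omega> * complex_of_real (- x)))"
      by (intro Bochner_Integration.integral_cong refl) (simp add: v_def U_def mult_ac)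
    also have "\<dots> = complex_of_real (sqrt (2 * pi)) * (LINT y|lborel. u y * gauss_kernel (real (Suc n)) (- x - y))"
      by (rule gauss_inversion[OF ub iu]) auto
    finally show ?thesis unfolding fourier_L1_borel[OF vb] by simp
  qed
  then have "(\<lambda>n. fourier_L1 (v n) x) \<longlonglongrightarrow> u (- x)" for x
    using gauss_convolution_tendsto[OF u B, of "- x"] by simp
  then have "AE x in lebesgue. u (- x) = g x"
    using borel_imp_lebesgue[OF borel_measurable_fourier_L1[OF vb]] borel_imp_lebesgue[of "\<lambda>x. u (- x)"]
    by (intro L2_normsq_limit_unique[OF _ Lp_measurable[OF gL] _ lim2]) auto
  then have "AE x in lebesgue. g x = u (- x)" by (auto elim: eventually_mono)
  then show ?thesis
    unfolding U_def[symmetric] using borel_imp_lebesgue[of "\<lambda>x. u (- x)"]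
    by (intro is_fourier_L2_cong[OF g]) auto
qed

text \<open>Measurability supplies continuous functions converging almost everywhere, but without a
  common bound or support. A radial clipping and a cutoff restore both while keeping the limit, so
  that dominated convergence applies.\<close>

lemma L2_normsq_dense_continuous_aux:
  assumes hm: "h \<in> borel_measurable lebesgue" and hB: "\<And>x. cmod (h x) \<le> N" and ha: "\<And>x. N < \<bar>x\<bar> \<Longrightarrow> h x = 0"
    and N: "N > 0" and e: "e > 0"
  shows "\<exists>u. continuous_on UNIV u \<and> (\<forall>x. cmod (u x) \<le> N) \<and> (\<forall>x. N + 1 < \<bar>x\<bar> \<longrightarrow> u x = 0) \<and> L2_normsq (\<lambda>x. u x - h x) < e"
proof -
  have "h measurable_on UNIV" using lebesgue_measurable_imp_measurable_on[OF hm, of UNIV] by simp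
  then obtain Z g where Z: "negligible Z" and gc: "\<And>n. continuous_on UNIV (g n)"
    and gl: "\<And>x. x \<notin> Z \<Longrightarrow> (\<lambda>n. g n x) \<longlonglongrightarrow> h x"
    unfolding measurable_on_def by auto
  \<comment> \<open>A trapezoid: 1 where \<open>h\<close> may be nonzero, 0 from distance
    \<open>N + 1\<close> on.\<close>
  define chi where "chi x = max 0 (min 1 (N + 1 - \<bar>x\<bar>))" for x :: real
  \<comment> \<open>Radial retraction of the plane onto the disc of radius \<open>N\<close>; the
    maximum keeps the denominator away from 0, which gives continuity.\<close>
  define clip where "clip z = z / complex_of_real (max 1 (cmod z / N))" for z
  have cpos: "max 1 (cmod z / N) > 0" for z by (simp add: max_def)
  have clipc: "continuous_on UNIV clip"
  proof -
    have "complex_of_real (max 1 (cmod z / N)) \<noteq> 0" for z using cpos[of z] by (metis less_irrefl of_real_eq_0_iff)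
    then show ?thesis unfolding clip_def[abs_def] using N by (intro continuous_intros) auto
  qed
  have clipN: "cmod (clip z) \<le> N" for z
  proof -
    have "cmod (clip z) = cmod z / max 1 (cmod z / N)"
      unfolding clip_def norm_divide norm_of_real using cpos[of z] by (simp only: abs_of_pos)
    also have "\<dots> \<le> N" using cpos[of z] N by (simp add: pos_divide_le_eq max_def field_simps)
    finally show ?thesis .
  qed
  have clip_id: "clip z = z" if "cmod z \<le> N" for z using that N by (simp add: clip_def max_def field_simps)
  define u where "u n x = complex_of_real (chi x) * clip (g n x)" for n x
  have uc: "continuous_on UNIV (u n)" for n
    unfolding u_def[abs_def] chi_def
    by (intro continuous_intros continuous_on_compose2[OF clipc gc]) auto
  have chi01: "0 \<le> chi x" "chi x \<le> 1" for x by (auto simp: chi_def)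
  have uN: "cmod (u n x) \<le> N" for n x
    using mult_mono[OF chi01(2)[of x] clipN[of "g n x"]] chi01[of x] by (simp add: u_def norm_mult)
  have u0: "u n x = 0" if "N + 1 < \<bar>x\<bar>" for n x using that by (simp add: u_def chi_def)
  have "(\<lambda>n. L2_normsq (\<lambda>x. u n x - h x)) \<longlonglongrightarrow> 0"
  proof (rule L2_normsq_dominated_convergence[where d = "\<lambda>x. N * indicator {- (N + 1)..N + 1} x"])
    have "AE x in lebesgue. x \<notin> Z" using Z by (intro AE_not_in) (simp add: negligible_iff_null_sets)
    then show "AE x in lebesgue. (\<lambda>n. u n x) \<longlonglongrightarrow> h x"
    proof eventually_elim
      fix x assume x: "x \<notin> Z"
      have "(\<lambda>n. clip (g n x)) \<longlonglongrightarrow> clip (h x)"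
        by (rule continuous_on_tendsto_compose[OF clipc gl[OF x]]) auto
      then have "(\<lambda>n. u n x) \<longlonglongrightarrow> complex_of_real (chi x) * clip (h x)" unfolding u_def by (intro tendsto_intros)
      moreover have "complex_of_real (chi x) * clip (h x) = h x"
        using ha[of x] clip_id[OF hB[of x]] by (cases "N < \<bar>x\<bar>") (auto simp: chi_def)
      ultimately show "(\<lambda>n. u n x) \<longlonglongrightarrow> h x" by simp
    qed
    show "AE x in lebesgue. cmod (u n x) \<le> N * indicator {- (N + 1)..N + 1} x" for n
      using uN u0 N by (intro AE_I2) (auto split: split_indicator)
    show "u n \<in> borel_measurable lebesgue" for n
      by (intro borel_imp_lebesgue borel_measurable_continuous_onI uc)
    show "(\<lambda>x. N * indicator {- (N + 1)..N + 1} x) \<in> borel_measurable lebesgue"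
      by (rule borel_imp_lebesgue) measurable
    have "(\<integral>\<^sup>+x. ennreal ((N * indicator {- (N + 1)..N + 1} x)\<^sup>2) \<partial>lebesgue) = (\<integral>\<^sup>+x. ennreal (N\<^sup>2) * indicator {- (N + 1)..N + 1} x \<partial>lebesgue)"
      by (intro nn_integral_cong) (auto split: split_indicator)
    also have "\<dots> < \<infinity>"
      unfolding nn_integral_completion by (subst nn_integral_cmult) (auto simp: ennreal_mult_less_top emeasure_lborel_Icc_eq)
    finally show "(\<integral>\<^sup>+x. ennreal ((N * indicator {- (N + 1)..N + 1} x)\<^sup>2) \<partial>lebesgue) < \<infinity>" .
  qed (rule hm)
  from order_tendstoD(2)[OF this e] obtain n where "L2_normsq (\<lambda>x. u n x - h x) < e" by (auto simp: eventually_sequentially)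
  then show ?thesis using uc uN u0 by blast
qed

text \<open>Truncation of both the domain and the range at \<open>Suc n\<close> reduces to bounded
  functions of bounded support; these are then approximated within
  \<open>1 / (n + 1)\<close>.\<close>

lemma L2_normsq_dense_continuous:
  assumes f: "f \<in> Lp 2"
  shows "\<exists>u. (\<forall>n::nat. continuous_on UNIV (u n) \<and> (\<exists>B. \<forall>x. cmod (u n x) \<le> B) \<and> (\<exists>a. \<forall>x. a < \<bar>x\<bar> \<longrightarrow> u n x = 0)) \<and>
      (\<lambda>n. L2_normsq (\<lambda>x. u n x - f x)) \<longlonglongrightarrow> 0"
proof -
  have fm[measurable]: "f \<in> borel_measurable lebesgue" by (rule Lp_measurable[OF f])
  have ind: "indicat_real {- a..a} \<in> borel_measurable lebesgue" for a :: real
    by (intro borel_imp_lebesgue borel_measurable_indicator) simp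
  define h where "h n x = complex_of_real (indicat_real {- real (Suc n)..real (Suc n)} x) * (if cmod (f x) \<le> real (Suc n) then f x else 0)" for n x
  have hm: "h n \<in> borel_measurable lebesgue" for n unfolding h_def[abs_def] using ind[of "real (Suc n)"] by measurable
  have hl: "(\<lambda>n. L2_normsq (\<lambda>x. h n x - f x)) \<longlonglongrightarrow> 0"
  proof (rule L2_normsq_dominated_convergence[where d = "\<lambda>x. cmod (f x)"])
    show "AE x in lebesgue. (\<lambda>n. h n x) \<longlonglongrightarrow> f x"
    proof (intro AE_I2 tendsto_eventually)
      fix x
      obtain N where "max \<bar>x\<bar> (cmod (f x)) \<le> real N" using real_arch_simple by blast
      then have "\<forall>n\<ge>N. h n x = f x" by (auto simp: h_def split: split_indicator)
      then show "\<forall>\<^sub>F n in sequentially. h n x = f x" by (auto simp: eventually_sequentially)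
    qed
    show "AE x in lebesgue. cmod (h n x) \<le> cmod (f x)" for n
      by (auto simp: h_def split: split_indicator)
  qed (use f hm in \<open>auto simp: Lp_2_iff L2_normsq_def\<close>)
  have ex: "\<exists>u. continuous_on UNIV u \<and> (\<forall>x. cmod (u x) \<le> real (Suc n)) \<and> (\<forall>x. real (Suc n) + 1 < \<bar>x\<bar> \<longrightarrow> u x = 0) \<and> L2_normsq (\<lambda>x. u x - h n x) < ennreal (1 / real (Suc n))" for n
  proof (rule L2_normsq_dense_continuous_aux[OF hm])
    show "cmod (h n x) \<le> real (Suc n)" for x unfolding h_def by (simp split: split_indicator)
    show "h n x = 0" if "real (Suc n) < \<bar>x\<bar>" for x
      using that unfolding h_def by (auto simp: indicator_def)
  qed auto
  from choice[OF allI[OF ex]]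
  obtain u where u': "\<forall>n. continuous_on UNIV (u n) \<and> (\<forall>x. cmod (u n x) \<le> real (Suc n)) \<and> (\<forall>x. real (Suc n) + 1 < \<bar>x\<bar> \<longrightarrow> u n x = 0) \<and> L2_normsq (\<lambda>x. u n x - h n x) < ennreal (1 / real (Suc n))"
    by (rule exE)
  then have u: "\<And>n. continuous_on UNIV (u n)" "\<And>n x. cmod (u n x) \<le> real (Suc n)"
    "\<And>n x. real (Suc n) + 1 < \<bar>x\<bar> \<Longrightarrow> u n x = 0" "\<And>n. L2_normsq (\<lambda>x. u n x - h n x) < ennreal (1 / real (Suc n))"
    by blast+
  have z: "(\<lambda>n. ennreal (1 / real (Suc n))) \<longlonglongrightarrow> 0"
    using tendsto_ennrealI[OF LIMSEQ_Suc[OF lim_1_over_n]] by simp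
  have ul: "(\<lambda>n. L2_normsq (\<lambda>x. u n x - h n x)) \<longlonglongrightarrow> 0"
    by (rule tendsto_sandwich[OF _ _ tendsto_const z]) (use u(4) in \<open>auto intro!: always_eventually less_imp_le simp del: of_nat_Suc\<close>)
  have "(\<lambda>n. L2_normsq (\<lambda>x. (u n x - h n x) + (h n x - f x))) \<longlonglongrightarrow> 0"
    by (intro L2_normsq_tendsto_0_add ul hl borel_measurable_diff hm fm borel_imp_lebesgue[OF borel_measurable_continuous_onI[OF u(1)]])
  then have lim: "(\<lambda>n. L2_normsq (\<lambda>x. u n x - f x)) \<longlonglongrightarrow> 0" by simp
  show ?thesis
  proof (intro exI[of _ u] conjI allI)
    show "\<exists>B. \<forall>x. cmod (u n x) \<le> B" for n using u(2) by blast
    show "\<exists>a. \<forall>x. a < \<bar>x\<bar> \<longrightarrow> u n x = 0" for n using u(3) by blast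
  qed (rule u(1) lim)+
qed

text \<open>Inversion holds for a dense class, and the transform relation has a closed
  graph.\<close>

theorem fourier_L2_inversion:
  assumes fg: "is_fourier_L2 f g" and f: "f \<in> Lp 2"
  shows "is_fourier_L2 g (\<lambda>x. f (- x))"
proof -
  obtain u where u: "\<And>n::nat. continuous_on UNIV (u n)" "\<And>n. \<exists>B. \<forall>x. cmod (u n x) \<le> B"
    "\<And>n. \<exists>a. \<forall>x. a < \<bar>x\<bar> \<longrightarrow> u n x = 0" and ul: "(\<lambda>n. L2_normsq (\<lambda>x. u n x - f x)) \<longlonglongrightarrow> 0"
    using L2_normsq_dense_continuous[OF f] by blast
  have uL: "u n \<in> Lp 1 \<inter> Lp 2" for n
  proof -
    obtain B a where "\<forall>x. cmod (u n x) \<le> B" "\<forall>x. a < \<bar>x\<bar> \<longrightarrow> u n x = 0" using u(2,3) by metis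
    then show ?thesis by (intro bounded_support_Lp[of _ B a] borel_imp_lebesgue[OF borel_measurable_continuous_onI[OF u(1)]]) auto
  qed
  have inv: "is_fourier_L2 (fourier_L1 (u n)) (\<lambda>x. u n (- x))" for n
  proof -
    obtain B a where "\<forall>x. cmod (u n x) \<le> B" "\<forall>x. a < \<bar>x\<bar> \<longrightarrow> u n x = 0" using u(2,3) by metis
    then show ?thesis by (intro fourier_L1_inversion[OF u(1), of n B a]) auto
  qed
  have "(\<lambda>n. L2_normsq (\<lambda>x. fourier_L1 (u n) x - g x)) \<longlonglongrightarrow> 0"
  proof (rule tendsto_sandwich[OF _ _ tendsto_const ul])
    show "\<forall>\<^sub>F n in sequentially. L2_normsq (\<lambda>x. fourier_L1 (u n) x - g x) \<le> L2_normsq (\<lambda>x. u n x - f x)"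
      using uL by (intro always_eventually allI is_fourier_L2_le is_fourier_L2_diff is_fourier_L2_L1 Lp_2_diff fg f) auto
  qed auto
  moreover have "(\<lambda>n. L2_normsq (\<lambda>x. u n (- x) - f (- x))) \<longlonglongrightarrow> 0"
  proof -
    have "L2_normsq (\<lambda>x. u n (- x) - f (- x)) = L2_normsq (\<lambda>x. u n x - f x)" for n
      using uL[of n] f by (intro L2_normsq_reflect[of "\<lambda>x. u n x - f x"] borel_measurable_diff) (auto intro: Lp_measurable)
    then show ?thesis using ul by simp
  qed
  ultimately show ?thesis
    using uL f by (intro is_fourier_L2_closed[OF inv]) (auto intro: fourier_L1_Lp_2 Lp_2_reflect is_fourier_L2_Lp[OF fg])
qed

text \<open>Since two transforms reflect, the reflected transform of \<open>g\<close> is a preimage.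
  This allows the extremal function to be prescribed on the frequency side.\<close>

lemma ex_inverse_fourier_L2:
  assumes g: "g \<in> Lp 2"
  shows "\<exists>f \<in> Lp 2. is_fourier_L2 f g"
proof -
  obtain G where G: "is_fourier_L2 g G" using ex_fourier_L2[OF g] by blast
  note GL = is_fourier_L2_Lp[OF G]
  have "is_fourier_L2 (\<lambda>x. G (- x)) (\<lambda>x. g (- (- x)))"
    using fourier_L2_inversion[OF G g] GL by (rule is_fourier_L2_reflect)
  then show ?thesis using Lp_2_reflect[OF GL] by auto
qed

text \<open>The missing inequality is the contraction applied to the inverted pair.\<close>

lemma is_fourier_L2_isometry:
  assumes fg: "is_fourier_L2 f g" and f: "f \<in> Lp 2"
  shows "L2_normsq g = L2_normsq f"
proof (rule antisym)
  show "L2_normsq g \<le> L2_normsq f" by (rule is_fourier_L2_le[OF assms])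
  have "L2_normsq f = L2_normsq (\<lambda>x. f (- x))" by (simp add: L2_normsq_reflect Lp_measurable[OF f])
  also have "\<dots> \<le> L2_normsq g" by (rule is_fourier_L2_le[OF fourier_L2_inversion[OF fg f] is_fourier_L2_Lp[OF fg]])
  finally show "L2_normsq f \<le> L2_normsq g" .
qed

section \<open>Polarization and Parseval's identity\<close>

lemma L2_normsq_eq_integral:
  assumes "f \<in> Lp 2"
  shows "integrable lebesgue (\<lambda>x. (cmod (f x))\<^sup>2)" "L2_normsq f = ennreal (LINT x|lebesgue. (cmod (f x))\<^sup>2)"
proof -
  show *: "integrable lebesgue (\<lambda>x. (cmod (f x))\<^sup>2)"
    using assms by (intro integrableI_bounded) (auto simp: Lp_2_iff L2_normsq_def)
  show "L2_normsq f = ennreal (LINT x|lebesgue. (cmod (f x))\<^sup>2)"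
    unfolding L2_normsq_def using * by (intro nn_integral_eq_integral) auto
qed

lemma measurable_cnj [measurable]: "cnj \<in> borel_measurable borel"
  by (intro borel_measurable_continuous_onI continuous_intros)

lemma integrable_L2_inner:
  assumes f: "f \<in> Lp 2" and g: "g \<in> Lp 2"
  shows "integrable lebesgue (\<lambda>x. f x * cnj (g x))"
proof (rule Bochner_Integration.integrable_bound)
  show "integrable lebesgue (\<lambda>x. (cmod (f x))\<^sup>2 + (cmod (g x))\<^sup>2)"
    using L2_normsq_eq_integral(1)[OF f] L2_normsq_eq_integral(1)[OF g] by simp
  show "(\<lambda>x. f x * cnj (g x)) \<in> borel_measurable lebesgue"
    using Lp_measurable[OF f] Lp_measurable[OF g] by measurable
  have "cmod (f x) * cmod (g x) \<le> (cmod (f x))\<^sup>2 + (cmod (g x))\<^sup>2" for x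
    using sum_squares_bound[of "cmod (f x)" "cmod (g x)"] zero_le_power2[of "cmod (f x)"] zero_le_power2[of "cmod (g x)"]
      mult_nonneg_nonneg[OF norm_ge_zero norm_ge_zero, of "f x" "g x"] by linarith
  then show "AE x in lebesgue. norm (f x * cnj (g x)) \<le> norm ((cmod (f x))\<^sup>2 + (cmod (g x))\<^sup>2)"
    by (intro AE_I2) (simp add: norm_mult)
qed

lemma L2_normsq_polarization:
  assumes f: "f \<in> Lp 2" and g: "g \<in> Lp 2"
  shows "(LINT x|lebesgue. (cmod (f x + c * g x))\<^sup>2) =
      (LINT x|lebesgue. (cmod (f x))\<^sup>2) + (cmod c)\<^sup>2 * (LINT x|lebesgue. (cmod (g x))\<^sup>2) + 2 * Re (cnj c * L2_inner f g)"
proof -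
  have *: "(cmod (a + c * b))\<^sup>2 = (cmod a)\<^sup>2 + (cmod c)\<^sup>2 * (cmod b)\<^sup>2 + 2 * Re (cnj c * (a * cnj b))" for a b
    unfolding cmod_power2 by (simp add: power2_eq_square algebra_simps)
  have i: "integrable lebesgue (\<lambda>x. cnj c * (f x * cnj (g x)))" using integrable_L2_inner[OF f g] by simp
  have "(LINT x|lebesgue. (cmod (f x + c * g x))\<^sup>2) =
      (LINT x|lebesgue. ((cmod (f x))\<^sup>2 + (cmod c)\<^sup>2 * (cmod (g x))\<^sup>2) + 2 * Re (cnj c * (f x * cnj (g x))))"
    by (simp only: *)
  also have "\<dots> = (LINT x|lebesgue. (cmod (f x))\<^sup>2 + (cmod c)\<^sup>2 * (cmod (g x))\<^sup>2) + (LINT x|lebesgue. 2 * Re (cnj c * (f x * cnj (g x))))"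
    using L2_normsq_eq_integral(1)[OF f] L2_normsq_eq_integral(1)[OF g] integrable_L2_inner[OF f g] by (intro Bochner_Integration.integral_add integrable_mult_right integrable_Re) auto
  also have "(LINT x|lebesgue. (cmod (f x))\<^sup>2 + (cmod c)\<^sup>2 * (cmod (g x))\<^sup>2) = (LINT x|lebesgue. (cmod (f x))\<^sup>2) + (cmod c)\<^sup>2 * (LINT x|lebesgue. (cmod (g x))\<^sup>2)"
    using L2_normsq_eq_integral(1)[OF f] L2_normsq_eq_integral(1)[OF g] by simp
  also have "(LINT x|lebesgue. 2 * Re (cnj c * (f x * cnj (g x)))) = 2 * (LINT x|lebesgue. Re (cnj c * (f x * cnj (g x))))"
    by (rule integral_mult_right_zero)
  also have "(LINT x|lebesgue. Re (cnj c * (f x * cnj (g x)))) = Re (LINT x|lebesgue. cnj c * (f x * cnj (g x)))"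
    by (rule integral_Re[OF i])
  also have "(LINT x|lebesgue. cnj c * (f x * cnj (g x))) = cnj c * L2_inner f g"
    unfolding L2_inner_def by (rule integral_mult_right_zero)
  finally show ?thesis .
qed

theorem Parseval_L2:
  assumes f: "f \<in> Lp 2" and f': "f' \<in> Lp 2" and g: "is_fourier_L2 f g" and g': "is_fourier_L2 f' g'"
  shows "L2_inner f f' = L2_inner g g'"
proof -
  note gL = is_fourier_L2_Lp[OF g] and gL' = is_fourier_L2_Lp[OF g']
  have iso: "(LINT x|lebesgue. (cmod (u x))\<^sup>2) = (LINT x|lebesgue. (cmod (v x))\<^sup>2)" if "u \<in> Lp 2" "is_fourier_L2 u v" for u v
  proof -
    have "ennreal (LINT x|lebesgue. (cmod (u x))\<^sup>2) = ennreal (LINT x|lebesgue. (cmod (v x))\<^sup>2)"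
      using is_fourier_L2_isometry[OF that(2,1)] L2_normsq_eq_integral(2)[OF that(1)] L2_normsq_eq_integral(2)[OF is_fourier_L2_Lp[OF that(2)]] by simp
    then show ?thesis by (subst (asm) ennreal_inj) auto
  qed
  \<comment> \<open>Polarization: the isometry for \<open>f + c * f'\<close> compares the cross
    terms; \<open>c = 1\<close> and \<open>c = \<i>\<close> recover the real and imaginary
    parts.\<close>
  have "Re (cnj c * L2_inner f f') = Re (cnj c * L2_inner g g')" for c
    using iso[OF Lp_2_add_scale[OF f f'] is_fourier_L2_add_scale[OF g g' f f'], of c] iso[OF f g] iso[OF f' g']
    unfolding L2_normsq_polarization[OF f f'] L2_normsq_polarization[OF gL gL'] by simp
  from this[of 1] this[of \<i>] show ?thesis by (simp add: complex_eq_iff)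
qed

subsection \<open>Filters and scaling functions\<close>

text \<open>The squared modulus of a filter of order \<open>n + 1\<close>, as a polynomial in
  \<open>y\<close>, the squared sine of half the angle.\<close>

definition daubechies_mask :: "nat \<Rightarrow> real \<Rightarrow> real" where
  "daubechies_mask n y = (1 - y) ^ Suc n * daubechies_poly n y"

text \<open>A partial sum identity for binomial coefficients, specialized to the weights
  \<open>y\<close> and \<open>1 - y\<close>, whose sum 1 makes one of the powers disappear.\<close>

lemma daubechies_poly_eq:
  "daubechies_poly n y = (\<Sum>k\<le>n. real (2 * n + 1 choose k) * y ^ k * (1 - y) ^ (n - k))"
proof -
  have "(\<Sum>k\<le>n. real (2 * n + 1 choose k) * y ^ k * (1 - y) ^ (n - k)) =
      (\<Sum>k\<le>n. (of_nat n + (of_nat n + 1) gchoose k) * y ^ k * (1 - y) ^ (n - k))"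
    by (intro sum.cong refl) (simp add: binomial_gbinomial algebra_simps)
  also have "\<dots> = (\<Sum>k\<le>n. (of_nat k + (of_nat n + 1) - 1 gchoose k) * y ^ k * (y + (1 - y)) ^ (n - k))"
    by (rule gbinomial_partial_sum_poly_xpos)
  also have "\<dots> = daubechies_poly n y"
    unfolding daubechies_poly_def atMost_atLeast0
    by (intro sum.cong refl) (simp add: binomial_gbinomial add.commute)
  finally show ?thesis ..
qed

text \<open>For \<open>y\<close> in the unit interval, this is the probability of at most
  \<open>n\<close> successes in \<open>2 * n + 1\<close> trials with success probability
  \<open>y\<close>. The number of trials is odd, so no tie can occur.\<close>

lemma daubechies_mask_eq: "daubechies_mask n y = (\<Sum>k\<le>n. real (2 * n + 1 choose k) * y ^ k * (1 - y) ^ (2 * n + 1 - k))"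
  unfolding daubechies_mask_def daubechies_poly_eq sum_distrib_left
proof (intro sum.cong refl)
  fix k assume "k \<in> {..n}"
  then have "2 * n + 1 - k = Suc n + (n - k)" by auto
  then show "(1 - y) ^ Suc n * (real (2 * n + 1 choose k) * y ^ k * (1 - y) ^ (n - k)) =
      real (2 * n + 1 choose k) * y ^ k * (1 - y) ^ (2 * n + 1 - k)"
    by (simp only: power_add mult_ac)
qed

text \<open>Exchanging success and failure reflects \<open>k\<close> to
  \<open>2 * n + 1 - k\<close>, so the two masks are the two halves of the binomial expansion of
  1.\<close>

lemma daubechies_mask_complement: "daubechies_mask n y + daubechies_mask n (1 - y) = 1"
proof -
  let ?t = "\<lambda>k. real (2 * n + 1 choose k) * y ^ k * (1 - y) ^ (2 * n + 1 - k)"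
  have "daubechies_mask n (1 - y) = (\<Sum>k\<le>n. real (2 * n + 1 choose k) * (1 - y) ^ k * y ^ (2 * n + 1 - k))"
    by (simp add: daubechies_mask_eq)
  also have "\<dots> = (\<Sum>k\<in>{n + 1..2 * n + 1}. ?t k)"
  proof (rule sum.reindex_bij_witness[of _ "\<lambda>k. 2 * n + 1 - k" "\<lambda>k. 2 * n + 1 - k"])
    fix k assume "k \<in> {..n}"
    then have k: "k \<le> 2 * n + 1" by simp
    have "(2 * n + 1 choose (2 * n + 1 - k)) = (2 * n + 1 choose k)" using binomial_symmetric[OF k] by simp
    then show "?t (2 * n + 1 - k) = real (2 * n + 1 choose k) * (1 - y) ^ k * y ^ (2 * n + 1 - k)"
      using k by (simp add: mult_ac)
  qed auto
  finally have "daubechies_mask n y + daubechies_mask n (1 - y) = (\<Sum>k\<le>n. ?t k) + (\<Sum>k\<in>{n + 1..2 * n + 1}. ?t k)"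
    by (simp only: daubechies_mask_eq)
  also have "\<dots> = (\<Sum>k\<in>{..n} \<union> {n + 1..2 * n + 1}. ?t k)"
    by (rule sum.union_disjoint[symmetric]) auto
  also have "{..n} \<union> {n + 1..2 * n + 1} = {..2 * n + 1}" by auto
  also have "(\<Sum>k\<le>2 * n + 1. ?t k) = (y + (1 - y)) ^ (2 * n + 1)" by (rule binomial_ring[symmetric])
  finally show ?thesis by simp
qed

lemma daubechies_mask_nonneg: "0 \<le> y \<Longrightarrow> y \<le> 1 \<Longrightarrow> 0 \<le> daubechies_mask n y"
  unfolding daubechies_mask_eq by (intro sum_nonneg mult_nonneg_nonneg) auto

lemma daubechies_mask_le_1: "0 \<le> y \<Longrightarrow> y \<le> 1 \<Longrightarrow> daubechies_mask n y \<le> 1"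
  using daubechies_mask_complement[of n y] daubechies_mask_nonneg[of "1 - y" n] by simp

text \<open>At the fixed point of \<open>y \<mapsto> 1 - y\<close> the complement identity makes the
  mask equal to \<open>1 / 2\<close>.\<close>

lemma daubechies_poly_half: "daubechies_poly n (1 / 2) = 2 ^ n"
proof -
  have "1 - 1 / 2 = (1 / 2 :: real)" by simp
  then have "(1 / 2) ^ Suc n * daubechies_poly n (1 / 2) + (1 / 2) ^ Suc n * daubechies_poly n (1 / 2) = 1"
    using daubechies_mask_complement[of n "1 / 2"] unfolding daubechies_mask_def by (simp only:)
  then have "(1 / 2) ^ n * daubechies_poly n (1 / 2) = 1" by (simp add: mult_ac)
  then show ?thesis by (simp add: power_one_over)
qed

text \<open>Termwise comparison with \<open>y = 1 / 2\<close>: since \<open>2 * y >= 1\<close>, each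
  \<open>y ^ j\<close> is at most \<open>(2 * y) ^ n * (1 / 2) ^ j\<close>, and the remaining sum is
  known. The base \<open>4 * y * (1 - y)\<close> is below 1 away from \<open>1 / 2\<close>, which
  gives geometric decay.\<close>

lemma daubechies_mask_le:
  assumes "1 / 2 \<le> y" "y \<le> 1"
  shows "daubechies_mask n y \<le> (1 - y) * (4 * y * (1 - y)) ^ n"
proof -
  have "daubechies_poly n y \<le> (\<Sum>j=0..n. (2 * y) ^ n * (real (n + j choose j) * (1 / 2) ^ j))"
    unfolding daubechies_poly_def
  proof (intro sum_mono)
    fix j assume j: "j \<in> {0..n}"
    have "y ^ j = (2 * y) ^ j * (1 / 2) ^ j" unfolding power_mult_distrib[symmetric] by simp
    also have "\<dots> \<le> (2 * y) ^ n * (1 / 2) ^ j"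
      using assms j by (intro mult_right_mono power_increasing) auto
    finally have "real (n + j choose j) * y ^ j \<le> real (n + j choose j) * ((2 * y) ^ n * (1 / 2) ^ j)"
      by (rule mult_left_mono) simp
    then show "real (n + j choose j) * y ^ j \<le> (2 * y) ^ n * (real (n + j choose j) * (1 / 2) ^ j)"
      by (simp only: mult_ac)
  qed
  also have "\<dots> = (2 * y) ^ n * 2 ^ n"
    unfolding sum_distrib_left[symmetric] daubechies_poly_half[symmetric] daubechies_poly_def ..
  finally have "daubechies_mask n y \<le> (1 - y) ^ Suc n * ((2 * y) ^ n * 2 ^ n)"
    unfolding daubechies_mask_def using assms by (intro mult_left_mono) auto
  also have "\<dots> = (1 - y) * ((1 - y) ^ n * (2 * y) ^ n * 2 ^ n)" by simp
  also have "(1 - y) ^ n * (2 * y) ^ n * 2 ^ n = (4 * y * (1 - y)) ^ n"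
    unfolding power_mult_distrib[symmetric] by (simp add: mult_ac)
  finally show ?thesis .
qed

lemma daubechies_mask_ge:
  assumes "0 \<le> y" "y \<le> 1 / 2"
  shows "1 - daubechies_mask n y \<le> y * (4 * y * (1 - y)) ^ n"
  using daubechies_mask_le[of "1 - y" n] daubechies_mask_complement[of n y] assms by (simp add: mult_ac)

lemma four_mult_le_1: "4 * y * (1 - y) \<le> (1::real)"
  using zero_le_power2[of "2 * y - 1"] by (simp add: power2_eq_square algebra_simps)

text \<open>The function \<open>1 / y - 2 / 3\<close> drops by a factor 4 along the doubling map
  \<open>y \<mapsto> 4 y (1 - y)\<close> weighted by the mask; this yields decay of the scaling function
  uniformly in the order of the filter.\<close>

lemma daubechies_mask_lyapunov:
  assumes n: "5 \<le> n" and y: "0 < y" "y < 1"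
  shows "4 * daubechies_mask n y * (1 / (4 * y * (1 - y)) - 2 / 3) \<le> 1 / y - 2 / 3"
proof -
  define z where "z = 4 * y * (1 - y)"
  have z: "0 < z" "z \<le> 1" using y four_mult_le_1[of y] by (auto simp: z_def)
  have pos: "0 \<le> 1 / z - 2 / 3" using z by (simp add: field_simps)
  show ?thesis
  \<comment> \<open>In the lower half the mask is only bounded by 1. With a general constant
    \<open>c\<close> in place of \<open>2 / 3\<close>, the left side is then at most
    \<open>1 / y + 2 - 4 * c\<close>, and \<open>2 / 3\<close> is the least \<open>c\<close> for
    which this is at most \<open>1 / y - c\<close>.\<close>
  proof (cases "y \<le> 1 / 2")
    case True
    have "4 * daubechies_mask n y * (1 / z - 2 / 3) \<le> 4 * 1 * (1 / z - 2 / 3)"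
      using pos daubechies_mask_le_1[of y n] y by (intro mult_right_mono) auto
    also have "\<dots> = 1 / y + 1 / (1 - y) - 8 / 3" using y by (simp add: z_def field_simps)
    also have "1 / (1 - y) \<le> 2" using True y by (simp add: field_simps)
    finally show ?thesis by (simp add: z_def)
  next
    case False
    have "4 * daubechies_mask n y * (1 / z - 2 / 3) \<le> 4 * ((1 - y) * z ^ n) * (1 / z - 2 / 3)"
      using pos daubechies_mask_le[of y n] y False by (intro mult_right_mono) (auto simp: z_def)
    also have "\<dots> = z ^ n * (1 / y - 8 * (1 - y) / 3)"
      using y by (simp add: z_def divide_simps)
    also have "\<dots> \<le> 1 / y - 2 / 3"
    \<comment> \<open>Up to \<open>3 / 4\<close> the subtracted term \<open>8 * (1 - y) / 3\<close>
      is at least \<open>2 / 3\<close>, and \<open>z ^ n <= 1\<close> is enough. Beyond that point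
      the smallness of \<open>z ^ n\<close> must help.\<close>
    proof (cases "y \<le> 3 / 4")
      case True
      have "z ^ n * (1 / y - 8 * (1 - y) / 3) \<le> z ^ n * (1 / y - 2 / 3)"
        using True z by (intro mult_left_mono) auto
      also have "\<dots> \<le> 1 * (1 / y - 2 / 3)"
        using z y by (intro mult_right_mono power_le_one) (auto simp: pos_le_divide_eq)
      finally show ?thesis by simp
    next
      case False
      have "y * (1 - y) = 3 / 16 - (y - 3 / 4) * (y - 1 / 4)" by algebra
      also have "\<dots> \<le> 3 / 16" using False by simp
      finally have z34: "z \<le> 3 / 4" by (simp add: z_def)
      \<comment> \<open>Origin of the hypothesis \<open>5 <= n\<close>: 5 is the least exponent for
        which \<open>(3 / 4) ^ n\<close> does not exceed \<open>1 / 4\<close>.\<close>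
      have "z ^ n \<le> z ^ 5" using z n by (intro power_decreasing) auto
      also have "\<dots> \<le> (3 / 4) ^ 5" using z34 z by (intro power_mono) auto
      also have "\<dots> \<le> 1 / 4" by (simp add: power_divide)
      finally have zn: "z ^ n \<le> 1 / 4" .
      have "z ^ n * (1 / y - 8 * (1 - y) / 3) \<le> z ^ n * (4 / 3)"
      proof (intro mult_left_mono)
        have "1 / y \<le> 4 / 3" using False y by (simp add: field_simps)
        moreover have "0 \<le> 8 * (1 - y) / 3" using y by simp
        ultimately show "1 / y - 8 * (1 - y) / 3 \<le> 4 / 3" by linarith
      qed (use z in auto)
      also have "\<dots> \<le> 1 / 3" using zn by simp
      also have "\<dots> \<le> 1 / y - 2 / 3" using y by (simp add: field_simps)
      finally show ?thesis .
    qed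
    finally show ?thesis by (simp add: z_def)
  qed
qed

section \<open>The mask as a function of the angle\<close>

definition mask_angle :: "nat \<Rightarrow> real \<Rightarrow> real" where
  "mask_angle n x = daubechies_mask n ((sin (x / 2))\<^sup>2)"

lemma sin_sq_bounds: "0 \<le> (sin (x::real))\<^sup>2" "(sin x)\<^sup>2 \<le> 1"
  by (simp_all add: abs_square_le_1)

lemma mask_angle_bounds: "0 \<le> mask_angle n x" "mask_angle n x \<le> 1"
  unfolding mask_angle_def by (intro daubechies_mask_nonneg daubechies_mask_le_1 sin_sq_bounds)+

text \<open>Doubling the angle acts on the squared sine of its half as the logistic map
  \<open>y \<mapsto> 4 y (1 - y)\<close>, so products over dyadic scales run along an orbit of that
  map.\<close>

lemma sin_sq_double: "4 * (sin (x / 2))\<^sup>2 * (1 - (sin (x / 2))\<^sup>2) = (sin (x::real))\<^sup>2"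
proof -
  have "sin x = 2 * sin (x / 2) * cos (x / 2)" using sin_double[of "x / 2"] by simp
  then show ?thesis by (simp add: power_mult_distrib cos_squared_eq)
qed

text \<open>A shift by \<open>pi\<close> exchanges \<open>y\<close> and \<open>1 - y\<close>: the
  quadrature mirror condition, which makes the shifted filter a high-pass filter.\<close>

lemma mask_angle_pi: "mask_angle n (x + pi) = 1 - mask_angle n x"
proof -
  have "(sin ((x + pi) / 2))\<^sup>2 = (cos (x / 2))\<^sup>2" by (simp add: add_divide_distrib sin_add)
  then show ?thesis using daubechies_mask_complement[of n "(sin (x / 2))\<^sup>2"] by (simp add: mask_angle_def cos_squared_eq)
qed

lemma sin_half_sq_ge_half:
  assumes "pi / 2 \<le> \<bar>x\<bar>" "\<bar>x\<bar> \<le> pi"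
  shows "1 / 2 \<le> (sin (x / 2))\<^sup>2"
proof -
  have "cos \<bar>x\<bar> \<le> cos (pi / 2)" using assms by (intro cos_monotone_0_pi_le) auto
  then have "cos x \<le> 0" by simp
  then show ?thesis using cos_double_sin[of "x / 2"] by simp
qed

lemma sin_half_sq_le_half:
  assumes "\<bar>x\<bar> \<le> pi / 2"
  shows "(sin (x / 2))\<^sup>2 \<le> 1 / 2"
proof -
  have "0 \<le> cos x" using assms by (intro cos_ge_zero) auto
  then show ?thesis using cos_double_sin[of "x / 2"] by simp
qed

lemma mask_angle_le:
  assumes "pi / 2 \<le> \<bar>x\<bar>" "\<bar>x\<bar> \<le> pi"
  shows "mask_angle n x \<le> ((sin x)\<^sup>2) ^ n"
proof -
  have "mask_angle n x \<le> (1 - (sin (x / 2))\<^sup>2) * ((sin x)\<^sup>2) ^ n"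
    using daubechies_mask_le[OF sin_half_sq_ge_half[OF assms] sin_sq_bounds(2), of n]
    unfolding mask_angle_def sin_sq_double .
  also have "\<dots> \<le> 1 * ((sin x)\<^sup>2) ^ n" by (intro mult_right_mono) auto
  finally show ?thesis by simp
qed

lemma mask_angle_ge:
  assumes "\<bar>x\<bar> \<le> pi / 2"
  shows "1 - mask_angle n x \<le> (sin (x / 2))\<^sup>2 * ((sin x)\<^sup>2) ^ n"
  using daubechies_mask_ge[OF sin_sq_bounds(1) sin_half_sq_le_half[OF assms], of n]
  unfolding mask_angle_def sin_sq_double .

text \<open>Iteration of \<open>daubechies_mask_lyapunov\<close> along the doubling orbit, each
  factor gaining 4. The constant 3 serves the empty product: \<open>1 / y - 2 / 3\<close> is at
  least \<open>1 / 3\<close>.\<close>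

lemma prod_mask_angle_le:
  assumes n: "5 \<le> n" and x: "sin (x / 2) \<noteq> 0"
  shows "(\<Prod>l<L. mask_angle n (2 ^ l * x)) \<le> 3 / 4 ^ L * (1 / (sin (x / 2))\<^sup>2 - 2 / 3)"
  using x
proof (induction L arbitrary: x)
  case 0
  have "1 \<le> 1 / (sin (x / 2))\<^sup>2" using 0 sin_sq_bounds[of "x / 2"] by (simp add: field_simps)
  then show ?case by simp
next
  case (Suc L)
  define y where "y = (sin (x / 2))\<^sup>2"
  have y: "0 < y" "y \<le> 1" using Suc.prems sin_sq_bounds[of "x / 2"] by (auto simp: y_def)
  have y1: "0 \<le> 1 / y - 2 / 3" using y by (simp add: field_simps)
  have "(\<Prod>l<Suc L. mask_angle n (2 ^ l * x)) = mask_angle n x * (\<Prod>l<L. mask_angle n (2 ^ l * (2 * x)))"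
    unfolding prod.lessThan_Suc_shift by (simp add: mult_ac)
  also have "\<dots> \<le> 3 / 4 ^ Suc L * (1 / y - 2 / 3)"
  proof (cases "y = 1")
    case True
    then have "mask_angle n x = 0" by (simp add: mask_angle_def daubechies_mask_def y_def)
    then show ?thesis using y1 by simp
  next
    case False
    have s: "(sin (2 * x / 2))\<^sup>2 = 4 * y * (1 - y)" unfolding y_def sin_sq_double by simp
    then have "sin (2 * x / 2) \<noteq> 0" using y False by auto
    from Suc.IH[OF this] have "mask_angle n x * (\<Prod>l<L. mask_angle n (2 ^ l * (2 * x))) \<le>
        mask_angle n x * (3 / 4 ^ L * (1 / (4 * y * (1 - y)) - 2 / 3))"
      unfolding s by (intro mult_left_mono mask_angle_bounds)
    also have "\<dots> = 3 / 4 ^ Suc L * (4 * daubechies_mask n y * (1 / (4 * y * (1 - y)) - 2 / 3))"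
      by (simp add: mask_angle_def y_def[symmetric])
    also have "\<dots> \<le> 3 / 4 ^ Suc L * (1 / y - 2 / 3)"
      using y False by (intro mult_left_mono daubechies_mask_lyapunov n) auto
    finally show ?thesis .
  qed
  finally show ?case by (simp add: y_def)
qed

text \<open>Weierstrass's product inequality.\<close>

lemma prod_ge_one_minus_sum:
  fixes a :: "nat \<Rightarrow> real"
  assumes "\<And>l. 0 \<le> a l" "\<And>l. a l \<le> 1"
  shows "1 - (\<Sum>l<L. a l) \<le> (\<Prod>l<L. 1 - a l)"
proof (induction L)
  case (Suc L)
  have "(\<Prod>l<L. 1 - a l) \<le> 1" using assms by (intro prod_le_1) auto
  then have "a L * (\<Prod>l<L. 1 - a l) \<le> a L * 1" using assms by (intro mult_left_mono) auto
  then show ?case using Suc by (simp add: algebra_simps)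
qed simp

section \<open>The infinite product of filters\<close>

lemma filter_symbol_norm:
  assumes "daubechies_filter (Suc n) h"
  shows "(cmod (filter_symbol (Suc n) h \<omega>))\<^sup>2 = mask_angle n \<omega>"
  using assms by (simp add: daubechies_filter_def mask_angle_def daubechies_mask_def cos_squared_eq)

text \<open>Serves only the convergence of the infinite product. The constant depends on the filter
  and enters no uniform estimate.\<close>

lemma filter_symbol_lipschitz:
  assumes "filter_symbol m h 0 = 1"
  shows "\<exists>C. \<forall>\<omega>. cmod (filter_symbol m h \<omega> - 1) \<le> C * \<bar>\<omega>\<bar>"
proof -
  have "cmod (filter_symbol m h \<omega> - 1) \<le> (\<Sum>l<2 * m. \<bar>h l\<bar> * real l) * \<bar>\<omega>\<bar>" for \<omega>
  proof -
    have "filter_symbol m h \<omega> - 1 = filter_symbol m h \<omega> - filter_symbol m h 0" using assms by simp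
    also have "\<dots> = 1 / complex_of_real (sqrt 2) * (\<Sum>l<2 * m. complex_of_real (h l) * (exp (\<i> * of_real (real l * \<omega>)) - 1))"
      unfolding filter_symbol_def by (simp add: sum_subtractf algebra_simps)
    also have "cmod \<dots> \<le> 1 * (\<Sum>l<2 * m. \<bar>h l\<bar> * (real l * \<bar>\<omega>\<bar>))"
      unfolding norm_mult
    proof (intro mult_mono order_trans[OF norm_sum] sum_mono)
      fix l
      have "cmod (exp (\<i> * of_real (real l * \<omega>)) - 1) = 2 * \<bar>sin (real l * \<omega> / 2)\<bar>" by (rule dist_exp_i_1)
      also have "\<dots> \<le> 2 * \<bar>real l * \<omega> / 2\<bar>" by (intro mult_left_mono abs_sin_x_le_abs_x) auto
      finally have "cmod (exp (\<i> * of_real (real l * \<omega>)) - 1) \<le> real l * \<bar>\<omega>\<bar>" by (simp add: abs_mult)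
      then show "cmod (complex_of_real (h l) * (exp (\<i> * of_real (real l * \<omega>)) - 1)) \<le> \<bar>h l\<bar> * (real l * \<bar>\<omega>\<bar>)"
        unfolding norm_mult norm_of_real by (intro mult_left_mono) auto
    qed (auto simp: norm_divide intro: sum_nonneg)
    finally show ?thesis by (simp add: sum_distrib_right mult.assoc)
  qed
  then show ?thesis by blast
qed

text \<open>This is \<open>2 * pi\<close> times the squared modulus of the transform of the scaling
  function, almost everywhere.\<close>

definition scaling_square :: "nat \<Rightarrow> (nat \<Rightarrow> real) \<Rightarrow> real \<Rightarrow> real" where
  "scaling_square n h \<omega> = (cmod (\<Prod>l. filter_symbol (Suc n) h (\<omega> / 2 ^ Suc l)))\<^sup>2"

text \<open>Absolute convergence of the product makes the infinite product a genuine limit; its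
  modulus depends on the filter only through \<open>mask_angle\<close>, so the phase of
  \<open>h\<close> drops out of all later bounds.\<close>

lemma scaling_square_limit:
  assumes h: "daubechies_filter (Suc n) h"
  shows "(\<lambda>L. \<Prod>l<L. mask_angle n (\<omega> / 2 ^ Suc l)) \<longlonglongrightarrow> scaling_square n h \<omega>"
proof -
  let ?f = "\<lambda>l. filter_symbol (Suc n) h (\<omega> / 2 ^ Suc l)"
  obtain C where C: "\<And>\<omega>. cmod (filter_symbol (Suc n) h \<omega> - 1) \<le> C * \<bar>\<omega>\<bar>"
    using filter_symbol_lipschitz h by (metis daubechies_filter_def)
  have "summable (\<lambda>l. cmod (?f l - 1))"
  proof (rule summable_comparison_test')
    show "summable (\<lambda>l. C * \<bar>\<omega>\<bar> / 2 * (1 / 2) ^ l)" by (intro summable_mult summable_geometric) auto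
    show "norm (cmod (?f l - 1)) \<le> C * \<bar>\<omega>\<bar> / 2 * (1 / 2) ^ l" for l
      using C[of "\<omega> / 2 ^ Suc l"] by (simp add: power_divide)
  qed
  then have "convergent_prod ?f"
    by (intro abs_convergent_prod_imp_convergent_prod) (simp add: abs_convergent_prod_conv_summable)
  from convergent_prod_LIMSEQ[OF this] have "(\<lambda>L. \<Prod>l<Suc L. ?f l) \<longlonglongrightarrow> prodinf ?f"
    by (simp only: lessThan_Suc_atMost)
  then have "(\<lambda>L. \<Prod>l<L. ?f l) \<longlonglongrightarrow> prodinf ?f" by (rule LIMSEQ_imp_Suc)
  then have "(\<lambda>L. (cmod (\<Prod>l<L. ?f l))\<^sup>2) \<longlonglongrightarrow> (cmod (prodinf ?f))\<^sup>2" by (intro tendsto_intros)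
  then show ?thesis
    by (simp only: scaling_square_def prod_norm[symmetric] prod_power_distrib filter_symbol_norm[OF h])
qed

lemma scaling_square_nonneg: "0 \<le> scaling_square n h \<omega>"
  by (simp add: scaling_square_def)

text \<open>All factors lie between 0 and 1, so the product is at most any one of them.\<close>

lemma scaling_square_le_mask:
  assumes h: "daubechies_filter (Suc n) h"
  shows "scaling_square n h \<omega> \<le> mask_angle n (\<omega> / 2 ^ Suc l)"
proof (rule LIMSEQ_le_const2[OF scaling_square_limit[OF h]], intro exI[of _ "Suc l"] allI impI)
  fix L assume L: "Suc l \<le> L"
  have "(\<Prod>j<L. mask_angle n (\<omega> / 2 ^ Suc j)) = mask_angle n (\<omega> / 2 ^ Suc l) * (\<Prod>j\<in>{..<L} - {l}. mask_angle n (\<omega> / 2 ^ Suc j))"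
    using L by (intro prod.remove) auto
  also have "\<dots> \<le> mask_angle n (\<omega> / 2 ^ Suc l) * 1"
    by (intro mult_left_mono prod_le_1 mask_angle_bounds conjI)
  finally show "(\<Prod>j<L. mask_angle n (\<omega> / 2 ^ Suc j)) \<le> mask_angle n (\<omega> / 2 ^ Suc l)" by simp
qed

lemma scaling_square_le_1:
  assumes "daubechies_filter (Suc n) h"
  shows "scaling_square n h \<omega> \<le> 1"
  using scaling_square_le_mask[OF assms, of \<omega> 0] mask_angle_bounds(2) by (rule order_trans)

text \<open>Read from the finest scale upwards, the partial product runs along the doubling orbit of
  \<open>\<omega> / 2 ^ L\<close>, where \<open>prod_mask_angle_le\<close> applies. As
  \<open>L\<close> grows, \<open>2 ^ Suc L * sin (\<omega> / 2 ^ Suc L)\<close> tends to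
  \<open>\<omega>\<close>; the constant is \<open>12 = 3 * 4\<close> because the sine is taken one
  scale further down.\<close>

lemma scaling_square_decay:
  assumes h: "daubechies_filter (Suc n) h" and n: "5 \<le> n" and w: "\<omega> \<noteq> 0"
  shows "scaling_square n h \<omega> \<le> 12 / \<omega>\<^sup>2"
proof -
  have lim: "(\<lambda>L. 2 ^ Suc L * sin (\<omega> / 2 ^ Suc L)) \<longlonglongrightarrow> \<omega>"
  proof -
    have "((\<lambda>t. sin t / t) \<longlongrightarrow> cos 0) (at (0::real))"
      using DERIV_sin[of "0::real"] by (simp add: DERIV_def)
    moreover have "filterlim (\<lambda>L. \<omega> / 2 ^ Suc L) (at 0) sequentially"
    proof (rule filterlim_atI)
      have "(\<lambda>L. \<omega> * (1 / 2) ^ Suc L) \<longlonglongrightarrow> \<omega> * 0"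
        by (intro tendsto_mult tendsto_const LIMSEQ_Suc LIMSEQ_realpow_zero) auto
      then show "(\<lambda>L. \<omega> / 2 ^ Suc L) \<longlonglongrightarrow> 0" by (simp add: power_divide)
    qed (use w in auto)
    ultimately have "(\<lambda>L. sin (\<omega> / 2 ^ Suc L) / (\<omega> / 2 ^ Suc L)) \<longlonglongrightarrow> cos 0" by (rule filterlim_compose)
    then have "(\<lambda>L. \<omega> * (sin (\<omega> / 2 ^ Suc L) / (\<omega> / 2 ^ Suc L))) \<longlonglongrightarrow> \<omega> * cos 0" by (rule tendsto_mult_left)
    then show ?thesis using w by (simp add: mult.commute)
  qed
  then have lim2: "(\<lambda>L. 12 / (2 ^ Suc L * sin (\<omega> / 2 ^ Suc L))\<^sup>2) \<longlonglongrightarrow> 12 / \<omega>\<^sup>2"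
    using w by (intro tendsto_intros) auto
  have "\<forall>\<^sub>F L in sequentially. 2 ^ Suc L * sin (\<omega> / 2 ^ Suc L) \<noteq> 0"
    using lim w by (rule tendsto_imp_eventually_ne)
  then have "\<forall>\<^sub>F L in sequentially. (\<Prod>l<L. mask_angle n (\<omega> / 2 ^ Suc l)) \<le> 12 / (2 ^ Suc L * sin (\<omega> / 2 ^ Suc L))\<^sup>2"
  proof eventually_elim
    case (elim L)
    then have ne: "sin (\<omega> / 2 ^ L / 2) \<noteq> 0" by (simp add: mult.commute)
    have "(\<Prod>l<L. mask_angle n (\<omega> / 2 ^ Suc l)) = (\<Prod>l<L. mask_angle n (\<omega> / 2 ^ Suc (L - Suc l)))"
      by (rule prod.nat_diff_reindex[symmetric])
    also have "\<dots> = (\<Prod>l<L. mask_angle n (2 ^ l * (\<omega> / 2 ^ L)))"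
    proof (intro prod.cong refl)
      fix l assume "l \<in> {..<L}"
      then have "L = l + Suc (L - Suc l)" by auto
      then have "(2::real) ^ L = 2 ^ l * 2 ^ Suc (L - Suc l)" by (metis power_add)
      then have "\<omega> / 2 ^ Suc (L - Suc l) = 2 ^ l * (\<omega> / 2 ^ L)" by simp
      then show "mask_angle n (\<omega> / 2 ^ Suc (L - Suc l)) = mask_angle n (2 ^ l * (\<omega> / 2 ^ L))" by simp
    qed
    also have "\<dots> \<le> 3 / 4 ^ L * (1 / (sin (\<omega> / 2 ^ L / 2))\<^sup>2 - 2 / 3)"
      by (rule prod_mask_angle_le[OF n ne])
    also have "\<dots> \<le> 3 / 4 ^ L * (1 / (sin (\<omega> / 2 ^ L / 2))\<^sup>2)" by (intro mult_left_mono) auto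
    also have "\<dots> = 12 / (2 ^ Suc L * sin (\<omega> / 2 ^ Suc L))\<^sup>2"
    proof -
      have "(2 ^ Suc L)\<^sup>2 = (2\<^sup>2 :: real) ^ Suc L" by (simp only: power_mult[symmetric] mult.commute)
      then have "(2 ^ Suc L)\<^sup>2 = (4 * 4 ^ L :: real)" by simp
      then show ?thesis using ne by (simp add: power_mult_distrib mult.commute)
    qed
    finally show ?case .
  qed
  then show ?thesis by (rule tendsto_le[OF _ lim2 scaling_square_limit[OF h], rotated]) simp
qed

text \<open>In the defect of each factor, the squared half-angle sine decays with the scale and sums
  to at most \<open>\<omega>^2\<close>, while the \<open>n\<close>-th power is bounded by its value
  at the coarsest scale. Weierstrass's inequality combines the defects.\<close>

lemma scaling_square_ge:
  assumes h: "daubechies_filter (Suc n) h" and w: "\<bar>\<omega>\<bar> \<le> pi"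
  shows "1 - \<omega>\<^sup>2 * ((sin (\<omega> / 2))\<^sup>2) ^ n \<le> scaling_square n h \<omega>"
proof (rule LIMSEQ_le_const[OF scaling_square_limit[OF h]], intro exI[of _ 0] allI impI)
  fix L
  let ?s = "((sin (\<omega> / 2))\<^sup>2) ^ n"
  have le: "1 - mask_angle n (\<omega> / 2 ^ Suc l) \<le> \<omega>\<^sup>2 * ?s * (1 / 2) ^ Suc l" for l
  proof -
    have p: "(1::real) \<le> 2 ^ l" by simp
    \<comment> \<open>All scaled angles stay within \<open>pi / 2\<close> of 0, where
      \<open>mask_angle_ge\<close> applies and the sine is monotone.\<close>
    have x: "\<bar>\<omega> / 2 ^ Suc l\<bar> \<le> \<bar>\<omega> / 2\<bar>" using p by (simp add: field_simps mult_le_cancel_left1)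
    have "1 - mask_angle n (\<omega> / 2 ^ Suc l) \<le> (sin (\<omega> / 2 ^ Suc l / 2))\<^sup>2 * ((sin (\<omega> / 2 ^ Suc l))\<^sup>2) ^ n"
      using x w by (intro mask_angle_ge) auto
    also have "\<dots> \<le> (\<omega>\<^sup>2 * (1 / 2) ^ Suc l) * ?s"
    proof (intro mult_mono)
      have "(sin (\<omega> / 2 ^ Suc l / 2))\<^sup>2 \<le> (\<omega> / 2 ^ Suc l / 2)\<^sup>2"
        using abs_sin_x_le_abs_x[of "\<omega> / 2 ^ Suc l / 2"] by (simp only: abs_le_square_iff)
      also have "\<dots> = \<omega>\<^sup>2 * ((1 / 2) ^ Suc l * ((1 / 2) ^ Suc l * (1 / 4)))"
        by (simp add: power2_eq_square power_divide)
      also have "\<dots> \<le> \<omega>\<^sup>2 * ((1 / 2) ^ Suc l * (1 * 1))"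
        by (intro mult_left_mono mult_mono power_le_one) auto
      finally show "(sin (\<omega> / 2 ^ Suc l / 2))\<^sup>2 \<le> \<omega>\<^sup>2 * (1 / 2) ^ Suc l" by simp
      have x2: "\<bar>\<omega> / 2\<bar> \<le> pi / 2" using w by simp
      have "- (pi / 2) \<le> \<bar>\<omega> / 2 ^ Suc l\<bar>" by (rule order_trans[of _ 0]) (simp_all only: abs_ge_zero, simp)
      then have "sin \<bar>\<omega> / 2 ^ Suc l\<bar> \<le> sin \<bar>\<omega> / 2\<bar>" using x x2 by (rule sin_monotone_2pi_le)
      moreover have "0 \<le> sin \<bar>\<omega> / 2 ^ Suc l\<bar>"
        using order_trans[OF x x2] pi_gt_zero by (intro sin_ge_zero abs_ge_zero) linarith
      ultimately have "(sin \<bar>\<omega> / 2 ^ Suc l\<bar>)\<^sup>2 \<le> (sin \<bar>\<omega> / 2\<bar>)\<^sup>2" by (intro power_mono)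
      moreover have "(sin \<bar>t\<bar>)\<^sup>2 = (sin t)\<^sup>2" for t :: real by (simp add: abs_if)
      ultimately have "(sin (\<omega> / 2 ^ Suc l))\<^sup>2 \<le> (sin (\<omega> / 2))\<^sup>2" by (simp only:)
      then show "((sin (\<omega> / 2 ^ Suc l))\<^sup>2) ^ n \<le> ?s" by (rule power_mono) simp
    qed auto
    finally show ?thesis by (simp add: mult_ac)
  qed
  have "(\<Sum>l<L. 1 - mask_angle n (\<omega> / 2 ^ Suc l)) \<le> (\<Sum>l<L. \<omega>\<^sup>2 * ?s * (1 / 2) ^ Suc l)"
    by (intro sum_mono le)
  also have "\<dots> = \<omega>\<^sup>2 * ?s * (\<Sum>l<L. (1 / 2) ^ Suc l)" by (rule sum_distrib_left[symmetric])
  also have "\<dots> \<le> \<omega>\<^sup>2 * ?s * 1"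
  proof (intro mult_left_mono)
    have "(\<Sum>l<L. (1 / 2) ^ Suc l) = 1 - (1 / 2 :: real) ^ L" by (induction L) auto
    then show "(\<Sum>l<L. (1 / 2 :: real) ^ Suc l) \<le> 1" by simp
  qed auto
  finally have "1 - \<omega>\<^sup>2 * ?s \<le> 1 - (\<Sum>l<L. 1 - mask_angle n (\<omega> / 2 ^ Suc l))" by simp
  also have "\<dots> \<le> (\<Prod>l<L. 1 - (1 - mask_angle n (\<omega> / 2 ^ Suc l)))"
    using mask_angle_bounds by (intro prod_ge_one_minus_sum) auto
  finally show "1 - \<omega>\<^sup>2 * ?s \<le> (\<Prod>l<L. mask_angle n (\<omega> / 2 ^ Suc l))" by simp
qed

subsection \<open>Wavelets in the frequency domain\<close>

text \<open>This is \<open>2 * pi\<close> times the squared modulus of the transform of the wavelet,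
  almost everywhere.\<close>

definition wavelet_square :: "nat \<Rightarrow> (nat \<Rightarrow> real) \<Rightarrow> real \<Rightarrow> real" where
  "wavelet_square n h \<omega> = mask_angle n (\<omega> / 2 + pi) * scaling_square n h (\<omega> / 2)"

lemma wavelet_square_nonneg: "0 \<le> wavelet_square n h \<omega>"
  unfolding wavelet_square_def by (intro mult_nonneg_nonneg mask_angle_bounds scaling_square_nonneg)

lemma wavelet_square_le_mask:
  assumes "daubechies_filter (Suc n) h"
  shows "wavelet_square n h \<omega> \<le> 1 - mask_angle n (\<omega> / 2)"
  using mult_left_mono[OF scaling_square_le_1[OF assms, of "\<omega> / 2"] mask_angle_bounds(1)[of n "\<omega> / 2 + pi"]]
  unfolding wavelet_square_def by (simp add: mask_angle_pi)

lemma wavelet_square_le_scaling: "wavelet_square n h \<omega> \<le> scaling_square n h (\<omega> / 2)"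
  using mult_right_mono[OF mask_angle_bounds(2)[of n "\<omega> / 2 + pi"] scaling_square_nonneg[of n h "\<omega> / 2"]]
  unfolding wavelet_square_def by simp

lemma wavelet_square_le_1:
  assumes "daubechies_filter (Suc n) h"
  shows "wavelet_square n h \<omega> \<le> 1"
  using wavelet_square_le_mask[OF assms, of \<omega>] mask_angle_bounds(1)[of n "\<omega> / 2"] by simp

lemma wavelet_square_decay:
  assumes "daubechies_filter (Suc n) h" "5 \<le> n" "\<omega> \<noteq> 0"
  shows "wavelet_square n h \<omega> \<le> 48 / \<omega>\<^sup>2"
  using order_trans[OF wavelet_square_le_scaling scaling_square_decay[OF assms(1,2), of "\<omega> / 2"]] assms(3)
  by (simp add: power_divide)

text \<open>The high-pass factor vanishes to high order at 0. This is a quantitative form of the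
  vanishing moments, and it absorbs the weight \<open>\<omega>^(-k)\<close>.\<close>

lemma wavelet_square_near_0:
  assumes h: "daubechies_filter (Suc n) h" and w: "\<bar>\<omega>\<bar> \<le> pi"
  shows "wavelet_square n h \<omega> \<le> ((sin (\<omega> / 2))\<^sup>2) ^ n"
proof -
  have "wavelet_square n h \<omega> \<le> (sin (\<omega> / 2 / 2))\<^sup>2 * ((sin (\<omega> / 2))\<^sup>2) ^ n"
    using order_trans[OF wavelet_square_le_mask[OF h] mask_angle_ge[of "\<omega> / 2" n]] w by simp
  also have "\<dots> \<le> 1 * ((sin (\<omega> / 2))\<^sup>2) ^ n" by (intro mult_right_mono sin_sq_bounds) auto
  finally show ?thesis by simp
qed

lemma sin_sq_less_1: "cos x \<noteq> 0 \<Longrightarrow> (sin x)\<^sup>2 < (1::real)"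
  by (simp add: sin_squared_eq)

lemma sin_sq_power_tendsto: "cos x \<noteq> 0 \<Longrightarrow> (\<lambda>n. ((sin x)\<^sup>2) ^ n) \<longlonglongrightarrow> (0::real)"
  by (intro LIMSEQ_realpow_zero sin_sq_less_1) auto

lemma cos_neq_0_outer:
  assumes "pi / 2 < \<bar>x\<bar>" "\<bar>x\<bar> \<le> pi"
  shows "cos x \<noteq> 0"
proof -
  have "cos \<bar>x\<bar> < cos (pi / 2)" using assms by (intro cos_monotone_0_pi) auto
  then show ?thesis by simp
qed

lemma cos_neq_0_inner:
  assumes "\<bar>x\<bar> < pi / 2"
  shows "cos x \<noteq> 0"
proof -
  have "- (pi / 2) < x" "x < pi / 2" using assms by linarith+
  then show ?thesis using cos_gt_zero_pi[of x] by simp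
qed

text \<open>Below \<open>pi\<close> the high-pass factor is small. Beyond \<open>2 * pi\<close> some
  dyadic fraction of \<open>\<omega> / 2\<close> falls into the stop band between
  \<open>pi / 2\<close> and \<open>pi\<close>, and that single low-pass factor decays geometrically
  in \<open>n\<close>.\<close>

lemma wavelet_square_tendsto_0:
  assumes h: "\<And>n. daubechies_filter (Suc n) (h n)" and w: "\<bar>\<omega>\<bar> < pi \<or> 2 * pi < \<bar>\<omega>\<bar>"
  shows "(\<lambda>n. wavelet_square n (h n) \<omega>) \<longlonglongrightarrow> 0"
proof -
  have "\<exists>x. cos x \<noteq> 0 \<and> (\<forall>n. wavelet_square n (h n) \<omega> \<le> ((sin x)\<^sup>2) ^ n)"
  proof (cases "\<bar>\<omega>\<bar> < pi")
    case True
    then show ?thesis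
      using wavelet_square_near_0[OF h, of \<omega>] by (intro exI[of _ "\<omega> / 2"] conjI cos_neq_0_inner) auto
  next
    case False
    then have w: "pi < \<bar>\<omega> / 2\<bar>" using w by simp
    \<comment> \<open>Minimality puts the scaled value above \<open>pi / 2\<close>. The index is
      positive because \<open>\<bar>\<omega> / 2\<bar>\<close> exceeds \<open>pi\<close>, so the
      scale really occurs in the product, whose factors start at \<open>2 ^ Suc 0\<close>.\<close>
    define l where "l = (LEAST l. \<bar>\<omega> / 2\<bar> / 2 ^ l \<le> pi)"
    obtain l0 where "\<bar>\<omega> / 2\<bar> / pi < 2 ^ l0" using real_arch_pow[of 2 "\<bar>\<omega> / 2\<bar> / pi"] by auto
    then have "\<bar>\<omega> / 2\<bar> / 2 ^ l0 \<le> pi" by (simp add: field_simps)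
    then have l: "\<bar>\<omega> / 2\<bar> / 2 ^ l \<le> pi" unfolding l_def by (rule LeastI)
    have "l \<noteq> 0" using l w by (intro notI) simp
    then obtain l' where l': "l = Suc l'" by (cases l) auto
    then have "\<not> \<bar>\<omega> / 2\<bar> / 2 ^ l' \<le> pi" using not_less_Least[of l' "\<lambda>l. \<bar>\<omega> / 2\<bar> / 2 ^ l \<le> pi"] by (simp add: l_def)
    then have x: "pi / 2 < \<bar>\<omega> / 2 / 2 ^ Suc l'\<bar>" "\<bar>\<omega> / 2 / 2 ^ Suc l'\<bar> \<le> pi"
      using l unfolding l' by (simp_all add: field_simps)
    have "wavelet_square n (h n) \<omega> \<le> ((sin (\<omega> / 2 / 2 ^ Suc l'))\<^sup>2) ^ n" for n
      using x by (intro order_trans[OF wavelet_square_le_scaling] order_trans[OF scaling_square_le_mask[OF h, of _ _ l']] mask_angle_le) auto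
    then show ?thesis using cos_neq_0_outer[OF x] by blast
  qed
  then obtain x where x: "cos x \<noteq> 0" "\<And>n. wavelet_square n (h n) \<omega> \<le> ((sin x)\<^sup>2) ^ n" by blast
  show ?thesis
    by (rule tendsto_sandwich[OF _ _ tendsto_const sin_sq_power_tendsto[OF x(1)]])
       (use x(2) wavelet_square_nonneg in auto)
qed

text \<open>On the octave \<open>\<omega> / 2\<close> lies in the stop band of the low-pass filter,
  so the high-pass factor tends to 1; its next halving lies in the pass band, so the scaling factor
  tends to 1 as well.\<close>

lemma wavelet_square_tendsto_1:
  assumes h: "\<And>n. daubechies_filter (Suc n) (h n)" and w: "pi < \<bar>\<omega>\<bar>" "\<bar>\<omega>\<bar> < 2 * pi"
  shows "(\<lambda>n. wavelet_square n (h n) \<omega>) \<longlonglongrightarrow> 1"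
proof (rule tendsto_sandwich[OF _ _ _ tendsto_const])
  let ?a = "\<lambda>n. ((sin (\<omega> / 2))\<^sup>2) ^ n" and ?b = "\<lambda>n. (\<omega> / 2)\<^sup>2 * ((sin (\<omega> / 2 / 2))\<^sup>2) ^ n"
  have "(1 - ?a n) * (1 - ?b n) \<le> wavelet_square n (h n) \<omega>" for n
  proof -
    have "(1 - ?a n) * (1 - ?b n) \<le> (1 - ?a n) * scaling_square n (h n) (\<omega> / 2)"
      using w by (intro mult_left_mono scaling_square_ge h) (auto simp: power_le_one sin_sq_bounds)
    also have "\<dots> \<le> (1 - mask_angle n (\<omega> / 2)) * scaling_square n (h n) (\<omega> / 2)"
      using mask_angle_le[of "\<omega> / 2" n] w by (intro mult_right_mono scaling_square_nonneg) auto
    finally show ?thesis by (simp add: wavelet_square_def mask_angle_pi)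
  qed
  then show "\<forall>\<^sub>F n in sequentially. (1 - ?a n) * (1 - ?b n) \<le> wavelet_square n (h n) \<omega>" by simp
  have "cos (\<omega> / 2) \<noteq> 0" using w by (intro cos_neq_0_outer) auto
  moreover have "cos (\<omega> / 2 / 2) \<noteq> 0" using w by (intro cos_neq_0_inner) auto
  ultimately have "(\<lambda>n. (1 - ?a n) * (1 - ?b n)) \<longlonglongrightarrow> (1 - 0) * (1 - (\<omega> / 2)\<^sup>2 * 0)"
    by (intro tendsto_mult tendsto_diff tendsto_const sin_sq_power_tendsto)
  then show "(\<lambda>n. (1 - ?a n) * (1 - ?b n)) \<longlonglongrightarrow> 1" by simp
qed (use wavelet_square_le_1[OF h] in auto)

definition wavelet_amp :: "nat \<Rightarrow> (nat \<Rightarrow> real) \<Rightarrow> real \<Rightarrow> real" where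
  "wavelet_amp n h \<omega> = sqrt (wavelet_square n h \<omega> / (2 * pi))"

lemma wavelet_amp_nonneg: "0 \<le> wavelet_amp n h \<omega>"
  by (simp add: wavelet_amp_def wavelet_square_nonneg)

text \<open>The integer 6 stands in for \<open>2 * pi\<close> from below.\<close>

lemma wavelet_amp_leI:
  assumes "wavelet_square n h \<omega> \<le> 6 * c\<^sup>2" "0 \<le> c"
  shows "wavelet_amp n h \<omega> \<le> c"
proof -
  have "6 * c\<^sup>2 \<le> c\<^sup>2 * (2 * pi)" using pi_gt3 mult_left_mono[of 6 "2 * pi" "c\<^sup>2"] by simp
  with assms(1) have "wavelet_square n h \<omega> \<le> c\<^sup>2 * (2 * pi)" by (rule order_trans)
  then have "wavelet_square n h \<omega> / (2 * pi) \<le> c\<^sup>2" by (simp only: pos_divide_le_eq pi_gt_zero mult_pos_pos zero_less_numeral)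
  then show ?thesis unfolding wavelet_amp_def using assms(2) by (intro real_le_lsqrt) auto
qed

lemma wavelet_amp_le_1: "daubechies_filter (Suc n) h \<Longrightarrow> wavelet_amp n h \<omega> \<le> 1"
  using wavelet_square_le_1[of n h \<omega>] by (intro wavelet_amp_leI) auto

text \<open>Majorant free of the filter, its order and the weight. Any constant whose square times 6
  reaches 48 would do in place of 4.\<close>

definition amp_bound :: "real \<Rightarrow> real" where
  "amp_bound \<omega> = (if \<bar>\<omega>\<bar> \<le> pi then 1 else 4 / \<bar>\<omega>\<bar>)"

lemma wavelet_amp_weighted_le:
  assumes h: "daubechies_filter (Suc n) h" and n: "5 \<le> n" "j \<le> n" and w: "\<omega> \<noteq> 0"
  shows "wavelet_amp n h \<omega> / \<bar>\<omega>\<bar> ^ j \<le> amp_bound \<omega>"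
proof (cases "\<bar>\<omega>\<bar> \<le> pi")
  case True
  have "wavelet_square n h \<omega> \<le> ((sin (\<omega> / 2))\<^sup>2) ^ n" by (rule wavelet_square_near_0[OF h True])
  \<comment> \<open>With \<open>j <= n\<close> the filter has enough vanishing order to pay for the
    weight \<open>\<bar>\<omega>\<bar> ^ j\<close>.\<close>
  also have "\<dots> \<le> ((sin (\<omega> / 2))\<^sup>2) ^ j" using n by (intro power_decreasing sin_sq_bounds)
  also have "\<dots> \<le> (\<omega>\<^sup>2) ^ j"
  proof (rule power_mono)
    have "\<bar>sin (\<omega> / 2)\<bar> \<le> \<bar>\<omega>\<bar>" using abs_sin_x_le_abs_x[of "\<omega> / 2"] by simp
    then show "(sin (\<omega> / 2))\<^sup>2 \<le> \<omega>\<^sup>2" by (simp only: abs_le_square_iff)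
  qed simp
  also have "\<dots> = (\<bar>\<omega>\<bar> ^ j)\<^sup>2" by (metis power2_abs power_mult mult.commute)
  also have "\<dots> \<le> 6 * (\<bar>\<omega>\<bar> ^ j)\<^sup>2" by simp
  finally have "wavelet_amp n h \<omega> \<le> \<bar>\<omega>\<bar> ^ j" by (rule wavelet_amp_leI) simp
  then show ?thesis using True w by (simp add: amp_bound_def divide_le_eq_1)
next
  case False
  have "wavelet_square n h \<omega> \<le> 48 / \<omega>\<^sup>2" by (rule wavelet_square_decay[OF h n(1) w])
  also have "\<dots> \<le> 6 * (4 / \<bar>\<omega>\<bar>)\<^sup>2" by (simp add: power_divide divide_right_mono)
  finally have "wavelet_amp n h \<omega> \<le> 4 / \<bar>\<omega>\<bar>" by (rule wavelet_amp_leI) simp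
  moreover have "1 \<le> \<bar>\<omega>\<bar> ^ j" using False pi_gt3 by (intro one_le_power) linarith
  then have "wavelet_amp n h \<omega> / \<bar>\<omega>\<bar> ^ j \<le> wavelet_amp n h \<omega> / 1"
    using wavelet_amp_nonneg w by (intro divide_left_mono) auto
  ultimately show ?thesis using False by (simp add: amp_bound_def)
qed

section \<open>Limits of the weighted integrals\<close>

lemma nn_integral_even:
  fixes f :: "real \<Rightarrow> ennreal"
  assumes [measurable]: "f \<in> borel_measurable borel" and even: "\<And>x. f (- x) = f x"
  shows "(\<integral>\<^sup>+x. f x \<partial>lborel) = 2 * (\<integral>\<^sup>+x. f x * indicator {0..} x \<partial>lborel)"
proof -
  have ae: "AE x in lborel. x \<noteq> (0::real)" by (rule AE_lborel_singleton)
  have "(\<integral>\<^sup>+x. f x \<partial>lborel) = (\<integral>\<^sup>+x. f x * indicator {0..} x + f x * indicator {..0} x \<partial>lborel)"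
    using ae by (intro nn_integral_cong_AE) (auto elim!: eventually_mono split: split_indicator)
  also have "\<dots> = (\<integral>\<^sup>+x. f x * indicator {0..} x \<partial>lborel) + (\<integral>\<^sup>+x. f x * indicator {..0} x \<partial>lborel)"
    by (rule nn_integral_add) auto
  also have "(\<integral>\<^sup>+x. f x * indicator {..0} x \<partial>lborel) = (\<integral>\<^sup>+x. f x * indicator {0..} x \<partial>lborel)"
    by (subst nn_integral_real_affine[where c = "-1" and t = 0])
       (auto simp: even split: split_indicator intro!: nn_integral_cong)
  finally show ?thesis by (simp add: mult_2)
qed

lemma DERIV_powr_antiderivative:
  assumes "(s::real) \<noteq> 1" "0 < x"
  shows "DERIV (\<lambda>x. c * (x powr (1 - s) / (1 - s))) x :> c * x powr (- s)"
proof -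
  have "DERIV (\<lambda>x. x powr (1 - s)) x :> (1 - s) * x powr (1 - s - 1)"
    using assms(2) by (rule has_real_derivative_powr)
  from DERIV_cmult[OF DERIV_cdivide[OF this, of "1 - s"], of c] show ?thesis using assms(1) by simp
qed

text \<open>The tail is a multiple of \<open>\<omega> powr (- r)\<close>, integrable at infinity
  because \<open>1 < r\<close>.\<close>

lemma amp_bound_integrable:
  assumes r: "1 < r"
  shows "(\<integral>\<^sup>+\<omega>. ennreal (amp_bound \<omega> powr r) \<partial>lborel) < \<infinity>"
proof -
  have [measurable]: "amp_bound \<in> borel_measurable borel" unfolding amp_bound_def[abs_def] by measurable
  let ?F = "\<lambda>x::real. 4 powr r * (x powr (1 - r) / (1 - r))"
  have tail: "(\<integral>\<^sup>+x. ennreal (4 powr r * x powr (- r)) * indicator {pi..} x \<partial>lborel) = ennreal (0 - ?F pi)"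
  proof (rule nn_integral_FTC_atLeast)
    show "DERIV ?F x :> 4 powr r * x powr (- r)" if "pi \<le> x" for x
    proof -
      have "x > 0" using that pi_gt_zero by linarith
      then show ?thesis using r by (intro DERIV_powr_antiderivative) auto
    qed
    have "((\<lambda>x::real. x powr (1 - r)) \<longlongrightarrow> 0) at_top"
      using r by (intro tendsto_neg_powr filterlim_ident) auto
    then have "(?F \<longlongrightarrow> 4 powr r * (0 / (1 - r))) at_top" using r by (intro tendsto_mult tendsto_divide tendsto_const) auto
    then show "(?F \<longlongrightarrow> 0) at_top" by simp
  qed auto
  have "(\<integral>\<^sup>+\<omega>. ennreal (amp_bound \<omega> powr r) \<partial>lborel) = 2 * (\<integral>\<^sup>+\<omega>. ennreal (amp_bound \<omega> powr r) * indicator {0..} \<omega> \<partial>lborel)"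
    by (rule nn_integral_even) (auto simp: amp_bound_def)
  also have "\<dots> \<le> 2 * (\<integral>\<^sup>+\<omega>. indicator {0..pi} \<omega> + ennreal (4 powr r * \<omega> powr (- r)) * indicator {pi..} \<omega> \<partial>lborel)"
  proof (intro mult_left_mono nn_integral_mono)
    fix \<omega> :: real
    have "(4 / \<omega>) powr r = 4 powr r * \<omega> powr (- r)" if "pi < \<omega>"
    proof -
      have "0 < \<omega>" using that pi_gt_zero by linarith
      then show ?thesis by (simp add: powr_divide powr_minus_divide)
    qed
    then show "ennreal (amp_bound \<omega> powr r) * indicator {0..} \<omega> \<le>
        indicator {0..pi} \<omega> + ennreal (4 powr r * \<omega> powr (- r)) * indicator {pi..} \<omega>"
      using pi_gt_zero by (auto simp: amp_bound_def split: split_indicator)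
  qed auto
  also have "\<dots> = 2 * ((\<integral>\<^sup>+\<omega>. indicator {0..pi} \<omega> \<partial>lborel) + (\<integral>\<^sup>+x. ennreal (4 powr r * x powr (- r)) * indicator {pi..} x \<partial>lborel))"
    by (subst nn_integral_add) auto
  also have "\<dots> < \<infinity>" unfolding tail by (simp add: ennreal_mult_less_top)
  finally show ?thesis .
qed

definition octave :: "real set" where
  "octave = {\<omega>. pi < \<bar>\<omega>\<bar> \<and> \<bar>\<omega>\<bar> < 2 * pi}"

lemma octave_measurable [measurable]: "octave \<in> sets borel"
  unfolding octave_def by measurable

text \<open>Closed form of the integral of the limiting weighted amplitude to the power
  \<open>r\<close>; the leading 2 accounts for the two signs of the frequency.\<close>

definition limit_integral :: "real \<Rightarrow> nat \<Rightarrow> real" where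
  "limit_integral r j = 2 * (2 * pi) powr (- r / 2) *
     ((pi powr (1 - r * real j) - (2 * pi) powr (1 - r * real j)) / (r * real j - 1))"

lemma octave_integral:
  assumes s: "r * real j \<noteq> 1"
  shows "(\<integral>\<^sup>+\<omega>. ennreal (indicator octave \<omega> * (sqrt (1 / (2 * pi)) / \<bar>\<omega>\<bar> ^ j) powr r) \<partial>lborel) = ennreal (limit_integral r j)"
proof -
  define s where "s = r * real j"
  let ?c = "(2 * pi) powr (- r / 2)"
  let ?F = "\<lambda>x::real. ?c * (x powr (1 - s) / (1 - s))"
  have int: "(\<integral>\<^sup>+x. ennreal (?c * x powr (- s)) * indicator {pi..2 * pi} x \<partial>lborel) = ennreal (?F (2 * pi) - ?F pi)"
  proof (rule nn_integral_FTC_Icc)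
    show "DERIV ?F x :> ?c * x powr (- s)" if "x \<in> {pi..2 * pi}" for x
    proof -
      have "x > 0" using that pi_gt_zero by (simp only: atLeastAtMost_iff) linarith
      then show ?thesis using assms by (intro DERIV_powr_antiderivative) (auto simp: s_def)
    qed
  qed auto
  have two: "2 * ennreal x = ennreal (2 * x)" for x by (simp add: ennreal_mult')
  have pw: "(sqrt (1 / (2 * pi)) / x ^ j) powr r = ?c * x powr (- s)" if "x > 0" for x
  proof -
    have "sqrt (1 / (2 * pi)) = (2 * pi) powr (- 1 / 2)"
      by (simp add: powr_half_sqrt[symmetric] powr_minus_divide powr_divide)
    then have "sqrt (1 / (2 * pi)) / x ^ j = (2 * pi) powr (- 1 / 2) * x powr (- real j)"
      using that by (simp add: powr_minus_divide powr_realpow)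
    then show ?thesis using that by (simp add: powr_mult powr_powr s_def mult.commute)
  qed
  have "(\<integral>\<^sup>+\<omega>. ennreal (indicator octave \<omega> * (sqrt (1 / (2 * pi)) / \<bar>\<omega>\<bar> ^ j) powr r) \<partial>lborel) =
      2 * (\<integral>\<^sup>+\<omega>. ennreal (indicator octave \<omega> * (sqrt (1 / (2 * pi)) / \<bar>\<omega>\<bar> ^ j) powr r) * indicator {0..} \<omega> \<partial>lborel)"
    by (rule nn_integral_even) (auto simp: octave_def split: split_indicator)
  also have "(\<integral>\<^sup>+\<omega>. ennreal (indicator octave \<omega> * (sqrt (1 / (2 * pi)) / \<bar>\<omega>\<bar> ^ j) powr r) * indicator {0..} \<omega> \<partial>lborel) =
      (\<integral>\<^sup>+x. ennreal (?c * x powr (- s)) * indicator {pi..2 * pi} x \<partial>lborel)"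
  proof (rule nn_integral_cong_AE)
    have "AE x in lborel. x \<noteq> pi" "AE x in lborel. x \<noteq> 2 * pi" by (rule AE_lborel_singleton)+
    then show "AE \<omega> in lborel. ennreal (indicator octave \<omega> * (sqrt (1 / (2 * pi)) / \<bar>\<omega>\<bar> ^ j) powr r) * indicator {0..} \<omega> =
        ennreal (?c * \<omega> powr (- s)) * indicator {pi..2 * pi} \<omega>"
    proof eventually_elim
      case (elim \<omega>)
      show ?case
      proof (cases "\<omega> \<in> {pi..2 * pi}")
        case True
        then have "\<omega> > 0" using pi_gt_zero by (simp only: atLeastAtMost_iff) linarith
        then show ?thesis using True elim pw[of \<omega>] by (simp add: octave_def)
      next
        case False
        then show ?thesis by (auto simp: octave_def split: split_indicator)
      qed
    qed
  qed
  also have "2 * \<dots> = ennreal (2 * (?F (2 * pi) - ?F pi))" unfolding int by (rule two)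
  also have "2 * (?F (2 * pi) - ?F pi) = limit_integral r j"
  proof -
    have "1 - s = - (s - 1)" by simp
    then have "x / (1 - s) = - (x / (s - 1))" for x by (metis minus_divide_right)
    then show ?thesis
      unfolding limit_integral_def s_def[symmetric] by (simp only:) (simp add: diff_divide_distrib algebra_simps)
  qed
  finally show ?thesis .
qed

text \<open>The product is 0 for \<open>j = 0\<close> and exceeds 1 otherwise, so the antiderivative
  is never logarithmic and no denominator vanishes.\<close>

lemma exponent_neq_1:
  assumes "1 < r"
  shows "r * real j \<noteq> 1"
proof
  assume *: "r * real j = 1"
  then have "1 \<le> j" by (cases j) auto
  then have "1 * 1 < r * real j" using assms by (intro mult_less_le_imp_less) auto
  with * show False by simp
qed

text \<open>The set \<open>S\<close> is free so that one statement covers both sides of the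
  sandwich: the whole line for the upper bound and the denominator, the octave for the lower
  bound.\<close>

theorem amp_integral_tendsto:
  assumes h: "\<And>n. daubechies_filter (Suc n) (h n)" and r: "1 < r"
    and S: "S \<in> sets borel" "octave \<subseteq> S"
    and m: "\<And>n. (\<lambda>\<omega>. wavelet_amp n (h n) \<omega>) \<in> borel_measurable lebesgue"
  shows "(\<lambda>n. \<integral>\<^sup>+\<omega>. ennreal (indicator S \<omega> * (wavelet_amp n (h n) \<omega> / \<bar>\<omega>\<bar> ^ j) powr r) \<partial>lebesgue) \<longlonglongrightarrow>
      ennreal (limit_integral r j)"
proof -
  note s = exponent_neq_1[OF r, of j]
  have ind: "indicat_real S \<in> borel_measurable lebesgue" using S by (intro borel_imp_lebesgue borel_measurable_indicator)
  have pw: "(\<lambda>\<omega>::real. \<bar>\<omega>\<bar> ^ j) \<in> borel_measurable lebesgue" by (rule borel_imp_lebesgue) measurable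
  \<comment> \<open>From this index on \<open>wavelet_amp_weighted_le\<close> provides the majorant:
    5 for the decay, \<open>j\<close> for the weight.\<close>
  define N where "N = max 5 j"
  have "(\<lambda>n. \<integral>\<^sup>+\<omega>. ennreal (indicator S \<omega> * (wavelet_amp (n + N) (h (n + N)) \<omega> / \<bar>\<omega>\<bar> ^ j) powr r) \<partial>lebesgue) \<longlonglongrightarrow>
      (\<integral>\<^sup>+\<omega>. ennreal (indicator octave \<omega> * (sqrt (1 / (2 * pi)) / \<bar>\<omega>\<bar> ^ j) powr r) \<partial>lebesgue)"
  proof (rule nn_integral_dominated_convergence[where w = "\<lambda>\<omega>. ennreal (amp_bound \<omega> powr r)"])
    \<comment> \<open>At 0 the weight is singular; at the four endpoints of the octave no pointwise
      limit has been established.\<close>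
    have ae: "AE \<omega> in lebesgue. \<omega> \<noteq> (0::real)" "AE \<omega> in lebesgue. \<omega> \<noteq> pi" "AE \<omega> in lebesgue. \<omega> \<noteq> - pi"
      "AE \<omega> in lebesgue. \<omega> \<noteq> 2 * pi" "AE \<omega> in lebesgue. \<omega> \<noteq> - (2 * pi)"
      by (rule AE_completion, rule AE_lborel_singleton)+
    show "AE \<omega> in lebesgue. ennreal (indicator S \<omega> * (wavelet_amp (n + N) (h (n + N)) \<omega> / \<bar>\<omega>\<bar> ^ j) powr r) \<le> ennreal (amp_bound \<omega> powr r)" for n
      using ae(1)
    proof eventually_elim
      case (elim \<omega>)
      have "(wavelet_amp (n + N) (h (n + N)) \<omega> / \<bar>\<omega>\<bar> ^ j) powr r \<le> amp_bound \<omega> powr r"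
        using r elim by (intro powr_mono2 wavelet_amp_weighted_le h divide_nonneg_nonneg wavelet_amp_nonneg) (auto simp: N_def)
      then have "indicator S \<omega> * (wavelet_amp (n + N) (h (n + N)) \<omega> / \<bar>\<omega>\<bar> ^ j) powr r \<le> 1 * amp_bound \<omega> powr r"
        by (intro mult_mono) (auto split: split_indicator)
      then show ?case by (intro ennreal_leI) simp
    qed
    show "(\<integral>\<^sup>+\<omega>. ennreal (amp_bound \<omega> powr r) \<partial>lebesgue) < \<infinity>"
      unfolding nn_integral_completion by (rule amp_bound_integrable[OF r])
    show "AE \<omega> in lebesgue. (\<lambda>n. ennreal (indicator S \<omega> * (wavelet_amp (n + N) (h (n + N)) \<omega> / \<bar>\<omega>\<bar> ^ j) powr r)) \<longlonglongrightarrow>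
        ennreal (indicator octave \<omega> * (sqrt (1 / (2 * pi)) / \<bar>\<omega>\<bar> ^ j) powr r)"
      using ae
    proof eventually_elim
      case (elim \<omega>)
      have "(\<lambda>n. wavelet_square n (h n) \<omega>) \<longlonglongrightarrow> indicator octave \<omega>"
      proof (cases "\<omega> \<in> octave")
        case True
        then show ?thesis using wavelet_square_tendsto_1[OF h] by (simp add: octave_def)
      next
        case False
        have "\<bar>\<omega>\<bar> < pi \<or> 2 * pi < \<bar>\<omega>\<bar>" using False elim by (auto simp: octave_def abs_if split: if_splits)
        then show ?thesis using wavelet_square_tendsto_0[OF h] False by simp
      qed
      then have "(\<lambda>n. wavelet_amp n (h n) \<omega>) \<longlonglongrightarrow> sqrt (indicator octave \<omega> / (2 * pi))"
        unfolding wavelet_amp_def by (intro tendsto_intros) auto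
      then have "(\<lambda>n. (wavelet_amp n (h n) \<omega> / \<bar>\<omega>\<bar> ^ j) powr r) \<longlonglongrightarrow> (sqrt (indicator octave \<omega> / (2 * pi)) / \<bar>\<omega>\<bar> ^ j) powr r"
        using r elim by (intro tendsto_powr2 tendsto_divide tendsto_const always_eventually allI divide_nonneg_nonneg wavelet_amp_nonneg) auto
      then have "(\<lambda>n. ennreal (indicator S \<omega> * (wavelet_amp n (h n) \<omega> / \<bar>\<omega>\<bar> ^ j) powr r)) \<longlonglongrightarrow>
          ennreal (indicator S \<omega> * (sqrt (indicator octave \<omega> / (2 * pi)) / \<bar>\<omega>\<bar> ^ j) powr r)"
        by (intro tendsto_ennrealI tendsto_mult tendsto_const)
      \<comment> \<open>The limiting amplitude vanishes off the octave, so \<open>S\<close> leaves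
        no trace in the limit.\<close>
      moreover have "indicator S \<omega> * (sqrt (indicator octave \<omega> / (2 * pi)) / \<bar>\<omega>\<bar> ^ j) powr r =
          indicator octave \<omega> * (sqrt (1 / (2 * pi)) / \<bar>\<omega>\<bar> ^ j) powr r"
        using S(2) r by (auto split: split_indicator)
      ultimately show ?case by (intro LIMSEQ_ignore_initial_segment) simp
    qed
    show "(\<lambda>\<omega>. ennreal (indicator S \<omega> * (wavelet_amp (n + N) (h (n + N)) \<omega> / \<bar>\<omega>\<bar> ^ j) powr r)) \<in> borel_measurable lebesgue" for n
      using ind pw m[of "n + N"] by measurable
    show "(\<lambda>\<omega>. ennreal (indicator octave \<omega> * (sqrt (1 / (2 * pi)) / \<bar>\<omega>\<bar> ^ j) powr r)) \<in> borel_measurable lebesgue"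
      by (rule borel_imp_lebesgue) measurable
    show "(\<lambda>\<omega>. ennreal (amp_bound \<omega> powr r)) \<in> borel_measurable lebesgue"
      unfolding amp_bound_def[abs_def] by (rule borel_imp_lebesgue) measurable
  qed
  then show ?thesis
    unfolding nn_integral_completion octave_integral[OF s] by (rule LIMSEQ_offset)
qed

subsection \<open>Duality\<close>

text \<open>Young's inequality for \<open>a / l\<close> and \<open>b\<close>, where
  \<open>l = A powr (1 / p)\<close> normalizes \<open>a\<close>. For \<open>A = 0\<close> this
  normalization is impossible, but then \<open>a\<close> vanishes almost everywhere.\<close>

lemma Holder_nn_integral_normalized:
  fixes a b :: "'a \<Rightarrow> real"
  assumes m: "a \<in> borel_measurable M" "b \<in> borel_measurable M"
    and nn: "\<And>x. 0 \<le> a x" "\<And>x. 0 \<le> b x"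
    and p: "1 < p" "1 < q" "1 / p + 1 / q = 1"
    and A: "(\<integral>\<^sup>+x. ennreal (a x powr p) \<partial>M) = ennreal A" "0 \<le> A"
    and B: "(\<integral>\<^sup>+x. ennreal (b x powr q) \<partial>M) \<le> 1"
  shows "(\<integral>\<^sup>+x. ennreal (a x * b x) \<partial>M) \<le> ennreal (A powr (1 / p))"
proof (cases "A = 0")
  case True
  then have "AE x in M. ennreal (a x powr p) = 0"
    using A m by (subst nn_integral_0_iff_AE[symmetric]) auto
  then have "AE x in M. ennreal (a x * b x) = 0" by eventually_elim (use nn in auto)
  then have "(\<integral>\<^sup>+x. ennreal (a x * b x) \<partial>M) = 0" using m by (subst nn_integral_0_iff_AE) auto
  then show ?thesis by simp
next
  case False
  define l where "l = A powr (1 / p)"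
  have l: "0 < l" using False A by (simp add: l_def)
  have coeff: "0 \<le> l / p / A" "0 \<le> l / q" using l p A by auto
  have lp: "l powr p = A" using False A p by (simp add: l_def powr_powr)
  have "(\<integral>\<^sup>+x. ennreal (a x * b x) \<partial>M) \<le> (\<integral>\<^sup>+x. ennreal (l / p / A) * ennreal (a x powr p) + ennreal (l / q) * ennreal (b x powr q) \<partial>M)"
  proof (rule nn_integral_mono)
    fix x
    have "(a x / l) * b x \<le> (a x / l) powr p / p + b x powr q / q"
      using p nn l by (intro Youngs_inequality) auto
    then have "l * ((a x / l) * b x) \<le> l * ((a x / l) powr p / p + b x powr q / q)"
      using l by (intro mult_left_mono) auto
    then have "a x * b x \<le> l / p / A * a x powr p + l / q * b x powr q"
      using l nn p by (simp add: powr_divide lp distrib_left mult_ac)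
    then have "ennreal (a x * b x) \<le> ennreal (l / p / A * a x powr p + l / q * b x powr q)" by (rule ennreal_leI)
    also have "\<dots> = ennreal (l / p / A) * ennreal (a x powr p) + ennreal (l / q) * ennreal (b x powr q)"
      using coeff by (simp only: ennreal_plus ennreal_mult powr_ge_zero mult_nonneg_nonneg)
    finally show "ennreal (a x * b x) \<le> ennreal (l / p / A) * ennreal (a x powr p) + ennreal (l / q) * ennreal (b x powr q)" .
  qed
  also have "\<dots> = ennreal (l / p / A) * ennreal A + ennreal (l / q) * (\<integral>\<^sup>+x. ennreal (b x powr q) \<partial>M)"
    using m by (subst nn_integral_add) (auto simp: nn_integral_cmult A)
  also have "\<dots> \<le> ennreal (l / p / A) * ennreal A + ennreal (l / q) * 1"
    by (intro add_mono mult_left_mono B) auto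
  also have "\<dots> = ennreal (l / p / A * A + l / q)"
    using coeff A(2) by (simp only: ennreal_plus ennreal_mult mult_nonneg_nonneg mult_1_right)
  also have "l / p / A * A + l / q = l * (1 / p + 1 / q)" using False by (simp add: distrib_left)
  finally show ?thesis using p by (simp add: l_def)
qed

lemma Lp_norm_le_1_iff:
  assumes "0 < r"
  shows "Lp_norm r f \<le> 1 \<longleftrightarrow> (\<integral>\<^sup>+x. ennreal (cmod (f x) powr r) \<partial>lebesgue) \<le> 1"
proof (cases "(\<integral>\<^sup>+x. ennreal (cmod (f x) powr r) \<partial>lebesgue)")
  case (real I)
  then have "Lp_norm r f = ennreal (I powr (1 / r))" by (simp add: Lp_norm_def Let_def)
  moreover have "I powr (1 / r) \<le> 1 \<longleftrightarrow> I \<le> 1"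
  proof
    assume le: "I powr (1 / r) \<le> 1"
    show "I \<le> 1"
    proof (rule ccontr)
      assume "\<not> I \<le> 1"
      then have "1 < I powr (1 / r)" using assms by (intro gr_one_powr) auto
      with le show False by linarith
    qed
  next
    assume "I \<le> 1"
    then show "I powr (1 / r) \<le> 1" using powr_mono2[of "1 / r" I 1] real assms by simp
  qed
  ultimately show ?thesis using real by simp
qed (simp add: Lp_norm_def top_unique)

lemma conjugate_exponent:
  assumes "1 < (p::real)"
  shows "1 < p / (p - 1)" "1 / p + 1 / (p / (p - 1)) = 1" "(p - 1) * (p / (p - 1)) = p"
  using assms by (auto simp: field_simps)

lemma measurable_abs_power_lebesgue: "(\<lambda>\<omega>::real. \<bar>\<omega>\<bar> ^ k) \<in> borel_measurable lebesgue"
  by (rule borel_imp_lebesgue) measurable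

text \<open>After Parseval the weight \<open>\<bar>\<omega>\<bar> ^ k\<close> is shifted from one
  factor to the other, which is legitimate off the null set where \<open>\<omega> = 0\<close>;
  Hoelder's inequality then pairs \<open>p\<close> with its conjugate exponent.\<close>

lemma L2_inner_le_weighted:
  assumes \<psi>: "\<psi> \<in> Lp 2" and p: "1 < p"
    and A: "(\<integral>\<^sup>+\<omega>. ennreal ((cmod (fourier \<psi> \<omega>) / \<bar>\<omega>\<bar> ^ k) powr p) \<partial>lebesgue) = ennreal A" "0 \<le> A"
    and f: "f \<in> W2 k (p / (p - 1))"
  shows "ennreal (cmod (L2_inner \<psi> f)) \<le> ennreal (A powr (1 / p))"
proof -
  let ?g = "fourier \<psi>" and ?G = "fourier f"
  have f2: "f \<in> Lp 2" and fn: "Lp_norm (p / (p - 1)) (\<lambda>\<omega>. (\<i> * complex_of_real \<omega>) ^ k * ?G \<omega>) \<le> 1"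
    using f by (auto simp: W2_def)
  note g = is_fourier_L2_fourier[OF \<psi>] and G = is_fourier_L2_fourier[OF f2]
  have gm: "?g \<in> borel_measurable lebesgue" and Gm: "?G \<in> borel_measurable lebesgue"
    by (rule Lp_measurable[OF is_fourier_L2_Lp[OF g]], rule Lp_measurable[OF is_fourier_L2_Lp[OF G]])
  note [measurable] = gm Gm measurable_abs_power_lebesgue[of k]
  have "ennreal (cmod (L2_inner \<psi> f)) = ennreal (cmod (LINT \<omega>|lebesgue. ?g \<omega> * cnj (?G \<omega>)))"
    using Parseval_L2[OF \<psi> f2 g G] by (simp add: L2_inner_def)
  also have "\<dots> \<le> (\<integral>\<^sup>+\<omega>. ennreal (cmod (?g \<omega> * cnj (?G \<omega>))) \<partial>lebesgue)"
    by (rule norm_integral_le_nn_integral)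
  also have "\<dots> = (\<integral>\<^sup>+\<omega>. ennreal ((cmod (?g \<omega>) / \<bar>\<omega>\<bar> ^ k) * (\<bar>\<omega>\<bar> ^ k * cmod (?G \<omega>))) \<partial>lebesgue)"
  proof (rule nn_integral_cong_AE)
    have "AE \<omega> in lebesgue. \<omega> \<noteq> (0::real)" by (rule AE_completion, rule AE_lborel_singleton)
    then show "AE \<omega> in lebesgue. ennreal (cmod (?g \<omega> * cnj (?G \<omega>))) =
        ennreal ((cmod (?g \<omega>) / \<bar>\<omega>\<bar> ^ k) * (\<bar>\<omega>\<bar> ^ k * cmod (?G \<omega>)))"
      by eventually_elim (simp add: norm_mult)
  qed
  also have "\<dots> \<le> ennreal (A powr (1 / p))"
  proof (rule Holder_nn_integral_normalized[where q = "p / (p - 1)"])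
    have "(\<integral>\<^sup>+\<omega>. ennreal (cmod ((\<i> * complex_of_real \<omega>) ^ k * ?G \<omega>) powr (p / (p - 1))) \<partial>lebesgue) \<le> 1"
      using fn p by (subst (asm) Lp_norm_le_1_iff) auto
    then show "(\<integral>\<^sup>+\<omega>. ennreal ((\<bar>\<omega>\<bar> ^ k * cmod (?G \<omega>)) powr (p / (p - 1))) \<partial>lebesgue) \<le> 1"
      by (simp add: norm_mult norm_power)
    show "(\<lambda>\<omega>. cmod (?g \<omega>) / \<bar>\<omega>\<bar> ^ k) \<in> borel_measurable lebesgue" by measurable
    show "(\<lambda>\<omega>. \<bar>\<omega>\<bar> ^ k * cmod (?G \<omega>)) \<in> borel_measurable lebesgue" by measurable
  qed (use conjugate_exponent[OF p] p A in auto)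
  finally show ?thesis .
qed

text \<open>Equality in Hoelder's inequality on the octave, where the weight is bounded, so that the
  extremal function has a bounded and compactly supported Fourier transform.\<close>

lemma L2_inner_attained:
  assumes \<psi>: "\<psi> \<in> Lp 2" and p: "1 < p" and le1: "AE \<omega> in lebesgue. cmod (fourier \<psi> \<omega>) \<le> 1"
    and A: "(\<integral>\<^sup>+\<omega>. ennreal (indicator octave \<omega> * (cmod (fourier \<psi> \<omega>) / \<bar>\<omega>\<bar> ^ k) powr p) \<partial>lebesgue) = ennreal A" "0 < A"
  shows "\<exists>f \<in> W2 k (p / (p - 1)). cmod (L2_inner \<psi> f) = A powr (1 / p)"
proof -
  let ?g = "fourier \<psi>" and ?q = "p / (p - 1)"
  note gF = is_fourier_L2_fourier[OF \<psi>]
  have gm: "?g \<in> borel_measurable lebesgue" by (rule Lp_measurable[OF is_fourier_L2_Lp[OF gF]])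
  have om: "indicat_real octave \<in> borel_measurable lebesgue" by (intro borel_imp_lebesgue borel_measurable_indicator octave_measurable)
  note [measurable] = gm om measurable_abs_power_lebesgue[of k]
  define a where "a \<omega> = cmod (?g \<omega>) / \<bar>\<omega>\<bar> ^ k" for \<omega>
  have am[measurable]: "a \<in> borel_measurable lebesgue" unfolding a_def[abs_def] by measurable
  have a0: "0 \<le> a \<omega>" for \<omega> by (simp add: a_def)
  \<comment> \<open>Normalization: \<open>c powr ?q = 1 / A\<close> cancels the integral
    \<open>A\<close>.\<close>
  define c where "c = A powr (- 1 / ?q)"
  have c: "0 < c" using A by (simp add: c_def)
  \<comment> \<open>Modulus of the equality case:
    \<open>\<bar>\<omega>\<bar> ^ k * b \<omega>\<close> is proportional to
    \<open>a \<omega> powr (p - 1)\<close> on the octave. The bound on the transform holds only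
    almost everywhere, and the case distinction makes \<open>b\<close> bounded everywhere.\<close>
  define b where "b \<omega> = indicator octave \<omega> * (if cmod (?g \<omega>) \<le> 1 then c * a \<omega> powr (p - 1) / \<bar>\<omega>\<bar> ^ k else 0)" for \<omega>
  have bm[measurable]: "b \<in> borel_measurable lebesgue" unfolding b_def[abs_def] by measurable
  have b0: "0 \<le> b \<omega>" for \<omega> using c by (simp add: b_def)
  \<comment> \<open>The phase is aligned with that of the wavelet, so the pairing integrates a
    nonnegative function.\<close>
  define G where "G \<omega> = complex_of_real (b \<omega>) * sgn (?g \<omega>)" for \<omega>
  have sgnm: "(\<lambda>z::complex. sgn z) \<in> borel_measurable borel" unfolding sgn_div_norm by measurable
  have Gm: "G \<in> borel_measurable lebesgue"
    unfolding G_def[abs_def]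
  proof (rule borel_measurable_times)
    show "(\<lambda>\<omega>. complex_of_real (b \<omega>)) \<in> borel_measurable lebesgue" using bm by measurable
    show "(\<lambda>\<omega>. sgn (?g \<omega>)) \<in> borel_measurable lebesgue" by (rule measurable_compose[OF gm sgnm])
  qed
  have outer: "1 \<le> \<bar>\<omega>\<bar> ^ k" "0 < \<bar>\<omega>\<bar>" if "\<omega> \<in> octave" for \<omega>
    using that pi_gt3 unfolding octave_def by (auto intro!: one_le_power)
  have Gc: "cmod (G \<omega>) \<le> c" for \<omega>
  proof -
    have "b \<omega> \<le> c"
    proof (cases "\<omega> \<in> octave \<and> cmod (?g \<omega>) \<le> 1")
      case True
      have "a \<omega> \<le> 1" using True outer(1)[of \<omega>] by (auto simp: a_def divide_le_eq_1)
      then have "a \<omega> powr (p - 1) \<le> 1 powr (p - 1)" using p a0 by (intro powr_mono2) auto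
      then have "a \<omega> powr (p - 1) / \<bar>\<omega>\<bar> ^ k \<le> 1" using outer[of \<omega>] True by (simp add: divide_le_eq_1)
      then have "c * (a \<omega> powr (p - 1) / \<bar>\<omega>\<bar> ^ k) \<le> c * 1" using c by (intro mult_left_mono) auto
      then show ?thesis using True by (simp add: b_def)
    next
      case False
      then have "b \<omega> = 0" by (auto simp: b_def)
      then show ?thesis using c by simp
    qed
    then show ?thesis using b0[of \<omega>] c by (simp add: G_def norm_mult norm_sgn)
  qed
  have "G \<omega> = 0" if "2 * pi < \<bar>\<omega>\<bar>" for \<omega> using that by (simp add: G_def b_def octave_def)
  from bounded_support_Lp[OF Gm Gc this] have G2: "G \<in> Lp 2" by simp
  obtain f where f2: "f \<in> Lp 2" and fG: "is_fourier_L2 f G" using ex_inverse_fourier_L2[OF G2] by blast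
  have fe: "AE \<omega> in lebesgue. fourier f \<omega> = G \<omega>"
    by (rule is_fourier_L2_unique[OF is_fourier_L2_fourier[OF f2] fG f2])
  have "(\<integral>\<^sup>+\<omega>. ennreal (cmod ((\<i> * complex_of_real \<omega>) ^ k * fourier f \<omega>) powr ?q) \<partial>lebesgue) \<le>
      (\<integral>\<^sup>+\<omega>. ennreal (1 / A) * ennreal (indicator octave \<omega> * a \<omega> powr p) \<partial>lebesgue)"
  proof (rule nn_integral_mono_AE)
    show "AE \<omega> in lebesgue. ennreal (cmod ((\<i> * complex_of_real \<omega>) ^ k * fourier f \<omega>) powr ?q) \<le>
        ennreal (1 / A) * ennreal (indicator octave \<omega> * a \<omega> powr p)"
      using fe
    proof eventually_elim
      case (elim \<omega>)
      have "cmod ((\<i> * complex_of_real \<omega>) ^ k * fourier f \<omega>) \<le> \<bar>\<omega>\<bar> ^ k * b \<omega>"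
        using b0[of \<omega>] by (simp add: elim G_def norm_mult norm_power norm_sgn mult_left_mono)
      also have "\<dots> \<le> indicator octave \<omega> * (c * a \<omega> powr (p - 1))"
        using c outer[of \<omega>] by (auto simp: b_def split: split_indicator)
      finally have "cmod ((\<i> * complex_of_real \<omega>) ^ k * fourier f \<omega>) powr ?q \<le> (indicator octave \<omega> * (c * a \<omega> powr (p - 1))) powr ?q"
        using p by (intro powr_mono2) auto
      also have "\<dots> = indicator octave \<omega> * (c powr ?q * a \<omega> powr p)"
        using c p conjugate_exponent(3)[OF p] by (auto simp: powr_mult powr_powr split: split_indicator)
      also have "c powr ?q = 1 / A"
      proof -
        have "?q \<noteq> 0" using p by simp
        then have "- 1 / ?q * ?q = - 1" by (rule nonzero_eq_divide_eq[THEN iffD1, OF _ refl])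
        then have "c powr ?q = A powr (- 1)" by (simp only: c_def powr_powr)
        then show ?thesis using A(2) by (simp add: powr_minus_divide)
      qed
      finally have "ennreal (cmod ((\<i> * complex_of_real \<omega>) ^ k * fourier f \<omega>) powr ?q) \<le> ennreal (indicator octave \<omega> * (1 / A * a \<omega> powr p))"
        by (rule ennreal_leI)
      also have "\<dots> = ennreal (1 / A) * ennreal (indicator octave \<omega> * a \<omega> powr p)"
        using A by (subst ennreal_mult[symmetric]) (auto simp: mult_ac)
      finally show ?case .
    qed
  qed
  also have "\<dots> = ennreal (1 / A) * ennreal A"
    using A(1) by (subst nn_integral_cmult) (auto simp: a_def)
  also have "\<dots> = 1" using A(2) by (simp add: ennreal_mult[symmetric])
  finally have "f \<in> W2 k ?q"
    unfolding W2_def using f2 p by (simp add: Lp_norm_le_1_iff)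
  moreover have "cmod (L2_inner \<psi> f) = A powr (1 / p)"
  proof -
    have "L2_inner \<psi> f = L2_inner ?g G" by (rule Parseval_L2[OF \<psi> f2 gF fG])
    also have "\<dots> = (LINT \<omega>|lebesgue. complex_of_real (c * (indicator octave \<omega> * a \<omega> powr p)))"
      unfolding L2_inner_def
    proof (rule integral_cong_AE)
      show "(\<lambda>\<omega>. ?g \<omega> * cnj (G \<omega>)) \<in> borel_measurable lebesgue" using gm Gm by measurable
      show "(\<lambda>\<omega>. complex_of_real (c * (indicator octave \<omega> * a \<omega> powr p))) \<in> borel_measurable lebesgue" by measurable
      show "AE \<omega> in lebesgue. ?g \<omega> * cnj (G \<omega>) = complex_of_real (c * (indicator octave \<omega> * a \<omega> powr p))"
        using le1
      proof eventually_elim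
        case (elim \<omega>)
        have "?g \<omega> * cnj (sgn (?g \<omega>)) = complex_of_real (cmod (?g \<omega>))"
          by (cases "?g \<omega> = 0") (simp_all add: sgn_div_norm scaleR_conv_of_real complex_norm_square[symmetric] power2_eq_square field_simps)
        then have "?g \<omega> * cnj (G \<omega>) = complex_of_real (b \<omega> * cmod (?g \<omega>))"
          by (simp add: G_def mult_ac)
        also have "b \<omega> * cmod (?g \<omega>) = c * (indicator octave \<omega> * a \<omega> powr p)"
        proof (cases "\<omega> \<in> octave")
          case True
          have "cmod (?g \<omega>) = a \<omega> * \<bar>\<omega>\<bar> ^ k" using outer[OF True] by (simp add: a_def)
          then have "b \<omega> * cmod (?g \<omega>) = c * (a \<omega> powr (p - 1) * a \<omega>)"
            using True elim outer[OF True] by (simp add: b_def)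
          also have "a \<omega> powr (p - 1) * a \<omega> = a \<omega> powr p"
            using a0[of \<omega>] p powr_mult_base[of "a \<omega>" "p - 1"] by (simp add: mult.commute)
          finally show ?thesis using True by simp
        qed (simp add: b_def)
        finally show ?case .
      qed
    qed
    also have "\<dots> = complex_of_real (LINT \<omega>|lebesgue. c * (indicator octave \<omega> * a \<omega> powr p))"
      by (rule integral_complex_of_real)
    also have "(LINT \<omega>|lebesgue. c * (indicator octave \<omega> * a \<omega> powr p)) = c * (LINT \<omega>|lebesgue. indicator octave \<omega> * a \<omega> powr p)"
      by (rule integral_mult_right_zero)
    also have "(LINT \<omega>|lebesgue. indicator octave \<omega> * a \<omega> powr p) = A"
      using A by (subst integral_eq_nn_integral) (auto simp: a_def)
    finally have "cmod (L2_inner \<psi> f) = c * A" using c A by (simp add: norm_mult)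
    also have "\<dots> = A powr (- 1 / ?q) * A powr 1" using A by (simp add: c_def)
    also have "\<dots> = A powr (- 1 / ?q + 1)" by (rule powr_add[symmetric])
    also have "- 1 / ?q + 1 = 1 / p" using p by (simp add: field_simps)
    finally show ?thesis .
  qed
  ultimately show ?thesis by blast
qed

text \<open>The formula for the transform of the scaling function holds almost everywhere but is
  evaluated at \<open>\<omega> / 2\<close>; dilations preserve null sets.\<close>

lemma AE_lebesgue_scale:
  assumes c: "c \<noteq> 0" and P: "AE x in lebesgue. P (x::real)"
  shows "AE x in lebesgue. P (c * x)"
proof -
  obtain N where N: "N \<in> null_sets lborel" "{x. \<not> P x} \<subseteq> N"
    using P unfolding AE_completion_iff by (auto simp: eventually_ae_filter)
  have "AE x in lborel. x \<notin> N" by (rule AE_not_in[OF N(1)])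
  then have "AE x in lborel. 0 + c * x \<notin> N"
    using N(1) c by (intro AE_borel_affine) auto
  then have "AE x in lborel. P (c * x)" by eventually_elim (use N(2) in auto)
  then show ?thesis by (rule AE_completion)
qed

lemma wavelet_fourier_norm:
  assumes h: "daubechies_filter (Suc n) h" and \<phi>: "scaling_function (Suc n) h \<phi>"
    and \<psi>: "daubechies_wavelet (Suc n) h \<phi> \<psi>"
  shows "AE \<omega> in lebesgue. cmod (fourier \<psi> \<omega>) = wavelet_amp n h \<omega>"
proof -
  have "AE \<omega> in lebesgue. fourier \<phi> (1 / 2 * \<omega>) =
      1 / complex_of_real (sqrt (2 * pi)) * (\<Prod>l. filter_symbol (Suc n) h (1 / 2 * \<omega> / 2 ^ Suc l))"
    using \<phi> unfolding scaling_function_def by (intro AE_lebesgue_scale[of "1 / 2"]) auto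
  moreover have "AE \<omega> in lebesgue. fourier \<psi> \<omega> =
        exp (- (\<i> * complex_of_real \<omega> / 2)) * cnj (filter_symbol (Suc n) h (\<omega> / 2 + pi)) * fourier \<phi> (\<omega> / 2)"
    using \<psi> unfolding daubechies_wavelet_def by auto
  ultimately show ?thesis
  proof eventually_elim
    case (elim \<omega>)
    have "1 / 2 * \<omega> = \<omega> / 2" by simp
    note e1 = elim(1)[unfolded this]
    have two_pi: "0 \<le> 2 * pi" by simp
    have "cmod (exp (- (\<i> * complex_of_real \<omega> / 2))) = 1" by simp
    then have "(cmod (fourier \<psi> \<omega>))\<^sup>2 = (cmod (filter_symbol (Suc n) h (\<omega> / 2 + pi)))\<^sup>2 * ((1 / sqrt (2 * pi))\<^sup>2 *
        (cmod (\<Prod>l. filter_symbol (Suc n) h (\<omega> / 2 / 2 ^ Suc l)))\<^sup>2)"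
      unfolding elim(2) e1 norm_mult complex_mod_cnj
      by (simp only: power_mult_distrib norm_divide norm_one norm_of_real abs_of_nonneg[OF real_sqrt_ge_zero[OF two_pi]] mult_1_left)
    also have "\<dots> = wavelet_square n h \<omega> / (2 * pi)"
      unfolding filter_symbol_norm[OF h] scaling_square_def[symmetric] wavelet_square_def by (simp add: power_divide)
    finally have "sqrt ((cmod (fourier \<psi> \<omega>))\<^sup>2) = wavelet_amp n h \<omega>" unfolding wavelet_amp_def by simp
    then show ?case by simp
  qed
qed

text \<open>A product of positive factors when \<open>1 < r\<close>, over which the root in
  \<open>limit_value\<close> distributes.\<close>

lemma limit_integral_eq:
  "limit_integral r j = (2 * pi) powr (1 - r / 2) * (pi powr (- (r * real j)) * ((1 - 2 powr (1 - r * real j)) / (r * real j - 1)))"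
proof -
  define s where "s = r * real j"
  have "2 * (2 * pi) powr (- r / 2) * pi powr (1 - s) = (2 * pi) powr (1 - r / 2) * pi powr (- s)"
    by (simp add: powr_diff powr_minus_divide)
  moreover have "pi powr (1 - s) - (2 * pi) powr (1 - s) = pi powr (1 - s) * (1 - 2 powr (1 - s))"
    by (simp add: powr_mult right_diff_distrib)
  ultimately show ?thesis
    unfolding limit_integral_def s_def[symmetric] by (simp add: mult.assoc[symmetric])
qed

text \<open>Numerator and denominator change sign together at \<open>s = 1\<close>, so the base of
  the outer \<open>powr\<close> in the limit is positive.\<close>

lemma octave_factor_pos:
  assumes "(s::real) \<noteq> 1"
  shows "0 < (1 - 2 powr (1 - s)) / (s - 1)"
proof (cases "1 < s")
  case True
  then have "2 powr (1 - s) < 2 powr 0" by (intro powr_less_mono) auto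
  then show ?thesis using True by simp
next
  case False
  then have "2 powr 0 < 2 powr (1 - s)" using assms by (intro powr_less_mono) auto
  then show ?thesis using False assms by (intro divide_neg_neg) auto
qed

lemma limit_integral_pos: "1 < r \<Longrightarrow> 0 < limit_integral r j"
  unfolding limit_integral_eq by (intro mult_pos_pos octave_factor_pos exponent_neq_1) auto

lemma limit_value:
  assumes p: "1 < p" and q: "1 < q"
  shows "limit_integral p k powr (1 / p) / limit_integral q 0 powr (1 / q) =
      (2 * pi) powr (1 / p - 1 / q) / pi ^ k * ((1 - 2 powr (1 - p * real k)) / (p * real k - 1)) powr (1 / p)"
proof -
  define F where "F = (1 - 2 powr (1 - p * real k)) / (p * real k - 1)"
  have F: "0 < F" unfolding F_def by (rule octave_factor_pos[OF exponent_neq_1[OF p]])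
  have "limit_integral p k powr (1 / p) = (2 * pi) powr ((1 - p / 2) * (1 / p)) * (pi powr (- (p * real k) * (1 / p)) * F powr (1 / p))"
    unfolding limit_integral_eq F_def[symmetric] using F by (simp only: powr_mult powr_powr powr_ge_zero mult_nonneg_nonneg less_imp_le)
  also have "(1 - p / 2) * (1 / p) = 1 / p - 1 / 2" using p by (simp add: field_simps)
  also have "- (p * real k) * (1 / p) = - real k" using p by simp
  also have "pi powr (- real k) = 1 / pi ^ k" by (simp add: powr_minus_divide powr_realpow)
  finally have 1: "limit_integral p k powr (1 / p) = (2 * pi) powr (1 / p - 1 / 2) * (1 / pi ^ k * F powr (1 / p))" .
  \<comment> \<open>For \<open>j = 0\<close> the last factor of \<open>limit_integral_eq\<close> is
    \<open>(1 - 2) / (0 - 1) = 1\<close>.\<close>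
  have "limit_integral q 0 powr (1 / q) = (2 * pi) powr ((1 - q / 2) * (1 / q))"
    unfolding limit_integral_eq by (simp add: powr_powr)
  also have "(1 - q / 2) * (1 / q) = 1 / q - 1 / 2" using q by (simp add: field_simps)
  finally have 2: "limit_integral q 0 powr (1 / q) = (2 * pi) powr (1 / q - 1 / 2)" .
  have "(2 * pi) powr (1 / p - 1 / 2) / (2 * pi) powr (1 / q - 1 / 2) = (2 * pi) powr (1 / p - 1 / q)"
    by (simp add: powr_diff[symmetric])
  then show ?thesis unfolding 1 2 F_def[symmetric] by (metis times_divide_eq_left times_divide_eq_right mult.commute mult_1)
qed

theorem theorem1:
  fixes k :: nat and p q :: real
    and h :: "nat \<Rightarrow> nat \<Rightarrow> real"
    and \<phi> \<psi> :: "nat \<Rightarrow> real \<Rightarrow> complex"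
  assumes "1 < p" and "1 < q"
    and "\<And>m. 1 \<le> m \<Longrightarrow> daubechies_filter m (h m)"
    and "\<And>m. 1 \<le> m \<Longrightarrow> scaling_function m (h m) (\<phi> m)"
    and "\<And>m. 1 \<le> m \<Longrightarrow> daubechies_wavelet m (h m) (\<phi> m) (\<psi> m)"
  shows "(\<lambda>m. C_const k p q (\<psi> m)) \<longlonglongrightarrow>
    ennreal ((2 * pi) powr (1 / p - 1 / q) / pi ^ k *
      ((1 - 2 powr (1 - p * real k)) / (p * real k - 1)) powr (1 / p))"
proof -
  note p = assms(1) and q = assms(2)
  \<comment> \<open>Orders are shifted by one, since the hypotheses say nothing about order
    0.\<close>
  define H where "H n = h (Suc n)" for n
  define f where "f n = \<psi> (Suc n)" for n
  have H: "daubechies_filter (Suc n) (H n)" for n using assms(3) by (simp add: H_def)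
  have f2: "f n \<in> Lp 2" for n using assms(5)[of "Suc n"] by (simp add: f_def daubechies_wavelet_def)
  have amp: "AE \<omega> in lebesgue. cmod (fourier (f n) \<omega>) = wavelet_amp n (H n) \<omega>" for n
    using assms(4,5)[of "Suc n"] H[of n] unfolding H_def f_def by (intro wavelet_fourier_norm) auto
  have fm: "fourier (f n) \<in> borel_measurable lebesgue" for n
    by (rule Lp_measurable[OF is_fourier_L2_Lp[OF is_fourier_L2_fourier[OF f2]]])
  have le1: "AE \<omega> in lebesgue. cmod (fourier (f n) \<omega>) \<le> 1" for n
    using amp[of n] by eventually_elim (use wavelet_amp_le_1[OF H] in auto)
  have ampm: "(\<lambda>\<omega>. wavelet_amp n (H n) \<omega>) \<in> borel_measurable lebesgue" for n
  proof -
    have "(\<lambda>\<omega>. cmod (fourier (f n) \<omega>)) \<in> borel_measurable lebesgue" using fm by measurable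
    then show ?thesis using amp by (rule borel_measurable_AE)
  qed
  define T where "T S r j n = (\<integral>\<^sup>+\<omega>. ennreal (indicator S \<omega> * (cmod (fourier (f n) \<omega>) / \<bar>\<omega>\<bar> ^ j) powr r) \<partial>lebesgue)" for S r j n
  have T: "T S r j \<longlonglongrightarrow> ennreal (limit_integral r j)" if "1 < r" "S \<in> sets borel" "octave \<subseteq> S" for S r j
  proof -
    have "T S r j = (\<lambda>n. \<integral>\<^sup>+\<omega>. ennreal (indicator S \<omega> * (wavelet_amp n (H n) \<omega> / \<bar>\<omega>\<bar> ^ j) powr r) \<partial>lebesgue)"
    proof
      show "T S r j n = (\<integral>\<^sup>+\<omega>. ennreal (indicator S \<omega> * (wavelet_amp n (H n) \<omega> / \<bar>\<omega>\<bar> ^ j) powr r) \<partial>lebesgue)" for n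
        unfolding T_def using amp[of n] by (intro nn_integral_cong_AE) (auto elim: eventually_mono)
    qed
    then show ?thesis using amp_integral_tendsto[OF H that ampm, of j] by (simp only:)
  qed
  \<comment> \<open>A finite positive limit makes the integrals eventually finite and positive, so
    that roots and quotients can be taken in the reals.\<close>
  have Tfin: "\<forall>\<^sub>F n in sequentially. T S r j n = ennreal (enn2real (T S r j n)) \<and> 0 < enn2real (T S r j n)"
    and Treal: "(\<lambda>n. enn2real (T S r j n)) \<longlonglongrightarrow> limit_integral r j"
    if S: "1 < r" "S \<in> sets borel" "octave \<subseteq> S" for S r j
  proof -
    have L: "0 < limit_integral r j" by (rule limit_integral_pos[OF S(1)])
    show R: "(\<lambda>n. enn2real (T S r j n)) \<longlonglongrightarrow> limit_integral r j"
      using T[OF S] L by (intro tendsto_enn2real) auto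
    have "\<forall>\<^sub>F n in sequentially. T S r j n < top" using order_tendstoD(2)[OF T[OF S], where a = top] by simp
    moreover have "\<forall>\<^sub>F n in sequentially. 0 < enn2real (T S r j n)" by (rule order_tendstoD(1)[OF R L])
    ultimately show "\<forall>\<^sub>F n in sequentially. T S r j n = ennreal (enn2real (T S r j n)) \<and> 0 < enn2real (T S r j n)"
      by eventually_elim auto
  qed
  note full = Tfin[OF p, of UNIV k, simplified] and oct = Tfin[OF p, of octave k, simplified] and den = Tfin[OF q, of UNIV 0, simplified]
  define Q where "Q n = enn2real (T UNIV q 0 n) powr (1 / q)" for n
  define up where "up n = enn2real (T UNIV p k n) powr (1 / p) / Q n" for n
  define lo where "lo n = enn2real (T octave p k n) powr (1 / p) / Q n" for n
  let ?L = "limit_integral p k powr (1 / p) / limit_integral q 0 powr (1 / q)"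
  have Q: "Q \<longlonglongrightarrow> limit_integral q 0 powr (1 / q)"
    unfolding Q_def using Treal[OF q, of UNIV 0] limit_integral_pos[OF q, of 0] by (intro tendsto_powr tendsto_const) auto
  have up: "up \<longlonglongrightarrow> ?L"
    unfolding up_def using Treal[OF p, of UNIV k] limit_integral_pos[OF p, of k] limit_integral_pos[OF q, of 0]
    by (intro tendsto_divide tendsto_powr tendsto_const Q) auto
  have lo: "lo \<longlonglongrightarrow> ?L"
    unfolding lo_def using Treal[OF p, of octave k] limit_integral_pos[OF p, of k] limit_integral_pos[OF q, of 0]
    by (intro tendsto_divide tendsto_powr tendsto_const Q) auto
  have Qn: "\<forall>\<^sub>F n in sequentially. Lp_norm q (fourier (f n)) = ennreal (Q n) \<and> 0 < Q n"
    using den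
  proof eventually_elim
    case (elim n)
    have I: "(\<integral>\<^sup>+\<omega>. ennreal (cmod (fourier (f n) \<omega>) powr q) \<partial>lebesgue) = T UNIV q 0 n" by (simp add: T_def)
    have "T UNIV q 0 n \<noteq> \<infinity>" using elim by (metis ennreal_neq_top infinity_ennreal_def)
    then have "Lp_norm q (fourier (f n)) = ennreal (Q n)" unfolding Lp_norm_def I Let_def Q_def by simp
    then show ?case using elim by (simp add: Q_def)
  qed
  have "(\<lambda>n. C_const k p q (f n)) \<longlonglongrightarrow> ennreal ?L"
  \<comment> \<open>The bounds differ only in the domain of the numerator integral, line versus
    octave, and have the same limit.\<close>
  proof (rule tendsto_sandwich[OF _ _ tendsto_ennrealI[OF lo] tendsto_ennrealI[OF up]])
    show "\<forall>\<^sub>F n in sequentially. C_const k p q (f n) \<le> ennreal (up n)"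
      using Qn full
    proof eventually_elim
      case (elim n)
      have A: "(\<integral>\<^sup>+\<omega>. ennreal ((cmod (fourier (f n) \<omega>) / \<bar>\<omega>\<bar> ^ k) powr p) \<partial>lebesgue) = ennreal (enn2real (T UNIV p k n))"
        using elim by (simp add: T_def)
      show ?case
        unfolding C_const_def
      proof (rule SUP_least)
        fix g assume "g \<in> W2 k (p / (p - 1))"
        from L2_inner_le_weighted[OF f2 p A _ this]
        have "ennreal (cmod (L2_inner (f n) g)) \<le> ennreal (enn2real (T UNIV p k n) powr (1 / p))" by simp
        then have "ennreal (cmod (L2_inner (f n) g)) / ennreal (Q n) \<le> ennreal (enn2real (T UNIV p k n) powr (1 / p)) / ennreal (Q n)"
          by (rule divide_right_mono_ennreal)
        then show "ennreal (cmod (L2_inner (f n) g)) / Lp_norm q (fourier (f n)) \<le> ennreal (up n)"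
          using elim by (simp add: divide_ennreal up_def)
      qed
    qed
    show "\<forall>\<^sub>F n in sequentially. ennreal (lo n) \<le> C_const k p q (f n)"
      using Qn oct
    proof eventually_elim
      case (elim n)
      have A: "(\<integral>\<^sup>+\<omega>. ennreal (indicator octave \<omega> * (cmod (fourier (f n) \<omega>) / \<bar>\<omega>\<bar> ^ k) powr p) \<partial>lebesgue) = ennreal (enn2real (T octave p k n))"
        using elim by (simp add: T_def)
      obtain g where g: "g \<in> W2 k (p / (p - 1))" "cmod (L2_inner (f n) g) = enn2real (T octave p k n) powr (1 / p)"
        using L2_inner_attained[OF f2 p le1 A] elim by blast
      have "ennreal (lo n) = ennreal (cmod (L2_inner (f n) g)) / Lp_norm q (fourier (f n))"
        using elim by (simp add: g(2) divide_ennreal lo_def)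
      also have "\<dots> \<le> C_const k p q (f n)"
        unfolding C_const_def by (rule SUP_upper[OF g(1)])
      finally show ?case .
    qed
  qed
  then have "(\<lambda>m. C_const k p q (\<psi> m)) \<longlonglongrightarrow> ennreal ?L"
    unfolding f_def by (rule LIMSEQ_imp_Suc)
  then show ?thesis unfolding limit_value[OF p q] .
qed

end
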